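(* Suppose that $f_0:\Gamma_-\to\mathbb{R}$ is bounded (and Borel measurable) and satisfies at least one of: (1) $f_0(x,\cdot)$ is continuous on $\Gamma_{-,x}$ for almost all $x\in\partial\Omega$; (2) $f_0(\cdot,\xi)$ is continuous on $\Gamma_{-,\xi}$ for almost all $\xi\in S^{d-1}$. Let $f$ be the solution (in the sense defined in the context) to the boundary value problem $$\xi\cdot\nabla_x f(x,\xi)+\mu_t(x)f(x,\xi)=\mu_s(x)\int_{S^{d-1}}p(x,\xi,\xi')f(x,\xi')\,d\sigma_{\xi'}\ \text{ on }\Omega_0\times S^{d-1},\qquad f=f_0\ \text{ on }\Gamma_-.$$ Then $f$ can be extended up to $\Gamma_+$ (that is, the limits below exist) by $$\overline{f}(x,\xi):=\begin{cases} f(x,\xi), & (x,\xi)\in D,\\ \displaystyle\lim_{t\downarrow0}f(x-t\xi,\xi), & (x,\xi)\in\Gamma_+.\end{cases}$$ Moreover, $$\operatorname{disc}(\overline{f})=\{(x_*+t\xi_*,\xi_* )\mid (x_*,\xi_* )\in\operatorname{disc}(f_0),\ 0\le t\le\tau_+(x_*,\xi_* )\}.$$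
   Context: Let $d\in\{2,3\}$; $S^{d-1}$ is the unit sphere of $\mathbb{R}^d$ and $d\sigma$ is the Lebesgue (surface) measure on it. $\Omega\subset\mathbb{R}^d$ is a bounded convex domain with $C^1$ boundary and outer unit normal $n(x)$ at $x\in\partial\Omega$. $\overline{\Omega}=\bigcup_{j=1}^N\overline{\Omega_j}$, where $\Omega_1,\dots,\Omega_N$ are disjoint open subdomains of $\Omega$ with piecewise $C^1$ boundaries, and $\Omega_0:=\bigcup_{j=1}^N\Omega_j$. Generalized convexity condition (assumed): for every $(x,\xi)\in\Omega\times S^{d-1}$ there are a positive integer $l(x,\xi)$ and reals $0\le t_1(x,\xi)<\dots<t_{l(x,\xi)}(x,\xi)$ such that, for $t\ge0$, $x-t\xi\in\partial\Omega_0$ if and only if $t=t_j(x,\xi)$ for some $j$; moreover $\sup_{(x,\xi)\in\Omega\times S^{d-1}}l(x,\xi)<\infty$. Put $t_0(x,\xi)=0$. Coefficients: $\mu_t,\mu_s$ are nonnegative bounded functions on $\mathbb{R}^d$, continuous on $\Omega_0$, with $\mu_t\ge\mu_s$ on $\Omega_0$ and $\mu_t=\mu_s=0$ on $\mathbb{R}^d\setminus\Omega_0$. $p$ is a nonnegative bounded function on $\mathbb{R}^d\times S^{d-1}\times S^{d-1}$, continuous on $\Omega_0\times S^{d-1}\times S^{d-1}$, zero on $(\mathbb{R}^d\setminus\Omega_0)\times S^{d-1}\times S^{d-1}$, with $\int_{S^{d-1}}p(x,\xi,\xi')\,d\sigma_{\xi'}=1$ for all $(x,\xi)\in\Omega_0\times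 S^{d-1}$. Notation: $\Gamma_\pm:=\{(x,\xi)\in\partial\Omega\times S^{d-1}\mid \pm n(x)\cdot\xi>0\}$; $D:=(\Omega\times S^{d-1})\cup\Gamma_-$; $\overline{D}:=D\cup\Gamma_+$; $\tau_\pm(x,\xi):=\inf\{t>0\mid x\pm t\xi\notin\Omega\}$ for $(x,\xi)\in\overline{D}$; $\Gamma_{-,\xi}:=\{x\in\partial\Omega\mid n(x)\cdot\xi<0\}$ for $\xi\in S^{d-1}$; $\Gamma_{-,x}:=\{\xi\in S^{d-1}\mid n(x)\cdot\xi<0\}$ for $x\in\partial\Omega$. "Almost all" refers to surface measure on $\partial\Omega$, respectively on $S^{d-1}$. For a function $g$, $\operatorname{disc}(g)$ is the set of points of its domain at which $g$ is discontinuous ($\overline f$ has domain $\overline D$, $f_0$ has domain $\Gamma_-$). The directional derivative is $\xi\cdot\nabla_xf(x,\xi):=\frac{d}{dt}f(x+t\xi,\xi)\big|_{t=0}$. A solution to the boundary value problem is a bounded function $f$ on $D$ (for which the integral in the equation is defined) such that: (i) $\xi\cdot\nabla_xf(x,\xi)$ exists at all $(x,\xi)\in\Omega_0\times S^{d-1}$; (ii) $f$ satisfies the equation for all $(x,\xi)\in\Omega_0\times S^{d-1}$ and the boundary condition for all $(x,\xi)\in\Gamma_-$; (iii) $f(\cdot,\xi)$ is continuous along the line $\{x+t\xi\mid t\in\mathbb{R}\}\cap(\Omega\cup\Gamma_{-,\xi})$ for all $(x,\xi)\in D$; (iv) for all $(x,\xi)\in\Omega_0\times S^{d-1}$, $\xi\cdot\nabla_xf(\cdot,\xi)$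 is continuous on the open segments $\{x-t\xi\mid t\in(t_{j-1}(x,\xi),t_j(x,\xi))\}$, $j=1,\dots,l(x,\xi)$. Under the stated assumptions on $f_0$ the solution exists and is unique. *)

theory Defs
  imports "HOL-Analysis.Analysis"
begin

text \<open>The surface measure of a Borel set \<open>A\<close> of unit vectors is \<open>d\<close> times the Lebesgue measure of the
  solid cone \<open>{r \<omega> | 0 < r \<le> 1, \<omega> \<in> A}\<close>, that is, of the points of the punctured unit ball whose
  direction \<open>sgn x = x / |x|\<close> lies in \<open>A\<close>. The completion makes it the Lebesgue measure on the sphere.\<close>

definition sphere_measure :: "'a::euclidean_space measure" where
  "sphere_measure = completion (scale_measure (of_nat DIM('a))
     (distr (restrict_space lborel (cball 0 1 - {0})) (restrict_space borel (sphere 0 1)) sgn))"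

text \<open>Hausdorff outer measure of integer dimension \<open>k \<ge> 1\<close>, normalised to be the \<open>k\<close>-dimensional area
  on \<open>k\<close>-dimensional \<open>C\<^sup>1\<close> surfaces. (For \<open>k = 0\<close> the convention \<open>0 ^ 0 = 1\<close> would give empty covering
  sets a positive weight.)\<close>

definition hausdorff_pre :: "nat \<Rightarrow> real \<Rightarrow> 'a::euclidean_space set \<Rightarrow> ennreal" where
  "hausdorff_pre k \<delta> A =
     (INF U \<in> {U :: nat \<Rightarrow> 'a set. A \<subseteq> (\<Union>i. U i) \<and> (\<forall>i. bounded (U i) \<and> diameter (U i) \<le> \<delta>)}.
        \<Sum>i. ennreal (unit_ball_vol (real k) * (diameter (U i) / 2) ^ k))"

definition hausdorff_outer :: "nat \<Rightarrow> 'a::euclidean_space set \<Rightarrow> ennreal" where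
  "hausdorff_outer k A = (SUP \<delta> \<in> {0<..}. hausdorff_pre k \<delta> A)"

definition surface_null :: "'a::euclidean_space set \<Rightarrow> bool" where
  "surface_null A \<longleftrightarrow> hausdorff_outer (DIM('a) - 1) A = 0"

definition is_domain :: "'a::euclidean_space set \<Rightarrow> bool" where
  "is_domain A \<longleftrightarrow> open A \<and> connected A \<and> A \<noteq> {}"

definition regular_C1 :: "'a::euclidean_space set \<Rightarrow> ('a \<Rightarrow> real) \<Rightarrow> ('a \<Rightarrow> 'a) \<Rightarrow> bool" where
  "regular_C1 U \<rho> G \<longleftrightarrow>
     open U \<and> (\<forall>x\<in>U. GDERIV \<rho> x :> G x \<and> G x \<noteq> 0) \<and> continuous_on U G"

definition defining_function ::
  "'a::euclidean_space set \<Rightarrow> 'a \<Rightarrow> 'a set \<Rightarrow> ('a \<Rightarrow> real) \<Rightarrow> ('a \<Rightarrow> 'a) \<Rightarrow> bool" where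
  "defining_function \<Omega> z U \<rho> G \<longleftrightarrow>
     z \<in> U \<and> regular_C1 U \<rho> G \<and> \<Omega> \<inter> U = {x\<in>U. \<rho> x < 0} \<and> frontier \<Omega> \<inter> U = {x\<in>U. \<rho> x = 0}"

definition C1_boundary :: "'a::euclidean_space set \<Rightarrow> bool" where
  "C1_boundary \<Omega> \<longleftrightarrow> (\<forall>z\<in>frontier \<Omega>. \<exists>U \<rho> G. defining_function \<Omega> z U \<rho> G)"

definition outer_normal :: "'a::euclidean_space set \<Rightarrow> 'a \<Rightarrow> 'a" where
  "outer_normal \<Omega> z = (THE v. \<exists>U \<rho> G. defining_function \<Omega> z U \<rho> G \<and> v = sgn (G z))"

definition C1_hypersurface :: "'a::euclidean_space set \<Rightarrow> bool" where
  "C1_hypersurface M \<longleftrightarrow>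
     (\<forall>z\<in>M. \<exists>U \<rho> G. z \<in> U \<and> regular_C1 U \<rho> G \<and> M \<inter> U = {x\<in>U. \<rho> x = 0})"

text \<open>The boundary consists of finitely many (relatively open) \<open>C\<^sup>1\<close> faces, up to edges and
  vertices, which are limits of faces and have no area.\<close>

definition piecewise_C1_boundary :: "'a::euclidean_space set \<Rightarrow> bool" where
  "piecewise_C1_boundary \<Omega> \<longleftrightarrow>
     (\<exists>\<M>. finite \<M> \<and> (\<forall>M\<in>\<M>. C1_hypersurface M) \<and>
        frontier \<Omega> = (\<Union>M\<in>\<M>. closure M) \<and> surface_null (frontier \<Omega> - \<Union>\<M>))"

definition generalized_convexity ::
  "'a::euclidean_space set \<Rightarrow> 'a set \<Rightarrow> ('a \<Rightarrow> 'a \<Rightarrow> nat) \<Rightarrow> ('a \<Rightarrow> 'a \<Rightarrow> nat \<Rightarrow> real) \<Rightarrow> bool" where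
  "generalized_convexity \<Omega> \<Omega>\<^sub>0 l T \<longleftrightarrow>
     (\<forall>x\<in>\<Omega>. \<forall>\<xi>\<in>sphere 0 1.
        1 \<le> l x \<xi> \<and> T x \<xi> 0 = 0 \<and> 0 \<le> T x \<xi> 1 \<and> strict_mono_on {1..l x \<xi>} (T x \<xi>) \<and>
        (\<forall>t\<ge>0. x - t *\<^sub>R \<xi> \<in> frontier \<Omega>\<^sub>0 \<longleftrightarrow> (\<exists>j\<in>{1..l x \<xi>}. t = T x \<xi> j))) \<and>
     (\<exists>L. \<forall>x\<in>\<Omega>. \<forall>\<xi>\<in>sphere 0 1. l x \<xi> \<le> L)"

definition Gamma_plus :: "'a::euclidean_space set \<Rightarrow> ('a \<times> 'a) set" where
  "Gamma_plus \<Omega> = {(x, \<xi>). x \<in> frontier \<Omega> \<and> \<xi> \<in> sphere 0 1 \<and> outer_normal \<Omega> x \<bullet> \<xi> > 0}"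

definition Gamma_minus :: "'a::euclidean_space set \<Rightarrow> ('a \<times> 'a) set" where
  "Gamma_minus \<Omega> = {(x, \<xi>). x \<in> frontier \<Omega> \<and> \<xi> \<in> sphere 0 1 \<and> outer_normal \<Omega> x \<bullet> \<xi> < 0}"

definition Gamma_minus_dir :: "'a::euclidean_space set \<Rightarrow> 'a \<Rightarrow> 'a set" where
  "Gamma_minus_dir \<Omega> \<xi> = {x \<in> frontier \<Omega>. outer_normal \<Omega> x \<bullet> \<xi> < 0}"

definition Gamma_minus_pt :: "'a::euclidean_space set \<Rightarrow> 'a \<Rightarrow> 'a set" where
  "Gamma_minus_pt \<Omega> x = {\<xi> \<in> sphere 0 1. outer_normal \<Omega> x \<bullet> \<xi> < 0}"

definition phase_dom :: "'a::euclidean_space set \<Rightarrow> ('a \<times> 'a) set" where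
  "phase_dom \<Omega> = (\<Omega> \<times> sphere 0 1) \<union> Gamma_minus \<Omega>"

definition phase_dom_bar :: "'a::euclidean_space set \<Rightarrow> ('a \<times> 'a) set" where
  "phase_dom_bar \<Omega> = phase_dom \<Omega> \<union> Gamma_plus \<Omega>"

definition tau_plus :: "'a::euclidean_space set \<Rightarrow> 'a \<Rightarrow> 'a \<Rightarrow> real" where
  "tau_plus \<Omega> x \<xi> = Inf {t. t > 0 \<and> x + t *\<^sub>R \<xi> \<notin> \<Omega>}"

definition disc :: "'b::t2_space set \<Rightarrow> ('b \<Rightarrow> 'c::topological_space) \<Rightarrow> 'b set" where
  "disc A g = {z \<in> A. \<not> continuous (at z within A) g}"

definition dir_deriv :: "('a::euclidean_space \<times> 'a \<Rightarrow> real) \<Rightarrow> 'a \<Rightarrow> 'a \<Rightarrow> real" where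
  "dir_deriv f x \<xi> = deriv (\<lambda>t. f (x + t *\<^sub>R \<xi>, \<xi>)) 0"

definition admissible_coefficients ::
  "'a::euclidean_space set \<Rightarrow> ('a \<Rightarrow> real) \<Rightarrow> ('a \<Rightarrow> real) \<Rightarrow> bool" where
  "admissible_coefficients \<Omega>\<^sub>0 \<mu>\<^sub>t \<mu>\<^sub>s \<longleftrightarrow>
     (\<forall>x. 0 \<le> \<mu>\<^sub>t x \<and> 0 \<le> \<mu>\<^sub>s x) \<and> bounded (range \<mu>\<^sub>t) \<and> bounded (range \<mu>\<^sub>s) \<and>
     continuous_on \<Omega>\<^sub>0 \<mu>\<^sub>t \<and> continuous_on \<Omega>\<^sub>0 \<mu>\<^sub>s \<and>
     (\<forall>x\<in>\<Omega>\<^sub>0. \<mu>\<^sub>s x \<le> \<mu>\<^sub>t x) \<and> (\<forall>x. x \<notin> \<Omega>\<^sub>0 \<longrightarrow> \<mu>\<^sub>t x = 0 \<and> \<mu>\<^sub>s x = 0)"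

definition phase_function ::
  "'a::euclidean_space set \<Rightarrow> ('a \<Rightarrow> 'a \<Rightarrow> 'a \<Rightarrow> real) \<Rightarrow> bool" where
  "phase_function \<Omega>\<^sub>0 p \<longleftrightarrow>
     (\<forall>x. \<forall>\<xi>\<in>sphere 0 1. \<forall>\<xi>'\<in>sphere 0 1. 0 \<le> p x \<xi> \<xi>') \<and>
     (\<exists>B. \<forall>x. \<forall>\<xi>\<in>sphere 0 1. \<forall>\<xi>'\<in>sphere 0 1. p x \<xi> \<xi>' \<le> B) \<and>
     continuous_on (\<Omega>\<^sub>0 \<times> sphere 0 1 \<times> sphere 0 1) (\<lambda>(x, \<xi>, \<xi>'). p x \<xi> \<xi>') \<and>
     (\<forall>x. x \<notin> \<Omega>\<^sub>0 \<longrightarrow> (\<forall>\<xi>\<in>sphere 0 1. \<forall>\<xi>'\<in>sphere 0 1. p x \<xi> \<xi>' = 0)) \<and>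
     (\<forall>x\<in>\<Omega>\<^sub>0. \<forall>\<xi>\<in>sphere 0 1. (LINT \<xi>'|sphere_measure. p x \<xi> \<xi>') = 1)"

definition bvp_solution ::
  "'a::euclidean_space set \<Rightarrow> 'a set \<Rightarrow> ('a \<Rightarrow> 'a \<Rightarrow> nat) \<Rightarrow> ('a \<Rightarrow> 'a \<Rightarrow> nat \<Rightarrow> real) \<Rightarrow>
   ('a \<Rightarrow> real) \<Rightarrow> ('a \<Rightarrow> real) \<Rightarrow> ('a \<Rightarrow> 'a \<Rightarrow> 'a \<Rightarrow> real) \<Rightarrow>
   ('a \<times> 'a \<Rightarrow> real) \<Rightarrow> ('a \<times> 'a \<Rightarrow> real) \<Rightarrow> bool" where
  "bvp_solution \<Omega> \<Omega>\<^sub>0 l T \<mu>\<^sub>t \<mu>\<^sub>s p f\<^sub>0 f \<longleftrightarrow>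
     bounded (f ` phase_dom \<Omega>) \<and>
     (\<forall>x\<in>\<Omega>\<^sub>0. \<forall>\<xi>\<in>sphere 0 1. integrable sphere_measure (\<lambda>\<xi>'. p x \<xi> \<xi>' * f (x, \<xi>'))) \<and>
     (\<forall>x\<in>\<Omega>\<^sub>0. \<forall>\<xi>\<in>sphere 0 1. (\<lambda>t. f (x + t *\<^sub>R \<xi>, \<xi>)) differentiable (at (0::real))) \<and>
     (\<forall>x\<in>\<Omega>\<^sub>0. \<forall>\<xi>\<in>sphere 0 1.
        dir_deriv f x \<xi> + \<mu>\<^sub>t x * f (x, \<xi>) =
        \<mu>\<^sub>s x * (LINT \<xi>'|sphere_measure. p x \<xi> \<xi>' * f (x, \<xi>'))) \<and>
     (\<forall>(x, \<xi>)\<in>Gamma_minus \<Omega>. f (x, \<xi>) = f\<^sub>0 (x, \<xi>)) \<and>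
     (\<forall>(x, \<xi>)\<in>phase_dom \<Omega>.
        continuous_on (range (\<lambda>t. x + t *\<^sub>R \<xi>) \<inter> (\<Omega> \<union> Gamma_minus_dir \<Omega> \<xi>)) (\<lambda>y. f (y, \<xi>))) \<and>
     (\<forall>x\<in>\<Omega>\<^sub>0. \<forall>\<xi>\<in>sphere 0 1. \<forall>j\<in>{1..l x \<xi>}.
        continuous_on ((\<lambda>t. x - t *\<^sub>R \<xi>) ` {T x \<xi> (j - 1)<..<T x \<xi> j}) (\<lambda>y. dir_deriv f y \<xi>))"

definition extension ::
  "'a::euclidean_space set \<Rightarrow> ('a \<times> 'a \<Rightarrow> real) \<Rightarrow> 'a \<times> 'a \<Rightarrow> real" where
  "extension \<Omega> f = (\<lambda>(x, \<xi>). if (x, \<xi>) \<in> phase_dom \<Omega> then f (x, \<xi>)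
                             else Lim (at_right 0) (\<lambda>t. f (x - t *\<^sub>R \<xi>, \<xi>)))"

end

theory Submission
  imports Defs
begin

text \<open>Along a characteristic the equation integrates to
  \<open>f (x, \<xi>) = exp (- depth) f\<^sub>0 (entry point, \<xi>) + \<integral> exp (- depth) \<mu>\<^sub>s G dt\<close>, where \<open>G\<close> is the scattering
  integral of \<open>f\<close>. A line meets the boundary of \<open>\<Omega>\<^sub>0\<close> in finitely many points, so by dominated
  convergence the depth and the line integral are continuous on the closed phase space as soon as
  \<open>G\<close> is continuous on \<open>\<Omega>\<^sub>0 \<times> S\<close>; the discontinuities of \<open>f\<close> are then exactly those of \<open>f\<^sub>0\<close>, transported by
  the entry map, which is continuous and has continuous sections.

  \<open>G\<close> is the uniform limit of source iterates, because the map has contraction ratio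
  \<open>1 - exp (- sup \<mu>\<^sub>t diam \<Omega>)\<close>. The only delicate iterate is the integral of
  \<open>p exp (- depth) f\<^sub>0 (entry point, \<xi>')\<close> over \<open>\<xi>'\<close>. If \<open>f\<^sub>0\<close> is continuous in \<open>x\<close> for almost all \<open>\<xi>\<close>, dominated
  convergence suffices. If \<open>f\<^sub>0\<close> is continuous in \<open>\<xi>\<close> for almost all boundary points, the boundary is
  parametrised by the directions \<open>\<omega>\<close> seen from a fixed \<open>x\<close>; the direction of the same boundary point
  seen from a nearby \<open>x'\<close> is a Lipschitz function of \<open>\<omega>\<close> with constant \<open>1 + O(|x - x'|)\<close>, so the surface
  measures in the two parametrisations are close.\<close>

section \<open>Chords of a convex domain\<close>

text \<open>Neither \<open>f\<close> nor \<open>f\<^sub>0\<close> need be jointly continuous;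
  averaging over directions is what restores continuity, so the iteration runs on \<open>G\<close>
  and is only compared with the given \<open>f\<close>. The iterates also settle measurability:
  \<open>f\<close> is known only through integrability against the completed surface measure, while
  every iterate is Borel in the direction. For data continuous in the direction, a fixed
  \<open>\<xi>'\<close> offers no convergence, because the entry point moves with \<open>x\<close>.
  Fixing the boundary point instead moves the direction, the variable in which the data are
  continuous, at the price of a change of variables. Its Jacobian is avoided on a boundary that is
  merely C1: it is enough that the pushed measure is at most \<open>c n\<close> times the surface
  measure, with \<open>c n\<close> tending to 1. The contraction has two sources: \<open>p\<close>
  averages with total mass 1, and the attenuated integral of \<open>\<mu>\<^sub>t\<close> along a
  chord is \<open>1 - exp (- depth)\<close>, which bounds that of
  \<open>\<mu>\<^sub>s\<close>.\<close>

definition back_time :: "'a::euclidean_space set \<Rightarrow> 'a \<Rightarrow> 'a \<Rightarrow> real" where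
  "back_time \<Omega> x \<xi> = Sup {t. 0 \<le> t \<and> x - t *\<^sub>R \<xi> \<in> closure \<Omega>}"

definition entry :: "'a::euclidean_space set \<Rightarrow> 'a \<Rightarrow> 'a \<Rightarrow> 'a" where
  "entry \<Omega> x \<xi> = x - back_time \<Omega> x \<xi> *\<^sub>R \<xi>"

text \<open>The closed phase space written without a normal: requiring the line to meet
  \<open>\<Omega>\<close> removes the tangential directions at boundary points, where
  \<open>back_time\<close> can jump.\<close>

definition chords :: "'a::euclidean_space set \<Rightarrow> ('a \<times> 'a) set" where
  "chords \<Omega> = {(x, \<xi>). x \<in> closure \<Omega> \<and> norm \<xi> = 1 \<and> (\<exists>t. x + t *\<^sub>R \<xi> \<in> \<Omega>)}"

definition inflow :: "'a::euclidean_space set \<Rightarrow> ('a \<times> 'a) set" where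
  "inflow \<Omega> = {(y, \<xi>). y \<in> frontier \<Omega> \<and> norm \<xi> = 1 \<and> (\<exists>t>0. y + t *\<^sub>R \<xi> \<in> \<Omega>)}"

locale convex_domain =
  fixes \<Omega> :: "'a::euclidean_space set"
  assumes open_dom: "open \<Omega>" and convex_dom: "convex \<Omega>" and bounded_dom: "bounded \<Omega>"
    and nonempty_dom: "\<Omega> \<noteq> {}"
begin

text \<open>Proper convex combinations of an interior point and a point of the closure are interior.
  The end at \<open>a\<close> is the interior one, and \<open>b\<close> may lie on either side of
  it.\<close>

lemma line_segment_in_dom:
  assumes a: "x + a *\<^sub>R \<xi> \<in> \<Omega>" and b: "x + b *\<^sub>R \<xi> \<in> closure \<Omega>"
    and t: "(a \<le> t \<and> t < b) \<or> (b < t \<and> t \<le> a)"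
  shows "x + t *\<^sub>R \<xi> \<in> \<Omega>"
proof (cases "t = a")
  case True then show ?thesis using a by simp
next
  case False
  define s where "s = (b - t) / (b - a)"
  have s: "0 < s" "s < 1" using t False by (auto simp: s_def field_simps)
  have eq: "x + t *\<^sub>R \<xi> = (x + b *\<^sub>R \<xi>) - s *\<^sub>R ((x + b *\<^sub>R \<xi>) - (x + a *\<^sub>R \<xi>))"
  proof -
    have "b - s * (b - a) = t" using t False by (auto simp: s_def)
    then have "t *\<^sub>R \<xi> = b *\<^sub>R \<xi> - s *\<^sub>R (b - a) *\<^sub>R \<xi>"
      by (metis scaleR_left_diff_distrib scaleR_scaleR)
    then show ?thesis by (simp add: scaleR_diff_right[symmetric] scaleR_left_diff_distrib[symmetric] del: scaleR_scaleR)
  qed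
  have "x + a *\<^sub>R \<xi> \<in> interior \<Omega>" using a open_dom by (simp add: interior_open)
  then have "x + t *\<^sub>R \<xi> \<in> interior \<Omega>"
    unfolding eq using s by (intro mem_interior_closure_convex_shrink[OF convex_dom _ b]) auto
  then show ?thesis using interior_subset by blast
qed

lemma line_bounded:
  assumes "x \<in> closure \<Omega>" "x - t *\<^sub>R \<xi> \<in> closure \<Omega>" "norm \<xi> = 1"
  shows "\<bar>t\<bar> \<le> diameter (closure \<Omega>)"
proof -
  have "dist x (x - t *\<^sub>R \<xi>) \<le> diameter (closure \<Omega>)"
    using assms bounded_dom by (intro diameter_bounded_bound) auto
  then show ?thesis using assms(3) by (simp add: dist_norm)
qed

lemma back_time_set:
  assumes "x \<in> closure \<Omega>" "norm \<xi> = 1"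
  shows "0 \<le> back_time \<Omega> x \<xi>" "x - back_time \<Omega> x \<xi> *\<^sub>R \<xi> \<in> closure \<Omega>"
    "\<And>t. \<lbrakk>0 \<le> t; x - t *\<^sub>R \<xi> \<in> closure \<Omega>\<rbrakk> \<Longrightarrow> t \<le> back_time \<Omega> x \<xi>"
    "back_time \<Omega> x \<xi> \<le> diameter (closure \<Omega>)"
proof -
  let ?S = "{t. 0 \<le> t \<and> x - t *\<^sub>R \<xi> \<in> closure \<Omega>}"
  have "?S = {0..} \<inter> (\<lambda>t. x - t *\<^sub>R \<xi>) -` closure \<Omega>" by auto
  moreover have "closed ((\<lambda>t. x - t *\<^sub>R \<xi>) -` closure \<Omega>)"
    by (intro closed_vimage) (auto intro!: continuous_intros)
  ultimately have cl: "closed ?S" using closed_Int[OF closed_atLeast] by metis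
  have bd: "bdd_above ?S"
    using line_bounded[OF assms(1) _ assms(2)] by (intro bdd_aboveI[of _ "diameter (closure \<Omega>)"]) fastforce
  have ne: "?S \<noteq> {}" using assms by (auto intro!: exI[of _ 0])
  have mem: "back_time \<Omega> x \<xi> \<in> ?S"
    unfolding back_time_def by (rule closed_contains_Sup[OF ne bd cl])
  then show "0 \<le> back_time \<Omega> x \<xi>" "x - back_time \<Omega> x \<xi> *\<^sub>R \<xi> \<in> closure \<Omega>" by auto
  show "t \<le> back_time \<Omega> x \<xi>" if "0 \<le> t" "x - t *\<^sub>R \<xi> \<in> closure \<Omega>" for t
    unfolding back_time_def using that by (intro cSup_upper bd) auto
  show "back_time \<Omega> x \<xi> \<le> diameter (closure \<Omega>)"
    using mem line_bounded[OF assms(1) _ assms(2)] by fastforce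
qed

lemma chordsD:
  assumes "(x, \<xi>) \<in> chords \<Omega>"
  shows "x \<in> closure \<Omega>" "norm \<xi> = 1" "\<exists>t. x + t *\<^sub>R \<xi> \<in> \<Omega>"
  using assms by (auto simp: chords_def)

lemma chords_interior: "x \<in> \<Omega> \<Longrightarrow> norm \<xi> = 1 \<Longrightarrow> (x, \<xi>) \<in> chords \<Omega>"
  using closure_subset by (auto simp: chords_def intro!: exI[of _ 0])

lemma back_segment_in_dom:
  assumes "(x, \<xi>) \<in> chords \<Omega>" "0 < t" "t < back_time \<Omega> x \<xi>"
  shows "x - t *\<^sub>R \<xi> \<in> \<Omega>"
proof -
  obtain s where s: "x + s *\<^sub>R \<xi> \<in> \<Omega>" using chordsD(3)[OF assms(1)] by blast
  have 1: "x + 0 *\<^sub>R \<xi> \<in> closure \<Omega>" using chordsD(1)[OF assms(1)] by simp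
  have 2: "x + (- back_time \<Omega> x \<xi>) *\<^sub>R \<xi> \<in> closure \<Omega>"
    using back_time_set(2)[OF chordsD(1,2)[OF assms(1)]] by simp
  have "x + (- t) *\<^sub>R \<xi> \<in> \<Omega>"
  \<comment> \<open>The witness \<open>s\<close> may lie on either side of \<open>- t\<close>; the
    segment from it to the opposite end, \<open>x\<close> or the backward endpoint, passes through
    \<open>- t\<close>.\<close>
  proof (cases "s \<le> - t")
    case True then show ?thesis using line_segment_in_dom[OF s 1, of "- t"] assms by auto
  next
    case False then show ?thesis using line_segment_in_dom[OF s 2, of "- t"] assms by auto
  qed
  then show ?thesis by simp
qed

lemma back_end_not_in_dom:
  assumes "x \<in> closure \<Omega>" "norm \<xi> = 1"
  shows "x - back_time \<Omega> x \<xi> *\<^sub>R \<xi> \<notin> \<Omega>"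
proof
  let ?b = "back_time \<Omega> x \<xi>"
  assume "x - ?b *\<^sub>R \<xi> \<in> \<Omega>"
  then obtain e where e: "e > 0" "ball (x - ?b *\<^sub>R \<xi>) e \<subseteq> \<Omega>" using open_dom open_contains_ball[of \<Omega>] by metis
  have "x - (?b + e/2) *\<^sub>R \<xi> \<in> ball (x - ?b *\<^sub>R \<xi>) e"
    using e assms by (simp add: dist_norm scaleR_add_left)
  then have "x - (?b + e/2) *\<^sub>R \<xi> \<in> closure \<Omega>" using e closure_subset by blast
  then have "?b + e/2 \<le> ?b" using back_time_set(1)[OF assms] e by (intro back_time_set(3)[OF assms]) auto
  then show False using e by simp
qed

text \<open>The interior point of the chord lies strictly ahead of the backward endpoint: otherwise
  maximality of \<open>back_time\<close> would make it that endpoint, which is outside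
  \<open>\<Omega>\<close>.\<close>

lemma entry_inflow:
  assumes "(x, \<xi>) \<in> chords \<Omega>"
  shows "(entry \<Omega> x \<xi>, \<xi>) \<in> inflow \<Omega>"
proof -
  note c = chordsD[OF assms]
  note b = back_time_set[OF c(1,2)]
  obtain s where s: "x + s *\<^sub>R \<xi> \<in> \<Omega>" using c(3) by blast
  let ?b = "back_time \<Omega> x \<xi>"
  have nb: "x - ?b *\<^sub>R \<xi> \<notin> \<Omega>" using back_end_not_in_dom[OF c(1,2)] .
  have "s > - ?b"
  proof (rule ccontr)
    assume "\<not> s > - ?b"
    then have "- s \<ge> ?b" by simp
    moreover have "x - (- s) *\<^sub>R \<xi> \<in> closure \<Omega>" using s closure_subset by auto
    ultimately have "- s = ?b" using b(1) b(3)[of "- s"] by simp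
    then have "s = - ?b" by simp
    then show False using s nb by simp
  qed
  moreover have "entry \<Omega> x \<xi> + (s + ?b) *\<^sub>R \<xi> = x + s *\<^sub>R \<xi>" by (simp add: entry_def algebra_simps)
  moreover have "entry \<Omega> x \<xi> \<in> frontier \<Omega>"
    using b(2) nb open_dom by (simp add: entry_def frontier_def interior_open)
  ultimately show ?thesis using s c by (auto simp: inflow_def intro!: exI[of _ "s + ?b"])
qed

lemma inflow_chords: "inflow \<Omega> \<subseteq> chords \<Omega>"
  by (auto simp: inflow_def chords_def frontier_def)

text \<open>\<open>t\<close> may be negative, so the shift also moves forward along the chord;
  \<open>inflow_forward\<close> is that case.\<close>

lemma back_time_shift:
  assumes "(x, \<xi>) \<in> chords \<Omega>" "x - t *\<^sub>R \<xi> \<in> closure \<Omega>" "t \<le> back_time \<Omega> x \<xi>"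
  shows "(x - t *\<^sub>R \<xi>, \<xi>) \<in> chords \<Omega>" "back_time \<Omega> (x - t *\<^sub>R \<xi>) \<xi> = back_time \<Omega> x \<xi> - t"
    "entry \<Omega> (x - t *\<^sub>R \<xi>) \<xi> = entry \<Omega> x \<xi>"
proof -
  note c = chordsD[OF assms(1)]
  note b = back_time_set[OF c(1,2)]
  note b' = back_time_set[OF assms(2) c(2)]
  let ?b = "back_time \<Omega> x \<xi>" and ?b' = "back_time \<Omega> (x - t *\<^sub>R \<xi>) \<xi>"
  obtain s where s: "x + s *\<^sub>R \<xi> \<in> \<Omega>" using c(3) by blast
  have "(x - t *\<^sub>R \<xi>) + (s + t) *\<^sub>R \<xi> = x + s *\<^sub>R \<xi>" by (simp add: algebra_simps)
  then show "(x - t *\<^sub>R \<xi>, \<xi>) \<in> chords \<Omega>" using s assms(2) c(2) unfolding chords_def by (metis (mono_tags, lifting) case_prodI mem_Collect_eq)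
  have "(x - t *\<^sub>R \<xi>) - (?b - t) *\<^sub>R \<xi> = x - ?b *\<^sub>R \<xi>" by (simp add: algebra_simps)
  then have 1: "?b - t \<le> ?b'" using b(2) assms(3) by (intro b'(3)) (simp_all only: diff_ge_0_iff_ge)
  have e: "(x - t *\<^sub>R \<xi>) - ?b' *\<^sub>R \<xi> = x - (t + ?b') *\<^sub>R \<xi>" by (simp add: algebra_simps)
  have "t + ?b' \<ge> 0" using 1 b(1) by linarith
  then have "t + ?b' \<le> ?b" using b(3)[of "t + ?b'"] b'(2) e by simp
  then show eq: "?b' = ?b - t" using 1 by simp
  show "entry \<Omega> (x - t *\<^sub>R \<xi>) \<xi> = entry \<Omega> x \<xi>" by (simp add: entry_def eq algebra_simps)
qed

text \<open>A positive backward time would place \<open>y\<close> strictly between a point of the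
  closure and an interior point, hence inside \<open>\<Omega>\<close>.\<close>

lemma inflow_back_time:
  assumes "(y, \<xi>) \<in> inflow \<Omega>" shows "back_time \<Omega> y \<xi> = 0" "entry \<Omega> y \<xi> = y"
proof -
  have c: "(y, \<xi>) \<in> chords \<Omega>" using assms inflow_chords by blast
  note b = back_time_set[OF chordsD(1,2)[OF c]]
  obtain s where s: "s > 0" "y + s *\<^sub>R \<xi> \<in> \<Omega>" using assms by (auto simp: inflow_def)
  have y: "y \<notin> \<Omega>" using assms open_dom by (auto simp: inflow_def frontier_def interior_open)
  show 0: "back_time \<Omega> y \<xi> = 0"
  proof (rule ccontr)
    assume "back_time \<Omega> y \<xi> \<noteq> 0"
    then have "y + 0 *\<^sub>R \<xi> \<in> \<Omega>"
      using line_segment_in_dom[OF s(2), of "- back_time \<Omega> y \<xi>" 0] b s by simp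
    then show False using y by simp
  qed
  show "entry \<Omega> y \<xi> = y" by (simp add: entry_def 0)
qed

lemma inflow_forward:
  assumes "(y, \<xi>) \<in> inflow \<Omega>" "0 \<le> t" "y + t *\<^sub>R \<xi> \<in> closure \<Omega>"
  shows "(y + t *\<^sub>R \<xi>, \<xi>) \<in> chords \<Omega>" "back_time \<Omega> (y + t *\<^sub>R \<xi>) \<xi> = t" "entry \<Omega> (y + t *\<^sub>R \<xi>) \<xi> = y"
proof -
  have c: "(y, \<xi>) \<in> chords \<Omega>" using assms inflow_chords by blast
  note s = back_time_shift[OF c, of "- t"]
  show "(y + t *\<^sub>R \<xi>, \<xi>) \<in> chords \<Omega>" using s assms inflow_back_time by simp
  show "back_time \<Omega> (y + t *\<^sub>R \<xi>) \<xi> = t" using s assms inflow_back_time by simp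
  show "entry \<Omega> (y + t *\<^sub>R \<xi>) \<xi> = y" using s assms inflow_back_time by simp
qed

lemma chords_reverse: "(x, - \<xi>) \<in> chords \<Omega> \<longleftrightarrow> (x, \<xi>) \<in> chords \<Omega>"
proof -
  have "(x, - \<xi>) \<in> chords \<Omega>" if "(x, \<xi>) \<in> chords \<Omega>" for \<xi>
    using that by (auto simp: chords_def) (metis add_uminus_conv_diff diff_minus_eq_add scaleR_minus_left)
  from this[of \<xi>] this[of "- \<xi>"] show ?thesis by auto
qed

text \<open>Forward exit is backward exit in the reversed direction, so \<open>back_time\<close>
  serves for both. The infimum in \<open>tau_plus\<close> is a minimum: everything strictly before
  the exit is inside, the exit point is not.\<close>

lemma inflow_forward_time:
  assumes "(y, \<xi>) \<in> inflow \<Omega>"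
  shows "0 < back_time \<Omega> y (- \<xi>)" "tau_plus \<Omega> y \<xi> = back_time \<Omega> y (- \<xi>)"
    "\<And>t. \<lbrakk>0 \<le> t; t \<le> back_time \<Omega> y (- \<xi>)\<rbrakk> \<Longrightarrow> y + t *\<^sub>R \<xi> \<in> closure \<Omega>"
proof -
  have c: "(y, - \<xi>) \<in> chords \<Omega>" using assms inflow_chords chords_reverse by blast
  note b = back_time_set[OF chordsD(1,2)[OF c]]
  let ?b = "back_time \<Omega> y (- \<xi>)"
  obtain s where s: "s > 0" "y + s *\<^sub>R \<xi> \<in> \<Omega>" using assms by (auto simp: inflow_def)
  have "s \<le> ?b" using b(3)[of s] s closure_subset by auto
  then show pos: "0 < ?b" using s by simp
  have inn: "y + t *\<^sub>R \<xi> \<in> \<Omega>" if "0 < t" "t < ?b" for t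
    using back_segment_in_dom[OF c that] by simp
  have out: "y + ?b *\<^sub>R \<xi> \<notin> \<Omega>" using back_end_not_in_dom[OF chordsD(1,2)[OF c]] by simp
  show "tau_plus \<Omega> y \<xi> = ?b" unfolding tau_plus_def
  proof (rule cInf_eq_minimum)
    show "?b \<in> {t. 0 < t \<and> y + t *\<^sub>R \<xi> \<notin> \<Omega>}" using pos out by simp
    show "?b \<le> x" if "x \<in> {t. 0 < t \<and> y + t *\<^sub>R \<xi> \<notin> \<Omega>}" for x
      using that inn[of x] by fastforce
  qed
  show "y + t *\<^sub>R \<xi> \<in> closure \<Omega>" if "0 \<le> t" "t \<le> ?b" for t
    using inn[of t] b(2) that closure_subset chordsD(1)[OF c] by (cases "t = 0"; cases "t = ?b") auto
qed

text \<open>Lower semicontinuity comes from openness of \<open>\<Omega>\<close>: a point shortly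
  before the exit stays inside under perturbation. Upper semicontinuity comes from closedness of the
  closure: a point shortly after the exit stays outside, and by convexity a nearby chord that
  reached further would contain it.\<close>

lemma back_time_continuous: "continuous_on (chords \<Omega>) (\<lambda>(x, \<xi>). back_time \<Omega> x \<xi>)"
  unfolding continuous_on_def
proof (intro ballI)
  fix w assume w: "w \<in> chords \<Omega>"
  obtain x \<xi> where weq: "w = (x, \<xi>)" by fastforce
  have c: "(x, \<xi>) \<in> chords \<Omega>" using w weq by simp
  note b = back_time_set[OF chordsD(1,2)[OF c]]
  let ?b = "back_time \<Omega> x \<xi>" and ?F = "at (x, \<xi>) within chords \<Omega>"
  have lim: "((\<lambda>z. fst z - r *\<^sub>R snd z) \<longlongrightarrow> x - r *\<^sub>R \<xi>) ?F" for r
    by (auto intro!: tendsto_eq_intros)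
  have in_chords: "\<forall>\<^sub>F z in ?F. z \<in> chords \<Omega>" by (simp add: eventually_at_filter)
  show "((\<lambda>(x, \<xi>). back_time \<Omega> x \<xi>) \<longlongrightarrow> (\<lambda>(x, \<xi>). back_time \<Omega> x \<xi>) w) (at w within chords \<Omega>)"
    unfolding weq order_tendsto_iff
  proof (intro conjI allI impI)
    fix l assume "l < (\<lambda>(x, \<xi>). back_time \<Omega> x \<xi>) (x, \<xi>)"
    then have l: "l < ?b" by simp
    show "\<forall>\<^sub>F z in ?F. l < (\<lambda>(x, \<xi>). back_time \<Omega> x \<xi>) z"
    proof (cases "l < 0")
      case True
      show ?thesis using in_chords
        by eventually_elim (use True back_time_set(1) chordsD in fastforce)
    next
      case False
      obtain r where r: "l < r" "r < ?b" using l dense by blast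
      then have "x - r *\<^sub>R \<xi> \<in> \<Omega>" using back_segment_in_dom[OF c, of r] False by simp
      then have "\<forall>\<^sub>F z in ?F. fst z - r *\<^sub>R snd z \<in> \<Omega>" using topological_tendstoD[OF lim open_dom] by simp
      then show ?thesis using in_chords
      proof eventually_elim
        case (elim z)
        obtain u v where [simp]: "z = (u, v)" by fastforce
        have "r \<le> back_time \<Omega> u v"
          using back_time_set(3)[of u v r] chordsD[of u v] elim closure_subset r False by auto
        then show ?case using r by simp
      qed
    qed
  next
    fix r assume "(\<lambda>(x, \<xi>). back_time \<Omega> x \<xi>) (x, \<xi>) < r"
    then have r: "?b < r" by simp
    then have "x - r *\<^sub>R \<xi> \<in> - closure \<Omega>" using b(3)[of r] b(1) by fastforce
    then have "\<forall>\<^sub>F z in ?F. fst z - r *\<^sub>R snd z \<in> - closure \<Omega>"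
      by (intro topological_tendstoD[OF lim]) auto
    then show "\<forall>\<^sub>F z in ?F. (\<lambda>(x, \<xi>). back_time \<Omega> x \<xi>) z < r" using in_chords
    proof eventually_elim
      case (elim z)
      obtain u v where [simp]: "z = (u, v)" by fastforce
      note c' = chordsD[of u v] and b' = back_time_set[of u v]
      show ?case
      proof (rule ccontr)
        assume "\<not> ?thesis"
        then have le: "r \<le> back_time \<Omega> u v" by simp
        have "u - r *\<^sub>R v \<in> closure \<Omega>"
          using back_segment_in_dom[of u v r] le r b(1) elim b' c' closure_subset
          by (cases "r = back_time \<Omega> u v") auto
        then show False using elim by simp
      qed
    qed
  qed
qed

lemma entry_continuous: "continuous_on (chords \<Omega>) (\<lambda>(x, \<xi>). entry \<Omega> x \<xi>)"
  using back_time_continuous unfolding entry_def case_prod_unfold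
  by (intro continuous_intros) auto

text \<open>A continuous section of the entry map. The minimum stops a point at its own exit, since
  a neighbouring chord may be shorter than \<open>t\<close>.\<close>

lemma inflow_section_continuous:
  "continuous_on (inflow \<Omega>) (\<lambda>(y, \<xi>). (y + min t (back_time \<Omega> y (- \<xi>)) *\<^sub>R \<xi>, \<xi>))"
proof -
  have "continuous_on (inflow \<Omega>) ((\<lambda>(x, \<xi>). back_time \<Omega> x \<xi>) \<circ> (\<lambda>(y, \<xi>). (y, - \<xi>)))"
    using inflow_chords chords_reverse
    by (intro continuous_on_compose2[OF back_time_continuous] continuous_on_compose)
      (auto intro!: continuous_intros continuous_on_subset[OF back_time_continuous] simp: case_prod_unfold)
  then have "continuous_on (inflow \<Omega>) (\<lambda>z. back_time \<Omega> (fst z) (- snd z))"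
    by (simp add: o_def case_prod_unfold)
  then show ?thesis unfolding case_prod_unfold by (intro continuous_intros)
qed

end

section \<open>Outer normals and the boundary phase space\<close>

lemma defining_function_descends:
  assumes "defining_function \<Omega> z U \<rho> G" "z \<in> frontier \<Omega>" "G z \<bullet> v < 0"
  obtains e where "e > 0" "\<And>t. \<lbrakk>0 < t; t < e\<rbrakk> \<Longrightarrow> z + t *\<^sub>R v \<in> \<Omega>"
proof -
  have U: "open U" "z \<in> U" and g: "GDERIV \<rho> z :> G z"
    and Om: "\<Omega> \<inter> U = {x\<in>U. \<rho> x < 0}" and fr: "frontier \<Omega> \<inter> U = {x\<in>U. \<rho> x = 0}"
    using assms(1) by (auto simp: defining_function_def regular_C1_def)
  have z0: "\<rho> z = 0" using fr U assms(2) by blast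
  have d: "(\<rho> has_derivative (\<lambda>h. h \<bullet> G z)) (at (z + 0 *\<^sub>R v))" using g by (simp add: gderiv_def)
  have "((\<lambda>t::real. z + t *\<^sub>R v) has_derivative (\<lambda>t. t *\<^sub>R v)) (at 0)"
    by (auto intro!: derivative_eq_intros)
  from has_derivative_compose[OF this d]
  have "((\<lambda>t. \<rho> (z + t *\<^sub>R v)) has_derivative (\<lambda>t. (t *\<^sub>R v) \<bullet> G z)) (at 0)" .
  then have "DERIV (\<lambda>t. \<rho> (z + t *\<^sub>R v)) 0 :> v \<bullet> G z"
    by (simp add: has_field_derivative_def mult.commute[of _ "v \<bullet> G z"])
  from DERIV_neg_dec_right[OF this] obtain e1 where e1: "e1 > 0"
    "\<And>h. \<lbrakk>0 < h; h < e1\<rbrakk> \<Longrightarrow> \<rho> (z + h *\<^sub>R v) < 0" using assms(3) z0 by (auto simp: inner_commute)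
  have "((\<lambda>t::real. z + t *\<^sub>R v) \<longlongrightarrow> z + 0 *\<^sub>R v) (at 0)" by (intro tendsto_intros)
  then have "\<forall>\<^sub>F t in at (0::real). z + t *\<^sub>R v \<in> U" using U by (intro topological_tendstoD) auto
  then obtain e2 where e2: "e2 > 0" "\<And>t. \<lbrakk>t \<noteq> 0; \<bar>t\<bar> < e2\<rbrakk> \<Longrightarrow> z + t *\<^sub>R v \<in> U"
    by (auto simp: eventually_at dist_real_def)
  show thesis
    by (rule that[of "min e1 e2"]) (use e1 e2 Om in \<open>auto\<close>)
qed

text \<open>The definite description in \<open>outer_normal\<close> is proper because every defining function has its
  gradient normal to the supporting hyperplane, which is therefore unique.\<close>

lemma convex_outer_normal:
  assumes "open \<Omega>" "convex \<Omega>" "C1_boundary \<Omega>" and z: "z \<in> frontier \<Omega>"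
  shows "\<And>w. w \<in> \<Omega> \<Longrightarrow> outer_normal \<Omega> z \<bullet> (w - z) < 0"
    and "\<And>v. outer_normal \<Omega> z \<bullet> v < 0 \<Longrightarrow> \<exists>e>0. \<forall>t. 0 < t \<and> t < e \<longrightarrow> z + t *\<^sub>R v \<in> \<Omega>"
proof -
  have zn: "z \<notin> \<Omega>" using z assms by (auto simp: frontier_def interior_open)
  obtain a b where ab: "a \<noteq> 0" "a \<bullet> z \<le> b" "\<forall>x\<in>\<Omega>. a \<bullet> x \<ge> b"
  proof -
    obtain a b where "a \<noteq> 0" "\<forall>x\<in>{z}. a \<bullet> x \<le> b" "\<forall>x\<in>\<Omega>. a \<bullet> x \<ge> b"
      using separating_hyperplane_sets[of "{z}" \<Omega>] zn assms z by auto
    then show thesis using that by auto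
  qed
  \<comment> \<open>Openness makes the separation strict: \<open>w\<close> can be pushed a little
    towards the hyperplane without leaving \<open>\<Omega>\<close>.\<close>
  have sup: "- a \<bullet> (w - z) < 0" if wO: "w \<in> \<Omega>" for w
  proof -
    obtain e where e: "e > 0" "ball w e \<subseteq> \<Omega>" using assms(1) wO open_contains_ball[of \<Omega>] by metis
    define w' where "w' = w - (e / (2 * norm a)) *\<^sub>R a"
    have "w' \<in> ball w e" using e ab by (simp add: w'_def dist_norm)
    then have "a \<bullet> w' \<ge> b" using ab e by blast
    moreover have "a \<bullet> w' < a \<bullet> w" using e ab by (simp add: w'_def inner_diff_right)
    ultimately show ?thesis using ab by (simp add: inner_diff_right)
  qed
  have dir: "sgn (G z) = sgn (- a)" if df: "defining_function \<Omega> z U \<rho> G" for U \<rho> G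
  proof -
    let ?g = "G z" and ?a = "- a"
    have g0: "?g \<noteq> 0" using df by (auto simp: defining_function_def regular_C1_def)
    \<comment> \<open>Directions descending for \<open>?g\<close> enter \<open>\<Omega>\<close>, so
      their half space lies in that of \<open>?a\<close>; such an inclusion forces the two normals
      to be parallel.\<close>
    have neg: "?a \<bullet> v < 0" if v: "?g \<bullet> v < 0" for v
    proof -
      obtain e where e: "e > 0" "\<And>t. \<lbrakk>0 < t; t < e\<rbrakk> \<Longrightarrow> z + t *\<^sub>R v \<in> \<Omega>"
        using defining_function_descends[OF df z v] by blast
      have "?a \<bullet> ((z + (e/2) *\<^sub>R v) - z) < 0" using e by (intro sup e(2)) auto
      then have "(e / 2) * (?a \<bullet> v) < 0" by simp
      then show ?thesis using e(1) by (auto simp: mult_less_0_iff zero_less_mult_iff)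
    qed
    define lam where "lam = (?a \<bullet> ?g) / (?g \<bullet> ?g)"
    define w where "w = ?a - lam *\<^sub>R ?g"
    have gg: "?g \<bullet> ?g > 0" using g0 by simp
    have gw: "?g \<bullet> w = 0" using gg by (simp add: w_def lam_def inner_diff_right inner_commute)
    have aw: "?a \<bullet> w = w \<bullet> w"
    proof -
      have "w \<bullet> w = ?a \<bullet> w - lam * (?g \<bullet> w)" by (simp add: w_def inner_diff_left)
      then show ?thesis using gw by simp
    qed
    have ag: "?a \<bullet> ?g > 0" using neg[of "- ?g"] gg by simp
    have w0: "w = 0"
    proof (rule ccontr)
      assume "w \<noteq> 0"
      then have ww: "w \<bullet> w > 0" by simp
      \<comment> \<open>With this \<open>s\<close> the direction \<open>- ?g + s *\<^sub>R w\<close>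
        descends for \<open>?g\<close> but is orthogonal to \<open>?a\<close>.\<close>
      define s where "s = (?a \<bullet> ?g) / (w \<bullet> w)"
      have "?g \<bullet> (- ?g + s *\<^sub>R w) < 0" using gg gw by (simp add: inner_diff_right)
      then have "?a \<bullet> (- ?g + s *\<^sub>R w) < 0" by (rule neg)
      moreover have "?a \<bullet> (- ?g + s *\<^sub>R w) = - (?a \<bullet> ?g) + s * (?a \<bullet> w)" by (simp add: inner_diff_right)
      moreover have "s * (?a \<bullet> w) = ?a \<bullet> ?g" using ww aw by (simp add: s_def)
      ultimately show False by simp
    qed
    then have "?a = lam *\<^sub>R ?g" by (simp add: w_def)
    moreover have "lam > 0" unfolding lam_def using divide_pos_pos[OF ag gg] .
    ultimately show ?thesis by (simp add: sgn_scaleR)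
  qed
  obtain U \<rho> G where df: "defining_function \<Omega> z U \<rho> G"
    using assms(3) z by (auto simp: C1_boundary_def)
  have on: "outer_normal \<Omega> z = sgn (- a)"
    unfolding outer_normal_def
  proof (rule the_equality)
    show "\<exists>U \<rho> G. defining_function \<Omega> z U \<rho> G \<and> sgn (- a) = sgn (G z)"
      using df dir[OF df, symmetric] by (intro exI[of _ U] exI[of _ \<rho>] exI[of _ G] conjI)
    show "v = sgn (- a)" if "\<exists>U \<rho> G. defining_function \<Omega> z U \<rho> G \<and> v = sgn (G z)" for v
      using that dir by blast
  qed
  show "outer_normal \<Omega> z \<bullet> (w - z) < 0" if "w \<in> \<Omega>" for w
    using sup[OF that] ab(1) by (auto simp: on sgn_div_norm divide_less_0_iff zero_less_divide_iff)
  show "\<exists>e>0. \<forall>t. 0 < t \<and> t < e \<longrightarrow> z + t *\<^sub>R v \<in> \<Omega>" if "outer_normal \<Omega> z \<bullet> v < 0" for v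
  proof -
    have "sgn (G z) \<bullet> v < 0" using that on dir[OF df] by simp
    moreover have "G z \<noteq> 0" using df by (auto simp: defining_function_def regular_C1_def)
    ultimately have "G z \<bullet> v < 0"
      by (auto simp: sgn_div_norm divide_less_0_iff mult_less_0_iff)
    from defining_function_descends[OF df z this] show ?thesis by metis
  qed
qed

locale C1_convex_domain = convex_domain +
  assumes C1_dom: "C1_boundary \<Omega>"
begin

lemma outer_normal_less_0_iff:
  assumes "y \<in> frontier \<Omega>"
  shows "outer_normal \<Omega> y \<bullet> \<xi> < 0 \<longleftrightarrow> (\<exists>t>0. y + t *\<^sub>R \<xi> \<in> \<Omega>)"
proof
  assume "outer_normal \<Omega> y \<bullet> \<xi> < 0"
  from convex_outer_normal(2)[OF open_dom convex_dom C1_dom assms this] obtain e where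
    "e > 0" "\<forall>t. 0 < t \<and> t < e \<longrightarrow> y + t *\<^sub>R \<xi> \<in> \<Omega>" by blast
  then show "\<exists>t>0. y + t *\<^sub>R \<xi> \<in> \<Omega>" by (intro exI[of _ "e/2"]) auto
next
  assume "\<exists>t>0. y + t *\<^sub>R \<xi> \<in> \<Omega>"
  then obtain t where t: "t > 0" "y + t *\<^sub>R \<xi> \<in> \<Omega>" by blast
  have "outer_normal \<Omega> y \<bullet> ((y + t *\<^sub>R \<xi>) - y) < 0"
    by (rule convex_outer_normal(1)[OF open_dom convex_dom C1_dom assms t(2)])
  then show "outer_normal \<Omega> y \<bullet> \<xi> < 0" using t(1) by (simp add: mult_less_0_iff)
qed

lemma Gamma_minus_eq: "Gamma_minus \<Omega> = inflow \<Omega>"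
  by (auto simp: Gamma_minus_def inflow_def outer_normal_less_0_iff)

lemma Gamma_plus_eq: "Gamma_plus \<Omega> = {(x, \<xi>). (x, - \<xi>) \<in> inflow \<Omega>}"
proof -
  have "outer_normal \<Omega> x \<bullet> \<xi> > 0 \<longleftrightarrow> (\<exists>t>0. x + t *\<^sub>R (- \<xi>) \<in> \<Omega>)" if "x \<in> frontier \<Omega>" for x \<xi>
    using outer_normal_less_0_iff[OF that, of "- \<xi>"] by simp
  then show ?thesis by (auto simp: Gamma_plus_def inflow_def)
qed

lemma Gamma_minus_dir_eq: "norm \<xi> = 1 \<Longrightarrow> Gamma_minus_dir \<Omega> \<xi> = {y. (y, \<xi>) \<in> inflow \<Omega>}"
  by (auto simp: Gamma_minus_dir_def inflow_def outer_normal_less_0_iff)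

lemma Gamma_minus_pt_eq: "y \<in> frontier \<Omega> \<Longrightarrow> Gamma_minus_pt \<Omega> y = {\<xi>. (y, \<xi>) \<in> inflow \<Omega>}"
  by (auto simp: Gamma_minus_pt_def inflow_def outer_normal_less_0_iff)

text \<open>A chord through a boundary point meets \<open>\<Omega>\<close> either ahead of it or
  behind it, and the sign of \<open>t\<close> tells inflow from outflow.\<close>

lemma phase_dom_bar_eq: "phase_dom_bar \<Omega> = chords \<Omega>"
proof (intro set_eqI iffI; clarify)
  fix x \<xi> assume "(x, \<xi>) \<in> phase_dom_bar \<Omega>"
  then consider "x \<in> \<Omega>" "norm \<xi> = 1" | "(x, \<xi>) \<in> inflow \<Omega>" | "(x, - \<xi>) \<in> inflow \<Omega>"
    by (auto simp: phase_dom_bar_def phase_dom_def Gamma_minus_eq Gamma_plus_eq)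
  then show "(x, \<xi>) \<in> chords \<Omega>"
    using chords_interior inflow_chords chords_reverse by cases blast+
next
  fix x \<xi> assume c: "(x, \<xi>) \<in> chords \<Omega>"
  obtain t where t: "x + t *\<^sub>R \<xi> \<in> \<Omega>" using chordsD(3)[OF c] by blast
  show "(x, \<xi>) \<in> phase_dom_bar \<Omega>"
  proof (cases "x \<in> \<Omega>")
    case True then show ?thesis using chordsD[OF c] by (auto simp: phase_dom_bar_def phase_dom_def)
  next
    case False
    then have fr: "x \<in> frontier \<Omega>" using chordsD[OF c] open_dom by (auto simp: frontier_def interior_open)
    have t0: "t \<noteq> 0" using t False by auto
    have "(x, \<xi>) \<in> inflow \<Omega>" if "t > 0" using that t fr chordsD[OF c] by (auto simp: inflow_def)
    moreover have "(x, - \<xi>) \<in> inflow \<Omega>" if "t < 0"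
      using that t fr chordsD[OF c] by (auto simp: inflow_def intro!: exI[of _ "- t"])
    ultimately show ?thesis using t0 linorder_neqE[of t 0]
      by (auto simp: phase_dom_bar_def phase_dom_def Gamma_minus_eq Gamma_plus_eq)
  qed
qed

end

section \<open>The surface measure of the sphere\<close>

text \<open>Formulated with the counting measure because a Vitali family is indexed by a countable
  set of centre-radius pairs, not by a sequence.\<close>

lemma emeasure_UN_countable_le:
  assumes "countable I" "\<And>i. i \<in> I \<Longrightarrow> X i \<in> sets M"
  shows "emeasure M (\<Union>i\<in>I. X i) \<le> (\<integral>\<^sup>+i. emeasure M (X i) \<partial>count_space I)"
proof -
  have sets: "(\<Union>i\<in>I. X i) \<in> sets M" using assms by auto
  have le: "indicator (\<Union>i\<in>I. X i) x \<le> (\<integral>\<^sup>+i. indicator (X i) x \<partial>count_space I)" for x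
  proof (cases "x \<in> (\<Union>i\<in>I. X i)")
    case True
    then obtain j where j: "j \<in> I" "x \<in> X j" by blast
    have "(1::ennreal) = (\<integral>\<^sup>+i. indicator {j} i \<partial>count_space I)"
      using j by (subst nn_integral_indicator) auto
    also have "\<dots> \<le> (\<integral>\<^sup>+i. indicator (X i) x \<partial>count_space I)"
      using j by (intro nn_integral_mono) (auto simp: indicator_def)
    finally show ?thesis using True by simp
  qed simp
  have "emeasure M (\<Union>i\<in>I. X i) = (\<integral>\<^sup>+x. indicator (\<Union>i\<in>I. X i) x \<partial>M)" using sets by simp
  also have "\<dots> \<le> (\<integral>\<^sup>+x. (\<integral>\<^sup>+i. indicator (X i) x \<partial>count_space I) \<partial>M)"
    by (intro nn_integral_mono le)
  also have "\<dots> = (\<integral>\<^sup>+i. (\<integral>\<^sup>+x. indicator (X i) x \<partial>M) \<partial>count_space I)"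
    using assms by (intro nn_integral_count_space_nn_integral) auto
  also have "\<dots> = (\<integral>\<^sup>+i. emeasure M (X i) \<partial>count_space I)"
    using assms by (intro nn_integral_cong) auto
  finally show ?thesis .
qed

text \<open>The constant \<open>L ^ DIM('a)\<close> is sharp because the Vitali covering uses balls, whose images lie in
  balls; a covering by cubes would lose a dimensional factor.\<close>

lemma lipschitz_image_emeasure_le:
  fixes \<Phi> :: "'a::euclidean_space \<Rightarrow> 'a"
  assumes lip: "\<And>x y. norm (\<Phi> x - \<Phi> y) \<le> L * norm (x - y)" and L: "0 \<le> L"
    and E: "E \<in> sets borel" and B: "B \<in> sets borel" and sub: "B \<subseteq> \<Phi> ` E"
  shows "emeasure lborel B \<le> ennreal (L ^ DIM('a)) * emeasure lborel E"
proof (rule ennreal_le_epsilon)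
  fix e0 :: real assume e0: "e0 > 0"
  \<comment> \<open>The slack for outer regularity: multiplied by \<open>L ^ DIM('a)\<close> it
    stays below \<open>e0\<close>, and the added 1 covers \<open>L = 0\<close>.\<close>
  define e where "e = e0 / (L ^ DIM('a) + 1)"
  have e: "e > 0" using e0 L by (simp add: e_def add_nonneg_pos)
  obtain U where U: "open U" "E \<subseteq> U" "emeasure lborel (U - E) < ennreal e"
    using outer_regular_lborel[OF E e] by blast
  let ?K = "{i::'a \<times> real. ball (fst i) (snd i) \<subseteq> U \<and> 0 < snd i}"
  have cover: "\<exists>i. i \<in> ?K \<and> x \<in> ball (fst i) (snd i) \<and> snd i < d" if "x \<in> U" "0 < d" for x d
  proof -
    obtain r where r: "r > 0" "ball x r \<subseteq> U" using openE[OF U(1) \<open>x \<in> U\<close>] by blast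
    have "ball x (min r (d/2)) \<subseteq> U" using r by auto
    then show ?thesis using r that by (intro exI[of _ "(x, min r (d/2))"]) auto
  qed
  \<comment> \<open>Disjointness lets the ball volumes add up to at most that of \<open>U\<close>,
    with no overlap count as an extra factor.\<close>
  obtain C where C: "countable C" "C \<subseteq> ?K"
    "pairwise (\<lambda>i j. disjnt (ball (fst i) (snd i)) (ball (fst j) (snd j))) C"
    "negligible (U - (\<Union>i\<in>C. ball (fst i) (snd i)))"
    by (rule Vitali_covering_theorem_balls[of U ?K fst snd, OF cover])
  let ?N = "U - (\<Union>i\<in>C. ball (fst i) (snd i))"
  let ?B = "\<lambda>i. cball (\<Phi> (fst i)) (L * snd i)"
  have "negligible (\<Phi> ` ?N)"
    using lip by (intro negligible_locally_Lipschitz_image[OF _ C(4)]) (auto intro!: exI[of _ UNIV] exI[of _ L])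
  then have N0: "emeasure lebesgue (\<Phi> ` ?N) = 0" "\<Phi> ` ?N \<in> sets lebesgue"
    by (auto simp: negligible_iff_null_sets)
  have cov: "B \<subseteq> (\<Union>i\<in>C. ?B i) \<union> \<Phi> ` ?N"
  proof
    fix b assume "b \<in> B"
    then obtain x where x: "x \<in> E" "b = \<Phi> x" using sub by blast
    show "b \<in> (\<Union>i\<in>C. ?B i) \<union> \<Phi> ` ?N"
    proof (cases "x \<in> ?N")
      case False
      then obtain i where i: "i \<in> C" "x \<in> ball (fst i) (snd i)" using x U(2) by blast
      have "norm (\<Phi> (fst i) - \<Phi> x) \<le> L * norm (fst i - x)" by (rule lip)
      also have "\<dots> \<le> L * snd i" using i L by (intro mult_left_mono) (auto simp: dist_norm)
      finally show ?thesis using i x by (auto simp: dist_norm)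
    qed (use x in auto)
  qed
  have UN_sets: "(\<Union>i\<in>C. ?B i) \<in> sets lebesgue" using C(1) by (intro sets.countable_UN') auto
  have "emeasure lborel B = emeasure lebesgue B" using B by simp
  also have "\<dots> \<le> emeasure lebesgue ((\<Union>i\<in>C. ?B i) \<union> \<Phi> ` ?N)"
    using UN_sets N0 by (intro emeasure_mono cov sets.Un)
  also have "\<dots> \<le> emeasure lebesgue (\<Union>i\<in>C. ?B i) + emeasure lebesgue (\<Phi> ` ?N)"
    using UN_sets N0 by (intro emeasure_subadditive)
  also have "\<dots> = emeasure lebesgue (\<Union>i\<in>C. ?B i)" using N0 by simp
  also have "\<dots> \<le> (\<integral>\<^sup>+i. emeasure lebesgue (?B i) \<partial>count_space C)"
    using C(1) by (intro emeasure_UN_countable_le) auto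
  also have "\<dots> = (\<integral>\<^sup>+i. ennreal (L ^ DIM('a)) * emeasure lborel (ball (fst i) (snd i)) \<partial>count_space C)"
  proof (intro nn_integral_cong)
    fix i assume "i \<in> space (count_space C)"
    then have i: "snd i > 0" using C(2) by auto
    then show "emeasure lebesgue (?B i) = ennreal (L ^ DIM('a)) * emeasure lborel (ball (fst i) (snd i))"
      using L by (simp add: emeasure_cball emeasure_ball power_mult_distrib ennreal_mult[symmetric] mult_ac)
  qed
  also have "\<dots> = ennreal (L ^ DIM('a)) * (\<integral>\<^sup>+i. emeasure lborel (ball (fst i) (snd i)) \<partial>count_space C)"
    by (intro nn_integral_cmult) auto
  also have "(\<integral>\<^sup>+i. emeasure lborel (ball (fst i) (snd i)) \<partial>count_space C)
      = emeasure lborel (\<Union>i\<in>C. ball (fst i) (snd i))"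
    using C(1,3) by (intro emeasure_UN_countable[symmetric])
      (auto simp: disjoint_family_on_def pairwise_def disjnt_def)
  also have "emeasure lborel (\<Union>i\<in>C. ball (fst i) (snd i)) \<le> emeasure lborel U"
    using C(2) U(1) by (intro emeasure_mono) auto
  also have "emeasure lborel U \<le> emeasure lborel E + emeasure lborel (U - E)"
  proof -
    have "U = E \<union> (U - E)" using U by blast
    then have "emeasure lborel U = emeasure lborel (E \<union> (U - E))" by simp
    also have "\<dots> \<le> emeasure lborel E + emeasure lborel (U - E)"
      using E U(1) by (intro emeasure_subadditive) auto
    finally show ?thesis .
  qed
  also have "\<dots> \<le> emeasure lborel E + ennreal e" using U(3) by (intro add_left_mono) auto
  also have "ennreal (L ^ DIM('a)) * (emeasure lborel E + ennreal e)
      = ennreal (L ^ DIM('a)) * emeasure lborel E + ennreal (L ^ DIM('a) * e)"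
    using L e by (simp add: distrib_left ennreal_mult)
  also have "L ^ DIM('a) * e \<le> e0"
    using L e0 by (simp add: e_def pos_divide_le_eq add_nonneg_pos) 
  finally show "emeasure lborel B \<le> ennreal (L ^ DIM('a)) * emeasure lborel E + ennreal e0"
    by (simp add: mult_left_mono ennreal_leI add_left_mono)
qed

section \<open>The surface measure through volumes of solid cones\<close>

definition sphere_borel :: "'a::euclidean_space measure" where
  "sphere_borel = scale_measure (of_nat DIM('a))
     (distr (restrict_space lborel (cball 0 1 - {0})) (restrict_space borel (sphere 0 1)) sgn)"

text \<open>Borel measurability and push-forwards are handled before completion; the completion
  matters where \<open>f\<close> itself is integrated.\<close>

lemma sphere_measure_eq: "sphere_measure = completion sphere_borel"
  by (simp add: sphere_measure_def sphere_borel_def)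

definition solid_cone :: "'a::euclidean_space set \<Rightarrow> 'a set" where
  "solid_cone A = {z \<in> cball 0 1 - {0}. sgn z \<in> A}"

lemma sets_sphere_borel [measurable_cong]: "sets sphere_borel = sets (restrict_space borel (sphere 0 1))"
  by (simp add: sphere_borel_def)

lemma space_sphere_borel [simp]: "space sphere_borel = sphere 0 1"
  using sets_eq_imp_space_eq[OF sets_sphere_borel] by (simp add: space_restrict_space)

lemma sets_sphere_borelI: "A \<in> sets borel \<Longrightarrow> A \<subseteq> sphere 0 1 \<Longrightarrow> A \<in> sets sphere_borel"
  by (auto simp: sets_sphere_borel sets_restrict_space)

lemma sets_sphere_borelD: "A \<in> sets sphere_borel \<Longrightarrow> A \<in> sets borel \<and> A \<subseteq> sphere 0 1"
  by (auto simp: sets_sphere_borel sets_restrict_space)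

lemma sgn_measurable: "sgn \<in> restrict_space lborel (cball 0 1 - {0}) \<rightarrow>\<^sub>M restrict_space borel (sphere (0::'a::euclidean_space) 1)"
proof (rule measurable_restrict_space2)
  show "sgn \<in> space (restrict_space lborel (cball 0 1 - {0::'a})) \<rightarrow> sphere 0 1"
    by (auto simp: norm_sgn space_restrict_space)
  have "(sgn :: 'a \<Rightarrow> 'a) \<in> borel_measurable borel" unfolding sgn_div_norm by measurable
  then show "sgn \<in> borel_measurable (restrict_space lborel (cball 0 1 - {0::'a}))"
    by (intro measurable_restrict_space1) simp
qed

lemma sets_solid_cone: "A \<in> sets borel \<Longrightarrow> solid_cone A \<in> sets borel"
proof -
  assume A: "A \<in> sets borel"
  have sgn: "(sgn :: 'a \<Rightarrow> 'a) \<in> borel_measurable borel" unfolding sgn_div_norm by measurable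
  have "sgn -` A \<in> sets borel" using measurable_sets[OF sgn A] by simp
  moreover have "solid_cone A = (cball 0 1 - {0}) \<inter> sgn -` A" by (auto simp: solid_cone_def)
  ultimately show "solid_cone A \<in> sets borel" by auto
qed

lemma emeasure_sphere_borel:
  fixes A :: "'a::euclidean_space set"
  assumes "A \<in> sets sphere_borel"
  shows "emeasure sphere_borel A = of_nat DIM('a) * emeasure lborel (solid_cone A)"
proof -
  have "sgn -` A \<inter> space (restrict_space lborel (cball 0 1 - {0})) = solid_cone A"
    by (auto simp: solid_cone_def space_restrict_space)
  moreover have "emeasure (restrict_space lborel (cball 0 1 - {0})) (solid_cone A) = emeasure lborel (solid_cone A)"
    by (intro emeasure_restrict_space) (auto simp: solid_cone_def)
  ultimately show ?thesis
    using assms unfolding sphere_borel_def by (simp add: emeasure_distr[OF sgn_measurable])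
qed

lemma finite_sphere_borel: "finite_measure (sphere_borel :: 'a::euclidean_space measure)"
proof
  have "emeasure lborel (solid_cone (sphere (0::'a) 1)) \<le> emeasure lborel (cball (0::'a) 1)"
    by (intro emeasure_mono) (auto simp: solid_cone_def)
  also have "\<dots> < \<infinity>" by (simp add: emeasure_cball)
  finally show "emeasure sphere_borel (space (sphere_borel :: 'a measure)) \<noteq> \<infinity>"
    by (subst emeasure_sphere_borel) (auto simp: ennreal_mult_eq_top_iff intro!: sets_sphere_borelI)
qed

text \<open>The law of cosines split into a radial and an angular part; later comparisons of
  directions rest on this splitting.\<close>

lemma dist_sphere_scaled:
  fixes u v :: "'a::real_inner"
  assumes "norm u = 1" "norm v = 1"
  shows "(norm (r *\<^sub>R u - s *\<^sub>R v))\<^sup>2 = (r - s)\<^sup>2 + r * s * (norm (u - v))\<^sup>2"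
proof -
  have "u \<bullet> u = 1" "v \<bullet> v = 1" using assms by (simp_all add: dot_square_norm)
  then show ?thesis
    unfolding power2_norm_eq_inner
    by (simp add: inner_diff_left inner_diff_right inner_commute algebra_simps power2_eq_square)
qed

text \<open>In the polar splitting only the angular term is magnified, by at most
  \<open>L\<^sup>2\<close>; the radial term is unchanged and is absorbed because
  \<open>1 \<le> L\<close>.\<close>

lemma homogeneous_extension_lipschitz:
  fixes \<Psi> :: "'a::euclidean_space \<Rightarrow> 'a"
  assumes lip: "\<And>u v. \<lbrakk>norm u = 1; norm v = 1\<rbrakk> \<Longrightarrow> norm (\<Psi> u - \<Psi> v) \<le> L * norm (u - v)"
    and unit: "\<And>u. norm u = 1 \<Longrightarrow> norm (\<Psi> u) = 1" and L: "1 \<le> L"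
  shows "norm (norm x *\<^sub>R \<Psi> (sgn x) - norm y *\<^sub>R \<Psi> (sgn y)) \<le> L * norm (x - y)"
proof (cases "x = 0 \<or> y = 0")
  case True
  have "norm z * norm (\<Psi> (sgn z)) \<le> L * norm z" for z
    using L unit[of "sgn z"] by (cases "z = 0") (auto simp: norm_sgn)
  then show ?thesis using True by auto
next
  case False
  then have u: "norm (sgn x) = 1" "norm (sgn y) = 1" by (auto simp: norm_sgn)
  let ?r = "norm x" and ?s = "norm y"
  have xy: "x = ?r *\<^sub>R sgn x" "y = ?s *\<^sub>R sgn y" using False by (simp_all add: sgn_div_norm)
  have "(norm (?r *\<^sub>R \<Psi> (sgn x) - ?s *\<^sub>R \<Psi> (sgn y)))\<^sup>2 = (?r - ?s)\<^sup>2 + ?r * ?s * (norm (\<Psi> (sgn x) - \<Psi> (sgn y)))\<^sup>2"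
    using unit u by (intro dist_sphere_scaled)
  also have "\<dots> \<le> L\<^sup>2 * (?r - ?s)\<^sup>2 + ?r * ?s * (L * norm (sgn x - sgn y))\<^sup>2"
  proof (intro add_mono mult_left_mono power_mono lip u)
    have "1 \<le> L\<^sup>2" using L by simp
    then show "(?r - ?s)\<^sup>2 \<le> L\<^sup>2 * (?r - ?s)\<^sup>2" using mult_right_mono[of 1 "L\<^sup>2" "(?r - ?s)\<^sup>2"] by simp
  qed auto
  also have "\<dots> = L\<^sup>2 * ((?r - ?s)\<^sup>2 + ?r * ?s * (norm (sgn x - sgn y))\<^sup>2)"
    by (simp add: algebra_simps power_mult_distrib)
  also have "\<dots> = (L * norm (x - y))\<^sup>2"
    using dist_sphere_scaled[OF u, of ?r ?s] by (simp add: power_mult_distrib xy[symmetric])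
  finally show ?thesis by (rule power2_le_imp_le) (use L in simp)
qed

text \<open>Extended homogeneously, the map sends the solid cone over \<open>A\<close> onto a set
  containing the one over \<open>B\<close>, so the volume estimate applies. The exponent is that of
  the ambient space rather than of the sphere, which is harmless when \<open>L\<close> tends to
  1.\<close>

lemma sphere_lipschitz_image_emeasure_le:
  fixes \<Psi> :: "'a::euclidean_space \<Rightarrow> 'a"
  assumes lip: "\<And>u v. \<lbrakk>norm u = 1; norm v = 1\<rbrakk> \<Longrightarrow> norm (\<Psi> u - \<Psi> v) \<le> L * norm (u - v)"
    and unit: "\<And>u. norm u = 1 \<Longrightarrow> norm (\<Psi> u) = 1" and L: "1 \<le> L"
    and A: "A \<in> sets sphere_borel" and B: "B \<in> sets sphere_borel" and sub: "B \<subseteq> \<Psi> ` A"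
  shows "emeasure sphere_borel B \<le> ennreal (L ^ DIM('a)) * emeasure sphere_borel A"
proof -
  let ?\<Phi> = "\<lambda>z. norm z *\<^sub>R \<Psi> (sgn z)"
  have "solid_cone B \<subseteq> ?\<Phi> ` solid_cone A"
  proof
    fix z assume z: "z \<in> solid_cone B"
    then obtain a where a: "a \<in> A" "sgn z = \<Psi> a" using sub by (auto simp: solid_cone_def)
    have na: "norm a = 1" using a A sets_sphere_borelD by fastforce
    let ?z = "norm z *\<^sub>R a"
    have zz: "sgn ?z = a" "norm ?z = norm z" using na z by (auto simp: sgn_scaleR solid_cone_def sgn_div_norm)
    moreover from this have "?z \<in> solid_cone A" using z a by (auto simp: solid_cone_def)
    moreover have "?\<Phi> ?z = z"
      unfolding zz a(2)[symmetric] using z by (simp add: sgn_div_norm solid_cone_def)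
    ultimately show "z \<in> ?\<Phi> ` solid_cone A" by (intro image_eqI[of _ _ ?z]) simp_all
  qed
  then have "emeasure lborel (solid_cone B) \<le> ennreal (L ^ DIM('a)) * emeasure lborel (solid_cone A)"
    using L A B sets_sphere_borelD sets_solid_cone
    by (intro lipschitz_image_emeasure_le[where \<Phi> = ?\<Phi>] homogeneous_extension_lipschitz lip unit) auto
  then have "of_nat DIM('a) * emeasure lborel (solid_cone B) \<le> of_nat DIM('a) * (ennreal (L ^ DIM('a)) * emeasure lborel (solid_cone A))"
    by (intro mult_left_mono) auto
  then show ?thesis using A B by (simp add: emeasure_sphere_borel mult.left_commute)
qed

section \<open>Spherical caps and radial projection of surface-null sets\<close>

lemma sphere_cap_emeasure_le:
  fixes w :: "'a::euclidean_space"
  assumes w: "norm w = 1" and \<rho>: "0 < \<rho>" "\<rho> \<le> 1"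
  shows "emeasure sphere_borel (sphere 0 1 \<inter> cball w \<rho>)
    \<le> ennreal (DIM('a) * 3 * 2 ^ DIM('a) * unit_ball_vol DIM('a) * \<rho> ^ (DIM('a) - 1))"
proof -
  let ?d = "DIM('a)"
  \<comment> \<open>The solid cone over the cap is covered by about \<open>1 / \<rho>\<close> balls
    of radius \<open>2 * \<rho>\<close> strung along its axis; their total volume has order
    \<open>\<rho> ^ (DIM('a) - 1)\<close>.\<close>
  define m where "m = nat \<lceil>1 / \<rho>\<rceil>"
  have m: "real m \<le> 1 / \<rho> + 1" using \<rho> by (simp add: m_def)
  have m': "1 / \<rho> \<le> real m" using \<rho> by (simp add: m_def)
  let ?C = "\<lambda>j::nat. cball ((real j * \<rho>) *\<^sub>R w) (2 * \<rho>)"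
  have "solid_cone (sphere 0 1 \<inter> cball w \<rho>) \<subseteq> (\<Union>j\<in>{..m}. ?C j)"
  proof
    fix z assume "z \<in> solid_cone (sphere 0 1 \<inter> cball w \<rho>)"
    then have z: "norm z \<le> 1" "dist w (sgn z) \<le> \<rho>" by (auto simp: solid_cone_def)
    define j where "j = nat \<lfloor>norm z / \<rho>\<rfloor>"
    have j: "real j \<le> norm z / \<rho>" "norm z / \<rho> \<le> real j + 1"
      using \<rho> by (auto simp: j_def)
    have "norm z / \<rho> \<le> 1 / \<rho>" using z \<rho> by (simp add: divide_right_mono)
    then have jm: "j \<le> m" using j m' by linarith
    have a: "real j * \<rho> \<le> norm z" "norm z \<le> real j * \<rho> + \<rho>" using j \<rho> by (auto simp: field_simps)
    have "(real j * \<rho>) *\<^sub>R w - z = norm z *\<^sub>R (w - sgn z) - (norm z - real j * \<rho>) *\<^sub>R w"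
      using z by (cases "z = 0") (auto simp: sgn_div_norm algebra_simps)
    then have "norm ((real j * \<rho>) *\<^sub>R w - z) \<le> norm (norm z *\<^sub>R (w - sgn z)) + norm ((norm z - real j * \<rho>) *\<^sub>R w)"
      by (metis norm_triangle_ineq4)
    also have "\<dots> \<le> 1 * \<rho> + \<rho>" proof (rule add_mono)
      show "norm (norm z *\<^sub>R (w - sgn z)) \<le> 1 * \<rho>"
        using z \<rho> mult_mono[of "norm z" 1 "norm (w - sgn z)" \<rho>] by (simp add: dist_norm)
      show "norm ((norm z - real j * \<rho>) *\<^sub>R w) \<le> \<rho>" using a w by simp
    qed
    finally show "z \<in> (\<Union>j\<in>{..m}. ?C j)" using jm by (auto simp: dist_norm)
  qed
  then have "emeasure lborel (solid_cone (sphere 0 1 \<inter> cball w \<rho>)) \<le> emeasure lborel (\<Union>j\<in>{..m}. ?C j)"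
    by (intro emeasure_mono) auto
  also have "\<dots> \<le> (\<Sum>j\<in>{..m}. emeasure lborel (?C j))"
    by (intro emeasure_subadditive_finite) auto
  also have "\<dots> = ennreal ((real m + 1) * (unit_ball_vol ?d * (2 * \<rho>) ^ ?d))"
    using \<rho> by (simp add: emeasure_cball ennreal_of_nat_eq_real_of_nat ennreal_mult ennreal_plus[symmetric] add.commute del: ennreal_plus)
  \<comment> \<open>There are \<open>m + 1\<close> centres and
    \<open>m \<le> 1 / \<rho> + 1\<close>; since \<open>\<rho> \<le> 1\<close>, their number is at
    most \<open>3 / \<rho>\<close>.\<close>
  also have "\<dots> \<le> ennreal (3 / \<rho> * (unit_ball_vol ?d * (2 * \<rho>) ^ ?d))"
  proof (intro ennreal_leI mult_right_mono)
    have "1 \<le> 1 / \<rho>" using \<rho> by simp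
    then show "real m + 1 \<le> 3 / \<rho>" using m by (simp add: field_simps)
  qed (use \<rho> in auto)
  also have "3 / \<rho> * (unit_ball_vol ?d * (2 * \<rho>) ^ ?d) = 3 * 2 ^ ?d * unit_ball_vol ?d * \<rho> ^ (?d - 1)"
  proof -
    have "\<rho> ^ ?d = \<rho> * \<rho> ^ (?d - 1)" using DIM_positive[where 'a='a] by (metis power_eq_if less_numeral_extra(3))
    then show ?thesis using \<rho> by (simp add: power_mult_distrib field_simps)
  qed
  finally have *: "emeasure lborel (solid_cone (sphere 0 1 \<inter> cball w \<rho>)) \<le> ennreal (3 * 2 ^ ?d * unit_ball_vol ?d * \<rho> ^ (?d - 1))" .
  have "emeasure sphere_borel (sphere 0 1 \<inter> cball w \<rho>) = of_nat ?d * emeasure lborel (solid_cone (sphere 0 1 \<inter> cball w \<rho>))"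
    by (intro emeasure_sphere_borel sets_sphere_borelI) auto
  also have "\<dots> \<le> of_nat ?d * ennreal (3 * 2 ^ ?d * unit_ball_vol ?d * \<rho> ^ (?d - 1))"
    by (intro mult_left_mono *) auto
  also have "\<dots> = ennreal (?d * 3 * 2 ^ ?d * unit_ball_vol ?d * \<rho> ^ (?d - 1))"
    using \<rho> by (simp add: ennreal_of_nat_eq_real_of_nat ennreal_mult mult.assoc)
  finally show ?thesis .
qed

lemma dist_sgn_square:
  fixes u v :: "'a::real_inner"
  assumes "u \<noteq> 0" "v \<noteq> 0"
  shows "norm u * norm v * (norm (sgn u - sgn v))\<^sup>2 = (norm (u - v))\<^sup>2 - (norm u - norm v)\<^sup>2"
  using dist_sphere_scaled[of "sgn u" "sgn v" "norm u" "norm v"] assms by (simp add: norm_sgn sgn_div_norm)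

lemma dist_sgn_le:
  fixes u v :: "'a::real_inner"
  assumes "\<delta> \<le> norm u" "\<delta> \<le> norm v" "0 < \<delta>"
  shows "norm (sgn u - sgn v) \<le> norm (u - v) / \<delta>"
proof -
  have nz: "u \<noteq> 0" "v \<noteq> 0" using assms by auto
  have "\<delta> * \<delta> * (norm (sgn u - sgn v))\<^sup>2 \<le> norm u * norm v * (norm (sgn u - sgn v))\<^sup>2"
    using assms by (intro mult_mono mult_right_mono) auto
  also have "\<dots> \<le> (norm (u - v))\<^sup>2" using dist_sgn_square[OF nz] by simp
  finally have "(\<delta> * norm (sgn u - sgn v))\<^sup>2 \<le> (norm (u - v))\<^sup>2" by (simp add: power2_eq_square mult_ac)
  then have "\<delta> * norm (sgn u - sgn v) \<le> norm (u - v)" by (rule power2_le_imp_le) simp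
  then show ?thesis using assms by (simp add: field_simps)
qed

text \<open>Converts the radius of a cap into the weight that its covering set has in
  \<open>hausdorff_pre\<close>. The floor \<open>e\<close> keeps the radius positive for covering
  sets of diameter 0 and costs at most \<open>e\<close>.\<close>

lemma unit_ball_vol_half_power_bound:
  assumes "0 \<le> d" "\<delta> > 0" "k \<ge> 1" "0 \<le> e" "e \<le> 1"
  shows "(max (d / \<delta>) e) ^ k \<le> (2 / \<delta>) ^ k / unit_ball_vol (real k) * (unit_ball_vol (real k) * (d / 2) ^ k) + e"
proof -
  have "(max (d / \<delta>) e) ^ k \<le> (d / \<delta>) ^ k + e ^ k"
    using assms by (cases "d / \<delta> \<le> e") (auto simp: max_def)
  moreover have "e ^ k \<le> e" using assms power_decreasing[of 1 k e] by simp
  moreover have "(2 / \<delta>) ^ k / unit_ball_vol (real k) * (unit_ball_vol (real k) * (d / 2) ^ k) = (d / \<delta>) ^ k"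
  proof -
    have "unit_ball_vol (real k) \<noteq> 0" using unit_ball_vol_pos[of "real k"] by linarith
    then show ?thesis using assms by (simp add: power_divide)
  qed
  ultimately show ?thesis by linarith
qed

text \<open>Radial projection from \<open>x\<close> is Lipschitz on a set at positive distance, so it maps Hausdorff-null
  sets to sets covered by small spherical caps.\<close>

lemma surface_null_projection_cover:
  fixes N :: "'a::euclidean_space set"
  assumes null: "surface_null N" and dim: "DIM('a) \<ge> 2" and \<delta>: "\<delta> > 0" "\<And>y. y \<in> N \<Longrightarrow> \<delta> \<le> norm (x - y)"
    and \<epsilon>: "0 < \<epsilon>" "\<epsilon> \<le> 1"
  obtains Z where "Z \<in> sets sphere_borel" "(\<lambda>y. sgn (x - y)) ` N \<subseteq> Z"
    "emeasure sphere_borel Z \<le> ennreal (DIM('a) * 3 * 2 ^ DIM('a) * unit_ball_vol DIM('a) *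
       ((2 / \<delta>) ^ (DIM('a) - 1) / unit_ball_vol (real (DIM('a) - 1)) + 1) * \<epsilon>)"
proof -
  define k where "k = DIM('a) - 1"
  define c where "c = DIM('a) * 3 * 2 ^ DIM('a) * unit_ball_vol DIM('a)"
  define b where "b = (2 / \<delta>) ^ k / unit_ball_vol (real k)"
  have k: "k \<ge> 1" using dim by (simp add: k_def)
  have c0: "c \<ge> 0" by (simp add: c_def)
  have b0: "b \<ge> 0" using \<delta> by (simp add: b_def)
  \<comment> \<open>The scale \<open>\<delta>\<close> makes every
    \<open>diameter (U i) / \<delta>\<close> at most 1, as the cap estimate requires of a
    radius.\<close>
  have "hausdorff_pre k \<delta> N \<le> hausdorff_outer k N"
    unfolding hausdorff_outer_def using \<delta> by (intro SUP_upper) auto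
  then have "hausdorff_pre k \<delta> N < ennreal \<epsilon>"
    using null \<epsilon> by (simp add: surface_null_def k_def)
  then obtain U where U: "N \<subseteq> (\<Union>i. U i)" "\<And>i. bounded (U i)" "\<And>i. diameter (U i) \<le> \<delta>"
    "(\<Sum>i. ennreal (unit_ball_vol (real k) * (diameter (U i) / 2) ^ k)) < ennreal \<epsilon>"
    unfolding hausdorff_pre_def INF_less_iff by auto
  \<comment> \<open>Positive floors for the radii, with sum \<open>\<epsilon>\<close>.\<close>
  define \<eta> where "\<eta> i = \<epsilon> * (1/2) ^ Suc i" for i :: nat
  have eta: "0 < \<eta> i" "\<eta> i \<le> 1" for i
  proof -
    show "0 < \<eta> i" using \<epsilon> by (simp add: \<eta>_def)
    have "(1/2::real) ^ Suc i \<le> 1" by (rule power_le_one) auto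
    then show "\<eta> i \<le> 1" using \<epsilon> mult_mono[of \<epsilon> 1 "(1/2) ^ Suc i" 1] by (simp add: \<eta>_def)
  qed
  define \<rho> where "\<rho> i = max (diameter (U i) / \<delta>) (\<eta> i)" for i
  have rho: "0 < \<rho> i" "\<rho> i \<le> 1" for i
    using eta[of i] U(3)[of i] \<delta> by (auto simp: \<rho>_def less_max_iff_disj)
  \<comment> \<open>Centres are taken in \<open>N\<close>, where the distance to \<open>x\<close> is
    bounded below; \<open>U i\<close> itself may come closer to \<open>x\<close>.\<close>
  define y where "y i = (SOME y. y \<in> U i \<inter> N)" for i
  define A where "A i = (if U i \<inter> N = {} then {} else sphere 0 1 \<inter> cball (sgn (x - y i)) (\<rho> i))" for i
  have y: "y i \<in> U i \<inter> N" if "U i \<inter> N \<noteq> {}" for i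
  proof -
    have "\<exists>z. z \<in> U i \<inter> N" using that by blast
    then show ?thesis unfolding y_def by (rule someI_ex)
  qed
  have nz: "x - z \<noteq> 0" if "z \<in> N" for z using \<delta>(2)[OF that] \<delta>(1) by auto
  have A_sets: "A i \<in> sets sphere_borel" for i
    by (auto simp: A_def intro!: sets_sphere_borelI)
  have cov: "(\<lambda>y. sgn (x - y)) ` N \<subseteq> (\<Union>i. A i)"
  proof
    fix w assume "w \<in> (\<lambda>y. sgn (x - y)) ` N"
    then obtain z where z: "z \<in> N" "w = sgn (x - z)" by blast
    then obtain i where i: "z \<in> U i" using U(1) by blast
    then have ne: "U i \<inter> N \<noteq> {}" using z by blast
    have "dist (sgn (x - y i)) w \<le> norm ((x - y i) - (x - z)) / \<delta>"
      unfolding z(2) dist_norm using \<delta> y[OF ne] z(1) by (intro dist_sgn_le) auto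
    also have "\<dots> = dist z (y i) / \<delta>" by (simp add: dist_norm)
    also have "\<dots> \<le> diameter (U i) / \<delta>"
      using \<delta> i y[OF ne] U(2) by (intro divide_right_mono diameter_bounded_bound) auto
    also have "\<dots> \<le> \<rho> i" by (simp add: \<rho>_def)
    finally have "w \<in> A i" using ne nz[OF z(1)] z(2) by (simp add: A_def norm_sgn)
    then show "w \<in> (\<Union>i. A i)" by blast
  qed
  have meas: "emeasure sphere_borel (A i)
      \<le> ennreal (c * b) * ennreal (unit_ball_vol (real k) * (diameter (U i) / 2) ^ k) + ennreal (c * \<eta> i)" for i
  proof (cases "U i \<inter> N = {}")
    case False
    have n1: "norm (sgn (x - y i)) = 1" using nz y[OF False] by (simp add: norm_sgn)
    have d0: "diameter (U i) \<ge> 0" using U(2) by (simp add: diameter_ge_0)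
    have "emeasure sphere_borel (A i) \<le> ennreal (c * \<rho> i ^ k)"
      using sphere_cap_emeasure_le[OF n1 rho] False by (simp add: A_def c_def k_def)
    also have "\<rho> i ^ k \<le> b * (unit_ball_vol (real k) * (diameter (U i) / 2) ^ k) + \<eta> i"
      unfolding \<rho>_def b_def using eta[of i] d0 \<delta> k by (intro unit_ball_vol_half_power_bound) auto
    then have "ennreal (c * \<rho> i ^ k) \<le> ennreal (c * (b * (unit_ball_vol (real k) * (diameter (U i) / 2) ^ k) + \<eta> i))"
      using c0 by (intro ennreal_leI mult_left_mono)
    also have "\<dots> = ennreal (c * b) * ennreal (unit_ball_vol (real k) * (diameter (U i) / 2) ^ k) + ennreal (c * \<eta> i)"
    proof -
      define v where "v = unit_ball_vol (real k) * (diameter (U i) / 2) ^ k"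
      have "v \<ge> 0" using d0 by (simp add: v_def)
      then have "ennreal (c * (b * v + \<eta> i)) = ennreal (c * b * v + c * \<eta> i)" by (simp add: algebra_simps)
      also have "\<dots> = ennreal (c * b * v) + ennreal (c * \<eta> i)"
        using \<open>v \<ge> 0\<close> c0 b0 eta[of i] by (intro ennreal_plus) auto
      also have "ennreal (c * b * v) = ennreal (c * b) * ennreal v"
        using \<open>v \<ge> 0\<close> c0 b0 by (intro ennreal_mult) auto
      finally show ?thesis by (simp only: v_def)
    qed
    finally show ?thesis .
  qed (simp add: A_def)
  have eta_sum: "(\<Sum>i. ennreal (c * \<eta> i)) = ennreal (c * \<epsilon>)"
  proof -
    have "(\<lambda>i. (c * \<epsilon>) * (1/2) ^ Suc i) sums ((c * \<epsilon>) * 1)"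
      by (intro sums_mult power_half_series)
    then have "(\<lambda>i. c * \<eta> i) sums (c * \<epsilon>)" by (simp add: \<eta>_def mult.assoc)
    then show ?thesis using c0 eta by (intro suminf_ennreal_eq) (auto simp: less_imp_le)
  qed
  show thesis
  proof
    show "(\<Union>i. A i) \<in> sets sphere_borel" using A_sets by auto
    show "(\<lambda>y. sgn (x - y)) ` N \<subseteq> (\<Union>i. A i)" by (rule cov)
    have "emeasure sphere_borel (\<Union>i. A i) \<le> (\<Sum>i. emeasure sphere_borel (A i))"
      using A_sets by (intro emeasure_subadditive_countably) auto
    also have "\<dots> \<le> (\<Sum>i. ennreal (c * b) * ennreal (unit_ball_vol (real k) * (diameter (U i) / 2) ^ k) + ennreal (c * \<eta> i))"
      by (intro suminf_le meas) auto
    also have "\<dots> = ennreal (c * b) * (\<Sum>i. ennreal (unit_ball_vol (real k) * (diameter (U i) / 2) ^ k)) + ennreal (c * \<epsilon>)"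
      by (subst suminf_add[symmetric]) (auto simp: eta_sum)
    also have "\<dots> \<le> ennreal (c * b) * ennreal \<epsilon> + ennreal (c * \<epsilon>)"
      using U(4) by (intro add_right_mono mult_left_mono) auto
    also have "\<dots> = ennreal (c * (b + 1) * \<epsilon>)"
    proof -
      have "ennreal (c * b) * ennreal \<epsilon> + ennreal (c * \<epsilon>) = ennreal (c * b * \<epsilon> + c * \<epsilon>)"
        using c0 b0 \<epsilon> by (simp add: ennreal_mult ennreal_plus)
      also have "c * b * \<epsilon> + c * \<epsilon> = c * (b + 1) * \<epsilon>" by (simp add: algebra_simps)
      finally show ?thesis .
    qed
    finally show "emeasure sphere_borel (\<Union>i. A i) \<le> ennreal (DIM('a) * 3 * 2 ^ DIM('a) * unit_ball_vol DIM('a) *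
       ((2 / \<delta>) ^ (DIM('a) - 1) / unit_ball_vol (real (DIM('a) - 1)) + 1) * \<epsilon>)"
      by (simp add: c_def b_def k_def)
  qed
qed

text \<open>The projected set need not be measurable, so it is enclosed in the intersection of
  measurable covers whose mass tends to 0.\<close>

lemma surface_null_projection_AE:
  fixes N :: "'a::euclidean_space set"
  assumes null: "surface_null N" and dim: "DIM('a) \<ge> 2" and \<delta>: "\<delta> > 0" "\<And>y. y \<in> N \<Longrightarrow> \<delta> \<le> norm (x - y)"
  shows "AE w in sphere_borel. w \<notin> (\<lambda>y. sgn (x - y)) ` N"
proof -
  define c where "c = DIM('a) * 3 * 2 ^ DIM('a) * unit_ball_vol DIM('a) *
       ((2 / \<delta>) ^ (DIM('a) - 1) / unit_ball_vol (real (DIM('a) - 1)) + 1)"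
  have "\<exists>Z. Z \<in> sets sphere_borel \<and> (\<lambda>y. sgn (x - y)) ` N \<subseteq> Z \<and>
      emeasure sphere_borel Z \<le> ennreal (c * (1 / real (Suc n)))" for n
    by (rule surface_null_projection_cover[OF null dim \<delta>, of "1 / real (Suc n)"]) (auto simp: c_def)
  then obtain Z where Z: "\<And>n. Z n \<in> sets sphere_borel" "\<And>n. (\<lambda>y. sgn (x - y)) ` N \<subseteq> Z n"
      "\<And>n. emeasure sphere_borel (Z n) \<le> ennreal (c * (1 / real (Suc n)))" by metis
  have sets: "(\<Inter>n. Z n) \<in> sets sphere_borel" using Z(1) by auto
  have "emeasure sphere_borel (\<Inter>n. Z n) \<le> ennreal (c * (1 / real (Suc n)))" for n
    using Z(1) by (intro order_trans[OF emeasure_mono Z(3)[of n]]) auto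
  moreover have "(\<lambda>n. ennreal (c * (1 / real (Suc n)))) \<longlonglongrightarrow> ennreal (c * 0)"
    by (intro tendsto_ennrealI tendsto_mult tendsto_const) (rule LIMSEQ_Suc, rule lim_1_over_n)
  ultimately have "emeasure sphere_borel (\<Inter>n. Z n) \<le> ennreal (c * 0)"
    by (intro LIMSEQ_le_const) auto
  then have "(\<Inter>n. Z n) \<in> null_sets sphere_borel" using sets by (auto simp: null_sets_def)
  then show ?thesis by (rule AE_I') (use Z(2) in auto)
qed

text \<open>Domination of measures gives domination of integrals for nonnegative functions only,
  hence the shift by \<open>K\<close>. The shift contributes the same total mass to both integrals
  because \<open>\<Lambda>\<close> maps the space into itself.\<close>

lemma integral_pushforward_le:
  fixes h :: "'a \<Rightarrow> real"
  assumes "finite_measure M" and \<Lambda>: "\<Lambda> \<in> M \<rightarrow>\<^sub>M M" and c: "0 \<le> c"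
    and dom: "\<And>A. A \<in> sets M \<Longrightarrow> emeasure M (\<Lambda> -` A \<inter> space M) \<le> ennreal c * emeasure M A"
    and h: "h \<in> borel_measurable M" "\<And>x. x \<in> space M \<Longrightarrow> \<bar>h x\<bar> \<le> K"
  shows "(\<integral>x. h (\<Lambda> x) \<partial>M) \<le> c * ((\<integral>x. h x \<partial>M) + K * measure M (space M)) - K * measure M (space M)"
proof -
  interpret finite_measure M by fact
  have hi: "integrable M h" using h by (intro integrable_const_bound[of _ K]) auto
  have \<Lambda>s: "\<And>x. x \<in> space M \<Longrightarrow> \<Lambda> x \<in> space M" using \<Lambda> measurable_space by fast
  have hmL: "(\<lambda>x. h (\<Lambda> x)) \<in> borel_measurable M" using measurable_compose[OF \<Lambda> h(1)] .
  have hLi: "integrable M (\<lambda>x. h (\<Lambda> x))"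
    using hmL h(2) \<Lambda>s by (intro integrable_const_bound[of _ K]) auto
  have pos: "0 \<le> h x + K" if "x \<in> space M" for x using h(2)[OF that] by (simp add: abs_le_iff)
  have "distr M M \<Lambda> \<le> scale_measure (ennreal c) M"
    by (subst le_measure) (auto simp: emeasure_distr[OF \<Lambda>] dom)
  then have "(\<integral>\<^sup>+x. ennreal (h x + K) \<partial>distr M M \<Lambda>) \<le> (\<integral>\<^sup>+x. ennreal (h x + K) \<partial>scale_measure (ennreal c) M)"
    by (intro nn_integral_mono_measure) auto
  also have "\<dots> = ennreal c * (\<integral>\<^sup>+x. ennreal (h x + K) \<partial>M)"
    using h by (intro nn_integral_scale_measure) auto
  also have "(\<integral>\<^sup>+x. ennreal (h x + K) \<partial>M) = ennreal (\<integral>x. h x + K \<partial>M)"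
    using hi pos by (intro nn_integral_eq_integral) auto
  also have "(\<integral>\<^sup>+x. ennreal (h x + K) \<partial>distr M M \<Lambda>) = (\<integral>\<^sup>+x. ennreal (h (\<Lambda> x) + K) \<partial>M)"
    using h \<Lambda> by (subst nn_integral_distr) auto
  also have "\<dots> = ennreal (\<integral>x. h (\<Lambda> x) + K \<partial>M)"
    using hLi pos[OF \<Lambda>s] by (intro nn_integral_eq_integral) auto
  finally have *: "ennreal (\<integral>x. h (\<Lambda> x) + K \<partial>M) \<le> ennreal (c * (\<integral>x. h x + K \<partial>M))"
    using c by (simp add: ennreal_mult')
  have "0 \<le> (\<integral>x. h x + K \<partial>M)"
    using pos by (intro integral_nonneg_AE AE_I2) auto
  then have "(\<integral>x. h (\<Lambda> x) + K \<partial>M) \<le> c * (\<integral>x. h x + K \<partial>M)"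
    using * c by (subst (asm) ennreal_le_iff) auto
  then show ?thesis using hi hLi by (simp add: mult.commute)
qed

text \<open>The masses of \<open>M\<close> and of its image under \<open>\<Lambda> n\<close> agree, so domination from one side, applied to
  \<open>K + h n\<close> and to \<open>K - h n\<close>, already forces convergence.\<close>

lemma integral_pushforward_tendsto:
  fixes h :: "nat \<Rightarrow> 'a \<Rightarrow> real"
  assumes fin: "finite_measure M" and \<Lambda>: "\<And>n. \<Lambda> n \<in> M \<rightarrow>\<^sub>M M" and c: "\<And>n. 0 \<le> c n" "c \<longlonglongrightarrow> 1"
    and dom: "\<And>n A. A \<in> sets M \<Longrightarrow> emeasure M (\<Lambda> n -` A \<inter> space M) \<le> ennreal (c n) * emeasure M A"
    and h: "\<And>n. h n \<in> borel_measurable M" "\<And>n x. x \<in> space M \<Longrightarrow> \<bar>h n x\<bar> \<le> K"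
    and h': "h' \<in> borel_measurable M" and lim: "AE x in M. (\<lambda>n. h n x) \<longlonglongrightarrow> h' x"
  shows "(\<lambda>n. \<integral>x. h n (\<Lambda> n x) \<partial>M) \<longlonglongrightarrow> (\<integral>x. h' x \<partial>M)"
proof -
  interpret finite_measure M by fact
  let ?m = "measure M (space M)"
  have hlim: "(\<lambda>n. \<integral>x. h n x \<partial>M) \<longlonglongrightarrow> (\<integral>x. h' x \<partial>M)"
    using h h' lim by (intro integral_dominated_convergence[where w="\<lambda>_. K"]) auto
  have up: "(\<integral>x. h n (\<Lambda> n x) \<partial>M) \<le> c n * ((\<integral>x. h n x \<partial>M) + K * ?m) - K * ?m" for n
    by (rule integral_pushforward_le[OF fin \<Lambda> c(1) dom h])
  have lo: "- (c n * (- (\<integral>x. h n x \<partial>M) + K * ?m) - K * ?m) \<le> (\<integral>x. h n (\<Lambda> n x) \<partial>M)" for n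
    using integral_pushforward_le[where \<Lambda>="\<Lambda> n" and c="c n" and h="\<lambda>x. - h n x" and K=K, OF fin \<Lambda> c(1) dom] h by simp
  show ?thesis
  proof (rule tendsto_sandwich)
    show "\<forall>\<^sub>F n in sequentially. (\<integral>x. h n (\<Lambda> n x) \<partial>M) \<le> c n * ((\<integral>x. h n x \<partial>M) + K * ?m) - K * ?m" using up by simp
    show "\<forall>\<^sub>F n in sequentially. - (c n * (- (\<integral>x. h n x \<partial>M) + K * ?m) - K * ?m) \<le> (\<integral>x. h n (\<Lambda> n x) \<partial>M)" using lo by simp
    have "(\<lambda>n. c n * ((\<integral>x. h n x \<partial>M) + K * ?m) - K * ?m) \<longlonglongrightarrow> 1 * ((\<integral>x. h' x \<partial>M) + K * ?m) - K * ?m"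
      by (intro tendsto_intros hlim c)
    then show "(\<lambda>n. c n * ((\<integral>x. h n x \<partial>M) + K * ?m) - K * ?m) \<longlonglongrightarrow> (\<integral>x. h' x \<partial>M)" by simp
    have "(\<lambda>n. - (c n * (- (\<integral>x. h n x \<partial>M) + K * ?m) - K * ?m)) \<longlonglongrightarrow> - (1 * (- (\<integral>x. h' x \<partial>M) + K * ?m) - K * ?m)"
      by (intro tendsto_intros hlim c)
    then show "(\<lambda>n. - (c n * (- (\<integral>x. h n x \<partial>M) + K * ?m) - K * ?m)) \<longlonglongrightarrow> (\<integral>x. h' x \<partial>M)" by simp
  qed
qed

section \<open>Line integrals and the transport equation\<close>

text \<open>\<open>F\<close> belongs to the single point \<open>z0\<close>: it holds the times at
  which the line through \<open>z0\<close> meets an interface. Nearby lines cross at other times,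
  but dominated convergence asks only for convergence at each fixed time off
  \<open>F\<close>.\<close>

lemma continuous_within_parametric_integral:
  fixes k :: "'b::metric_space \<Rightarrow> real \<Rightarrow> real"
  assumes int: "\<And>z. z \<in> Z \<Longrightarrow> k z integrable_on {0..R}"
    and bound: "\<And>z t. \<lbrakk>z \<in> Z; t \<in> {0..R}\<rbrakk> \<Longrightarrow> \<bar>k z t\<bar> \<le> C"
    and F: "finite F" and cont: "\<And>t. t \<in> {0..R} - F \<Longrightarrow> continuous (at z0 within Z) (\<lambda>z. k z t)"
    and z0: "z0 \<in> Z"
  shows "continuous (at z0 within Z) (\<lambda>z. integral {0..R} (k z))"
proof (rule continuous_within_sequentiallyI)
  fix u :: "nat \<Rightarrow> 'b" assume u: "u \<longlonglongrightarrow> z0" "\<forall>n. u n \<in> Z"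
  let ?k = "\<lambda>z t. if t \<in> F then 0 else k z t"
  have eq: "integral {0..R} (k z) = integral {0..R} (?k z)" for z
    by (rule integral_spike[OF negligible_finite[OF F]]) auto
  have "(\<lambda>n. integral {0..R} (?k (u n))) \<longlonglongrightarrow> integral {0..R} (?k z0)"
  proof (rule dominated_convergence(2))
    show "?k (u n) integrable_on {0..R}" for n
      by (rule integrable_spike_finite[OF F _ int[of "u n"]]) (use u(2) in auto)
    \<comment> \<open>The maximum also bounds the value 0 assigned on \<open>F\<close>.\<close>
    show "(\<lambda>t. max 0 C) integrable_on {0..R}" by (rule integrable_const_ivl)
    show "norm (?k (u n) t) \<le> max 0 C" if "t \<in> {0..R}" for n t
      using bound[OF u(2)[rule_format, of n] that] by auto
    show "(\<lambda>n. ?k (u n) t) \<longlonglongrightarrow> ?k z0 t" if "t \<in> {0..R}" for t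
    proof (cases "t \<in> F")
      case False
      then have "continuous (at z0 within Z) (\<lambda>z. k z t)" using cont that by auto
      then have "(\<lambda>n. k (u n) t) \<longlonglongrightarrow> k z0 t"
        using u by (auto simp: continuous_within_sequentially o_def)
      then show ?thesis using False by simp
    qed simp
  qed
  then show "(\<lambda>n. integral {0..R} (k (u n))) \<longlonglongrightarrow> integral {0..R} (k z0)" by (simp add: eq)
qed

text \<open>Replaces the variable exit time by a common upper limit, so that only the integrand
  depends on the chord.\<close>

lemma has_integral_extend_zero:
  fixes f :: "real \<Rightarrow> real"
  assumes "(f has_integral y) {a..b}" "b \<le> c" "\<And>t. b < t \<Longrightarrow> f t = 0"
  shows "(f has_integral y) {a..c}"
proof -
  have e: "{t \<in> {a..b} - {a..c}. f t \<noteq> 0} = {}" "{t \<in> {a..c} - {a..b}. f t \<noteq> 0} = {}"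
    using assms(2,3) by (auto simp: not_le)
  show ?thesis
    by (rule has_integral_spike_set_eq[THEN iffD1, OF _ _ assms(1)]) (simp_all only: e negligible_empty)
qed

text \<open>The optical depth of the backward segment of length \<open>t\<close>.\<close>

definition depth :: "('a::euclidean_space \<Rightarrow> real) \<Rightarrow> 'a \<Rightarrow> 'a \<Rightarrow> real \<Rightarrow> real" where
  "depth m x \<xi> t = integral {0..t} (\<lambda>s. m (x - s *\<^sub>R \<xi>))"

text \<open>\<open>R\<close> exceeds the length of every chord, so the single interval
  \<open>{0..R}\<close> covers all backward chords.\<close>

locale transport_domain = convex_domain \<Omega> for \<Omega> :: "'a::euclidean_space set" +
  fixes \<Omega>\<^sub>0 :: "'a set" and R :: real
  assumes open_dom0: "open \<Omega>\<^sub>0" and dom0_sub: "\<Omega>\<^sub>0 \<subseteq> \<Omega>" and dom0_dense: "\<Omega> \<subseteq> closure \<Omega>\<^sub>0"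
    and finite_crossing: "\<And>x \<xi>. \<lbrakk>x \<in> \<Omega>; norm \<xi> = 1\<rbrakk> \<Longrightarrow> finite {t. 0 \<le> t \<and> x - t *\<^sub>R \<xi> \<in> frontier \<Omega>\<^sub>0}"
    and R: "diameter (closure \<Omega>) < R"
begin

text \<open>Admissible sources along lines: jumps across the interfaces are allowed, and vanishing
  off \<open>\<Omega>\<^sub>0\<close> makes the part of a line beyond its exit contribute
  nothing.\<close>

definition integrand :: "real \<Rightarrow> ('a \<times> 'a \<Rightarrow> real) \<Rightarrow> bool" where
  "integrand C q \<longleftrightarrow> continuous_on (\<Omega>\<^sub>0 \<times> sphere 0 1) q \<and> (\<forall>z \<in> UNIV \<times> sphere 0 1. \<bar>q z\<bar> \<le> C)
     \<and> (\<forall>x \<xi>. norm \<xi> = 1 \<longrightarrow> x \<notin> \<Omega>\<^sub>0 \<longrightarrow> q (x, \<xi>) = 0)"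

lemma R_pos: "0 < R"
proof -
  obtain x where "x \<in> \<Omega>" using nonempty_dom by blast
  then have "0 \<le> diameter (closure \<Omega>)" using bounded_dom by (intro diameter_ge_0) auto
  then show ?thesis using R by simp
qed

lemma back_time_less_R: "(x, \<xi>) \<in> chords \<Omega> \<Longrightarrow> back_time \<Omega> x \<xi> < R"
  using back_time_set(4)[of x \<xi>] chordsD[of x \<xi>] R by fastforce

lemma dom_frontier0: "x \<in> \<Omega> \<Longrightarrow> x \<notin> \<Omega>\<^sub>0 \<Longrightarrow> x \<in> frontier \<Omega>\<^sub>0"
  using dom0_dense open_dom0 by (auto simp: frontier_def interior_open)

text \<open>The crossing hypothesis speaks of backward half lines from interior points. Applied at
  an interior point of the chord in both directions, it controls the whole line, also for base
  points on the boundary.\<close>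

lemma finite_line_crossing:
  assumes "(x, \<xi>) \<in> chords \<Omega>"
  shows "finite {t. x - t *\<^sub>R \<xi> \<in> frontier \<Omega>\<^sub>0}"
proof -
  obtain s where s: "x + s *\<^sub>R \<xi> \<in> \<Omega>" using chordsD(3)[OF assms] by blast
  have n: "norm \<xi> = 1" "norm (- \<xi>) = 1" using chordsD[OF assms] by auto
  let ?y = "x + s *\<^sub>R \<xi>"
  let ?A = "{t. 0 \<le> t \<and> ?y - t *\<^sub>R \<xi> \<in> frontier \<Omega>\<^sub>0}" and ?B = "{t. 0 \<le> t \<and> ?y - t *\<^sub>R (- \<xi>) \<in> frontier \<Omega>\<^sub>0}"
  have "{t. x - t *\<^sub>R \<xi> \<in> frontier \<Omega>\<^sub>0} \<subseteq> (\<lambda>t. t - s) ` ?A \<union> (\<lambda>t. - t - s) ` ?B"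
  proof
    fix t assume "t \<in> {t. x - t *\<^sub>R \<xi> \<in> frontier \<Omega>\<^sub>0}"
    then have t: "x - t *\<^sub>R \<xi> \<in> frontier \<Omega>\<^sub>0" by simp
    have e: "?y - (t + s) *\<^sub>R \<xi> = x - t *\<^sub>R \<xi>" "?y - (- (t + s)) *\<^sub>R (- \<xi>) = x - t *\<^sub>R \<xi>"
      by (simp_all add: scaleR_add_left scaleR_diff_left)
    then have "t + s \<in> ?A \<or> - (t + s) \<in> ?B" unfolding mem_Collect_eq e using t linear[of 0 "t + s"] by auto
    then show "t \<in> (\<lambda>t. t - s) ` ?A \<union> (\<lambda>t. - t - s) ` ?B"
    proof
      assume "t + s \<in> ?A" then show ?thesis by (intro UnI1 image_eqI[of _ _ "t + s"]) simp_all
    next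
      assume "- (t + s) \<in> ?B" then show ?thesis by (intro UnI2 image_eqI[of _ _ "- (t + s)"]) simp_all
    qed
  qed
  then show ?thesis
    using finite_crossing[OF s n(1)] finite_crossing[OF s n(2)] by (meson finite_UnI finite_imageI finite_subset)
qed

text \<open>Off the interfaces a point is either in the open set \<open>\<Omega>\<^sub>0\<close> or
  in the exterior, where \<open>q\<close> vanishes nearby.\<close>

lemma integrand_continuous:
  assumes q: "integrand C q" and z: "z \<notin> frontier \<Omega>\<^sub>0" and \<xi>: "norm \<xi> = 1"
  shows "continuous (at (z, \<xi>) within (UNIV \<times> sphere 0 1)) q"
proof (cases "z \<in> \<Omega>\<^sub>0")
  case True
  have "at (z, \<xi>) within (\<Omega>\<^sub>0 \<times> sphere 0 1) = at (z, \<xi>) within (UNIV \<times> sphere 0 1)"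
    using True open_dom0 by (intro at_within_nhd[of _ "\<Omega>\<^sub>0 \<times> UNIV"]) (auto intro: open_Times)
  then show ?thesis
    using q True \<xi> unfolding integrand_def continuous_on_eq_continuous_within by (metis SigmaI mem_sphere_0)
next
  case False
  then have nc: "z \<in> - closure \<Omega>\<^sub>0" using z open_dom0 by (auto simp: frontier_def interior_open)
  have "\<forall>\<^sub>F w in at (z, \<xi>) within (UNIV \<times> sphere 0 1). w \<in> (- closure \<Omega>\<^sub>0) \<times> UNIV"
    using nc by (intro topological_tendstoD[OF tendsto_ident_at]) (auto intro: open_Times)
  moreover have "\<forall>\<^sub>F w in at (z, \<xi>) within (UNIV \<times> sphere 0 1). w \<in> UNIV \<times> sphere 0 1"
    by (simp add: eventually_at_filter)
  ultimately have "\<forall>\<^sub>F w in at (z, \<xi>) within (UNIV \<times> sphere 0 1). q w = q (z, \<xi>)"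
  proof eventually_elim
    case (elim w)
    obtain a b where w: "w = (a, b)" by fastforce
    have "a \<notin> \<Omega>\<^sub>0" "norm b = 1" using elim w closure_subset[of \<Omega>\<^sub>0] by auto
    then show ?case using q False \<xi> by (simp add: integrand_def w)
  qed
  then show ?thesis unfolding continuous_within by (rule tendsto_eventually)
qed

text \<open>The times spent in \<open>\<Omega>\<^sub>0\<close> form a Borel set on which the
  integrand is continuous; off it the integrand is 0, so it is Borel and bounded.\<close>

lemma integrand_line_integrable:
  assumes q: "integrand C q" and w: "continuous_on {a..b} w" and \<xi>: "norm \<xi> = 1"
  shows "(\<lambda>t. w t * q (x - t *\<^sub>R \<xi>, \<xi>)) integrable_on {a..b}"
proof -
  let ?T = "{t. x - t *\<^sub>R \<xi> \<in> \<Omega>\<^sub>0} \<inter> {a..b}"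
  have "open ((\<lambda>t. x - t *\<^sub>R \<xi>) -` \<Omega>\<^sub>0)"
    by (intro open_vimage open_dom0) (auto intro!: continuous_intros)
  then have T: "?T \<in> sets borel" by (auto simp: vimage_def)
  have "continuous_on ?T (\<lambda>t. w t * q (x - t *\<^sub>R \<xi>, \<xi>))"
  proof (intro continuous_on_mult continuous_on_subset[OF w])
    have "continuous_on (\<Omega>\<^sub>0 \<times> sphere 0 1) q" using q by (simp add: integrand_def)
    moreover have "continuous_on ?T (\<lambda>t. (x - t *\<^sub>R \<xi>, \<xi>))" by (intro continuous_intros)
    moreover have "(\<lambda>t. (x - t *\<^sub>R \<xi>, \<xi>)) ` ?T \<subseteq> \<Omega>\<^sub>0 \<times> sphere 0 1" using \<xi> by auto
    ultimately show "continuous_on ?T (\<lambda>t. q (x - t *\<^sub>R \<xi>, \<xi>))"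
      by (rule continuous_on_compose2)
  qed auto
  from borel_measurable_continuous_on_indicator[OF T this]
  have m: "(\<lambda>t. indicat_real ?T t *\<^sub>R (w t * q (x - t *\<^sub>R \<xi>, \<xi>))) \<in> borel_measurable borel" .
  obtain B where B: "\<And>t. t \<in> {a..b} \<Longrightarrow> norm (w t) \<le> B"
    using compact_imp_bounded[OF compact_continuous_image[OF w compact_Icc]] unfolding bounded_iff by blast
  have C: "\<bar>q (y, \<xi>)\<bar> \<le> C" for y using q \<xi> by (auto simp: integrand_def)
  have "(\<lambda>t. indicat_real ?T t *\<^sub>R (w t * q (x - t *\<^sub>R \<xi>, \<xi>))) integrable_on {a..b}"
  proof (rule measurable_bounded_by_integrable_imp_integrable)
    show "(\<lambda>t. indicat_real ?T t *\<^sub>R (w t * q (x - t *\<^sub>R \<xi>, \<xi>))) \<in> borel_measurable (lebesgue_on {a..b})"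
      using m by (intro measurable_restrict_space1 measurable_completion) simp
    show "(\<lambda>t. B * C) integrable_on {a..b}" by (rule integrable_const_ivl)
    show "norm (indicat_real ?T t *\<^sub>R (w t * q (x - t *\<^sub>R \<xi>, \<xi>))) \<le> B * C" if "t \<in> {a..b}" for t
    proof -
      have BC: "0 \<le> B" "0 \<le> C" using order_trans[OF norm_ge_zero B[OF that]] order_trans[OF abs_ge_zero C] by auto
      have "norm (w t) * \<bar>q (x - t *\<^sub>R \<xi>, \<xi>)\<bar> \<le> B * C" using B[OF that] C BC by (intro mult_mono) auto
      then show ?thesis using BC by (simp add: indicator_def abs_mult)
    qed
  qed auto
  then show ?thesis
  proof (rule integrable_eq)
    fix t assume "t \<in> {a..b}"
    then show "indicat_real ?T t *\<^sub>R (w t * q (x - t *\<^sub>R \<xi>, \<xi>)) = w t * q (x - t *\<^sub>R \<xi>, \<xi>)"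
      using q \<xi> by (auto simp: integrand_def indicator_def)
  qed
qed

lemma integrand_line_continuous:
  assumes q: "integrand C q" and c: "(x, \<xi>) \<in> chords \<Omega>" and t: "x - t *\<^sub>R \<xi> \<notin> frontier \<Omega>\<^sub>0"
  shows "continuous (at (x, \<xi>) within chords \<Omega>) (\<lambda>z. q (fst z - t *\<^sub>R snd z, snd z))"
proof -
  let ?g = "\<lambda>z. (fst z - t *\<^sub>R snd z, snd z) :: 'a \<times> 'a"
  have "continuous (at (?g (x, \<xi>)) within ?g ` chords \<Omega>) q"
    unfolding fst_conv snd_conv
    by (rule continuous_within_subset[OF integrand_continuous[OF q t chordsD(2)[OF c]]]) (auto simp: chords_def)
  moreover have "continuous (at (x, \<xi>) within chords \<Omega>) ?g" by (intro continuous_intros)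
  ultimately show ?thesis by (rule continuous_within_compose2[rotated])
qed

end

section \<open>Attenuated line integrals and the Duhamel formula\<close>

locale attenuated_domain = transport_domain \<Omega> \<Omega>\<^sub>0 R
  for \<Omega> \<Omega>\<^sub>0 :: "'a::euclidean_space set" and R +
  fixes m :: "'a \<Rightarrow> real" and M :: real
  assumes m_nonneg: "\<And>x. 0 \<le> m x" and m_le: "\<And>x. m x \<le> M" and m_cont: "continuous_on \<Omega>\<^sub>0 m"
    and m_zero: "\<And>x. x \<notin> \<Omega>\<^sub>0 \<Longrightarrow> m x = 0"
begin

lemma integrand_m: "integrand M (\<lambda>z. m (fst z))"
  unfolding integrand_def using m_nonneg m_le m_zero
  by (auto intro!: continuous_on_compose2[OF m_cont] continuous_intros)

lemma M_nonneg: "0 \<le> M" using m_nonneg m_le order_trans by blast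

lemma m_line_integrable: "norm \<xi> = 1 \<Longrightarrow> (\<lambda>t. m (x - t *\<^sub>R \<xi>)) integrable_on {a..b}"
  using integrand_line_integrable[OF integrand_m, of a b "\<lambda>_. 1" \<xi> x] by simp

lemma depth_bounds:
  assumes "norm \<xi> = 1" "0 \<le> t"
  shows "0 \<le> depth m x \<xi> t" "depth m x \<xi> t \<le> M * t"
proof -
  show "0 \<le> depth m x \<xi> t"
    unfolding depth_def using assms m_nonneg by (intro integral_nonneg m_line_integrable) auto
  have "depth m x \<xi> t \<le> integral {0..t} (\<lambda>s. M)"
    unfolding depth_def using assms m_le by (intro integral_le m_line_integrable) auto
  then show "depth m x \<xi> t \<le> M * t" using assms by (simp add: mult.commute)
qed

lemma depth_continuous_time: "norm \<xi> = 1 \<Longrightarrow> continuous_on {0..b} (depth m x \<xi>)"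
  unfolding depth_def[abs_def] by (intro indefinite_integral_continuous_1 m_line_integrable)

lemma depth_continuous_at:
  assumes c: "(x, \<xi>) \<in> chords \<Omega>"
  shows "continuous (at (x, \<xi>) within chords \<Omega>) (\<lambda>z. depth m (fst z) (snd z) t)"
  unfolding depth_def
proof (rule continuous_within_parametric_integral[where C = M])
  show "(\<lambda>s. m (fst z - s *\<^sub>R snd z)) integrable_on {0..t}" if "z \<in> chords \<Omega>" for z
    using that by (intro m_line_integrable) (auto simp: chords_def)
  show "\<bar>m (fst z - s *\<^sub>R snd z)\<bar> \<le> M" for z s using m_nonneg m_le by simp
  show "finite {t. x - t *\<^sub>R \<xi> \<in> frontier \<Omega>\<^sub>0}" by (rule finite_line_crossing[OF c])
  show "continuous (at (x, \<xi>) within chords \<Omega>) (\<lambda>z. m (fst z - s *\<^sub>R snd z))"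
    if "s \<in> {0..t} - {t. x - t *\<^sub>R \<xi> \<in> frontier \<Omega>\<^sub>0}" for s
    using integrand_line_continuous[OF integrand_m c, of s] that by simp
qed (rule c)

definition travel :: "('a \<times> 'a \<Rightarrow> real) \<Rightarrow> 'a \<Rightarrow> 'a \<Rightarrow> real" where
  "travel q x \<xi> = integral {0..R} (\<lambda>t. exp (- depth m x \<xi> t) * q (x - t *\<^sub>R \<xi>, \<xi>))"

lemma travel_integrable:
  assumes "integrand C q" "norm \<xi> = 1"
  shows "(\<lambda>t. exp (- depth m x \<xi> t) * q (x - t *\<^sub>R \<xi>, \<xi>)) integrable_on {0..b}"
  using assms by (intro integrand_line_integrable[OF assms(1)] continuous_intros depth_continuous_time)

lemma exp_depth_mult_le:
  assumes "norm \<xi> = 1" "0 \<le> t" "\<bar>a\<bar> \<le> C"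
  shows "\<bar>exp (- depth m x \<xi> t) * a\<bar> \<le> C"
proof -
  have "exp (- depth m x \<xi> t) * \<bar>a\<bar> \<le> 1 * C"
    using depth_bounds[OF assms(1,2)] assms(3) by (intro mult_mono) auto
  then show ?thesis by (simp add: abs_mult)
qed

lemma travel_continuous_at:
  assumes q: "integrand C q" and c: "(x, \<xi>) \<in> chords \<Omega>"
  shows "continuous (at (x, \<xi>) within chords \<Omega>) (\<lambda>z. travel q (fst z) (snd z))"
  unfolding travel_def
proof (rule continuous_within_parametric_integral[where C = C])
  show "(\<lambda>t. exp (- depth m (fst z) (snd z) t) * q (fst z - t *\<^sub>R snd z, snd z)) integrable_on {0..R}"
    if "z \<in> chords \<Omega>" for z
    using that by (intro travel_integrable[OF q]) (auto simp: chords_def)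
  show "\<bar>exp (- depth m (fst z) (snd z) t) * q (fst z - t *\<^sub>R snd z, snd z)\<bar> \<le> C"
    if "z \<in> chords \<Omega>" "t \<in> {0..R}" for z t
    using that q by (intro exp_depth_mult_le) (auto simp: chords_def integrand_def)
  show "finite {t. x - t *\<^sub>R \<xi> \<in> frontier \<Omega>\<^sub>0}" by (rule finite_line_crossing[OF c])
  show "continuous (at (x, \<xi>) within chords \<Omega>)
      (\<lambda>z. exp (- depth m (fst z) (snd z) t) * q (fst z - t *\<^sub>R snd z, snd z))"
    if "t \<in> {0..R} - {t. x - t *\<^sub>R \<xi> \<in> frontier \<Omega>\<^sub>0}" for t
    using that by (intro continuous_intros depth_continuous_at c integrand_line_continuous[OF q c]) auto
qed (rule c)

lemma travel_bound:
  assumes q: "integrand C q" and \<xi>: "norm \<xi> = 1"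
  shows "\<bar>travel q x \<xi>\<bar> \<le> C * R"
proof -
  have "norm (travel q x \<xi>) \<le> integral {0..R} (\<lambda>t. C)"
    unfolding travel_def using q \<xi> exp_depth_mult_le
    by (intro integral_norm_bound_integral travel_integrable[OF q \<xi>]) (auto simp: integrand_def)
  then show ?thesis using R_pos by (simp add: mult.commute)
qed

lemma outside_after_back_time:
  assumes c: "(x, \<xi>) \<in> chords \<Omega>" and t: "back_time \<Omega> x \<xi> < t"
  shows "x - t *\<^sub>R \<xi> \<notin> \<Omega>\<^sub>0"
proof
  assume "x - t *\<^sub>R \<xi> \<in> \<Omega>\<^sub>0"
  then have "x - t *\<^sub>R \<xi> \<in> closure \<Omega>" using dom0_sub closure_subset by blast
  then have "t \<le> back_time \<Omega> x \<xi>"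
    using back_time_set(1)[OF chordsD(1,2)[OF c]] t by (intro back_time_set(3)[OF chordsD(1,2)[OF c]]) auto
  then show False using t by simp
qed

lemma depth_back_time:
  assumes c: "(x, \<xi>) \<in> chords \<Omega>"
  shows "depth m x \<xi> (back_time \<Omega> x \<xi>) = depth m x \<xi> R"
proof -
  let ?b = "back_time \<Omega> x \<xi>"
  have "((\<lambda>s. m (x - s *\<^sub>R \<xi>)) has_integral depth m x \<xi> ?b) {0..?b}"
    unfolding depth_def using chordsD[OF c] by (intro integrable_integral m_line_integrable)
  then have "((\<lambda>s. m (x - s *\<^sub>R \<xi>)) has_integral depth m x \<xi> ?b) {0..R}"
    by (rule has_integral_extend_zero)
      (simp_all add: m_zero outside_after_back_time[OF c] less_imp_le[OF back_time_less_R[OF c]])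
  then show ?thesis unfolding depth_def by (rule integral_unique[symmetric])
qed

lemma depth_deriv:
  assumes \<xi>: "norm \<xi> = 1" and t: "0 < t" "x - t *\<^sub>R \<xi> \<in> \<Omega>\<^sub>0"
  shows "(depth m x \<xi> has_real_derivative m (x - t *\<^sub>R \<xi>)) (at t)"
proof -
  have "isCont m (x - t *\<^sub>R \<xi>)" using m_cont open_dom0 t(2) continuous_on_eq_continuous_at by blast
  then have "isCont (\<lambda>s. m (x - s *\<^sub>R \<xi>)) t"
    by (rule isCont_o2[rotated]) (intro continuous_intros)
  then have cw: "continuous (at t within {0..t+1}) (\<lambda>s. m (x - s *\<^sub>R \<xi>))" by (rule continuous_at_imp_continuous_at_within)
  have "(depth m x \<xi> has_vector_derivative m (x - t *\<^sub>R \<xi>)) (at t within {0..t+1})"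
    unfolding depth_def[abs_def]
    using integral_has_vector_derivative_continuous_at[OF m_line_integrable[OF \<xi>], of t 0 "t+1" "{}" x] cw t
    by simp
  then have "(depth m x \<xi> has_vector_derivative m (x - t *\<^sub>R \<xi>)) (at t within {0<..<t+1})"
    by (rule has_vector_derivative_within_subset) auto
  then show ?thesis
    using t at_within_open[of t "{0<..<t+1}"] by (simp add: has_real_derivative_iff_has_vector_derivative)
qed

text \<open>The fundamental theorem of calculus for \<open>exp (- depth) * u\<close> along the
  backward chord: the integrating factor cancels the attenuation term. The equation holds inside
  \<open>\<Omega>\<^sub>0\<close> only; the finitely many crossing times are exceptional points,
  bridged by continuity of \<open>u\<close>.\<close>

lemma transport_representation:
  assumes c: "(x, \<xi>) \<in> chords \<Omega>"
    and cont: "continuous_on {0..back_time \<Omega> x \<xi>} (\<lambda>t. u (x - t *\<^sub>R \<xi>))"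
    and deriv: "\<And>y. y \<in> \<Omega>\<^sub>0 \<Longrightarrow> ((\<lambda>t. u (y + t *\<^sub>R \<xi>)) has_real_derivative (S y - m y * u y)) (at 0)"
    and S: "\<And>y. y \<notin> \<Omega>\<^sub>0 \<Longrightarrow> S y = 0"
  shows "((\<lambda>t. exp (- depth m x \<xi> t) * S (x - t *\<^sub>R \<xi>)) has_integral
      (u x - exp (- depth m x \<xi> R) * u (entry \<Omega> x \<xi>))) {0..R}"
proof -
  let ?b = "back_time \<Omega> x \<xi>"
  let ?v = "\<lambda>t. - (exp (- depth m x \<xi> t) * u (x - t *\<^sub>R \<xi>))"
  note \<xi> = chordsD(2)[OF c]
  have b0: "0 \<le> ?b" using back_time_set(1) chordsD[OF c] by blast
  have "((\<lambda>t. exp (- depth m x \<xi> t) * S (x - t *\<^sub>R \<xi>)) has_integral (?v ?b - ?v 0)) {0..?b}"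
  proof (rule fundamental_theorem_of_calculus_interior_strong[OF finite_line_crossing[OF c] b0])
    show "continuous_on {0..?b} ?v"
      by (intro continuous_intros cont depth_continuous_time \<xi>)
    fix t assume t: "t \<in> {0<..<?b} - {t. x - t *\<^sub>R \<xi> \<in> frontier \<Omega>\<^sub>0}"
    then have t0: "x - t *\<^sub>R \<xi> \<in> \<Omega>\<^sub>0" using back_segment_in_dom[OF c, of t] dom_frontier0 by auto
    let ?y = "x - t *\<^sub>R \<xi>"
    \<comment> \<open>The hypothesis differentiates forward from the base point \<open>?y\<close>,
      whereas the integration variable runs backward from \<open>x\<close>; this accounts for the
      factor \<open>-1\<close>.\<close>
    have "((\<lambda>r. t - r) has_real_derivative -1) (at t)" by (auto intro!: derivative_eq_intros)
    moreover have "((\<lambda>s. u (?y + s *\<^sub>R \<xi>)) has_real_derivative (S ?y - m ?y * u ?y)) (at (t - t))"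
      using deriv[OF t0] by simp
    ultimately have "((\<lambda>r. u (?y + (t - r) *\<^sub>R \<xi>)) has_real_derivative (S ?y - m ?y * u ?y) * -1) (at t)"
      by (rule DERIV_chain2[rotated])
    moreover have "?y + (t - r) *\<^sub>R \<xi> = x - r *\<^sub>R \<xi>" for r by (simp add: scaleR_diff_left)
    ultimately have du: "((\<lambda>r. u (x - r *\<^sub>R \<xi>)) has_real_derivative - (S ?y - m ?y * u ?y)) (at t)" by simp
    have dd: "(depth m x \<xi> has_real_derivative m ?y) (at t)" using t t0 \<xi> by (intro depth_deriv) auto
    have "(?v has_real_derivative exp (- depth m x \<xi> t) * S ?y) (at t)"
      by (rule derivative_eq_intros du dd refl)+ (simp add: algebra_simps)
    then show "(?v has_vector_derivative exp (- depth m x \<xi> t) * S ?y) (at t)"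
      by (simp add: has_real_derivative_iff_has_vector_derivative)
  qed
  moreover have "?v ?b - ?v 0 = u x - exp (- depth m x \<xi> R) * u (entry \<Omega> x \<xi>)"
    using depth_back_time[OF c] by (simp add: entry_def) (simp add: depth_def)
  ultimately have "((\<lambda>t. exp (- depth m x \<xi> t) * S (x - t *\<^sub>R \<xi>)) has_integral
      (u x - exp (- depth m x \<xi> R) * u (entry \<Omega> x \<xi>))) {0..?b}" by simp
  then show ?thesis
    by (rule has_integral_extend_zero)
      (simp_all add: S outside_after_back_time[OF c] less_imp_le[OF back_time_less_R[OF c]])
qed

text \<open>The constant function 1 solves the transport equation with source
  \<open>m\<close>.\<close>

lemma attenuation_integral:
  assumes c: "(x, \<xi>) \<in> chords \<Omega>"
  shows "((\<lambda>t. exp (- depth m x \<xi> t) * m (x - t *\<^sub>R \<xi>)) has_integral (1 - exp (- depth m x \<xi> R))) {0..R}"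
  using transport_representation[OF c, of "\<lambda>_. 1" m] m_zero by simp

text \<open>The source of the contraction: the weights \<open>exp (- depth) * m\<close> have total
  mass \<open>1 - exp (- depth)\<close> along a chord, and the depth is at most \<open>M * R\<close>
  on every chord.\<close>

lemma attenuation_bound:
  assumes c: "(x, \<xi>) \<in> chords \<Omega>"
    and int: "(\<lambda>t. exp (- depth m x \<xi> t) * S t) integrable_on {0..R}"
    and S: "\<And>t. t \<in> {0..R} \<Longrightarrow> \<bar>S t\<bar> \<le> \<epsilon> * m (x - t *\<^sub>R \<xi>)" and \<epsilon>: "0 \<le> \<epsilon>"
  shows "\<bar>integral {0..R} (\<lambda>t. exp (- depth m x \<xi> t) * S t)\<bar> \<le> \<epsilon> * (1 - exp (- (M * R)))"
proof -
  have I: "((\<lambda>t. \<epsilon> * (exp (- depth m x \<xi> t) * m (x - t *\<^sub>R \<xi>))) has_integral (\<epsilon> * (1 - exp (- depth m x \<xi> R)))) {0..R}"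
    by (rule has_integral_mult_right[OF attenuation_integral[OF c]])
  have "norm (integral {0..R} (\<lambda>t. exp (- depth m x \<xi> t) * S t)) \<le> \<epsilon> * (1 - exp (- depth m x \<xi> R))"
    unfolding integral_unique[OF I, symmetric]
  proof (rule integral_norm_bound_integral[OF int has_integral_integrable[OF I]])
    fix t assume "t \<in> {0..R}"
    then have "exp (- depth m x \<xi> t) * \<bar>S t\<bar> \<le> exp (- depth m x \<xi> t) * (\<epsilon> * m (x - t *\<^sub>R \<xi>))"
      by (intro mult_left_mono S) auto
    then show "norm (exp (- depth m x \<xi> t) * S t) \<le> \<epsilon> * (exp (- depth m x \<xi> t) * m (x - t *\<^sub>R \<xi>))"
      by (simp add: abs_mult mult.left_commute)
  qed
  also have "\<dots> \<le> \<epsilon> * (1 - exp (- (M * R)))"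
    using depth_bounds(2)[OF chordsD(2)[OF c], of R x] R_pos \<epsilon> by (intro mult_left_mono) auto
  finally show ?thesis by simp
qed

end

section \<open>Change of base point in boundary integrals\<close>

text \<open>A second-difference estimate for the norm: the change caused by the shift
  \<open>h\<close> varies slowly with the base vector away from 0. Working with differences of
  squares replaces differentiation and needs a lower bound for one vector only.\<close>

lemma norm_second_difference_le:
  fixes a b h :: "'a::real_inner"
  assumes "\<delta> \<le> norm a" "0 < \<delta>"
  shows "\<bar>(norm (a + h) - norm (b + h)) - (norm a - norm b)\<bar> \<le> 4 * norm h * norm (a - b) / \<delta>"
proof -
  define s X where "s = norm (a + h) + norm a" and "X = norm (a + h) - norm a"
  define s' X' where "s' = norm (b + h) + norm b" and "X' = norm (b + h) - norm b"
  \<comment> \<open>The squared norms differ by an expression affine in \<open>c\<close>, so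
    subtracting the identities for \<open>a\<close> and \<open>b\<close> cancels the term in
    \<open>h\<close> alone.\<close>
  have 1: "(norm (c + h) + norm c) * (norm (c + h) - norm c) = 2 * (c \<bullet> h) + (norm h)\<^sup>2" for c
    using power2_norm_eq_inner[of "c + h"] power2_norm_eq_inner[of c] power2_norm_eq_inner[of h]
    by (simp add: inner_add_left inner_add_right inner_commute power2_eq_square algebra_simps)
  have eq: "s * (X - X') = 2 * ((a - b) \<bullet> h) + X' * (s' - s)"
    using 1[of a] 1[of b] by (simp add: s_def X_def s'_def X'_def inner_diff_left algebra_simps)
  have "\<bar>(a - b) \<bullet> h\<bar> \<le> norm (a - b) * norm h" by (rule Cauchy_Schwarz_ineq2)
  moreover have "\<bar>X'\<bar> \<le> norm h" unfolding X'_def using norm_triangle_ineq3[of "b + h" b] by simp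
  moreover have "\<bar>s' - s\<bar> \<le> 2 * norm (a - b)"
    using norm_triangle_ineq3[of "b + h" "a + h"] norm_triangle_ineq3[of b a]
    by (simp add: s_def s'_def norm_minus_commute)
  ultimately have "\<bar>s * (X - X')\<bar> \<le> 2 * (norm (a - b) * norm h) + norm h * (2 * norm (a - b))"
    unfolding eq by (intro order_trans[OF abs_triangle_ineq] add_mono) (auto simp: abs_mult intro!: mult_mono)
  moreover have "\<delta> \<le> s" using assms by (simp add: s_def add_increasing)
  then have "\<delta> * \<bar>X - X'\<bar> \<le> \<bar>s * (X - X')\<bar>" using assms by (auto simp: abs_mult intro!: mult_mono)
  ultimately have "\<delta> * \<bar>X - X'\<bar> \<le> 4 * norm h * norm (a - b)" by (simp add: algebra_simps)
  then show ?thesis using assms by (simp add: X_def X'_def field_simps)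
qed

text \<open>A common shift keeps \<open>a - b\<close> and hence alters the angle only through the
  norms. By the polar splitting, the angular term changes through a ratio of norms and a difference
  of squared radial gaps, both of first order in \<open>h\<close>; \<open>L\<close> turns
  \<open>norm (a - b)\<close> back into an angle.\<close>

lemma dist_sgn_shift_le:
  fixes a b h :: "'a::real_inner"
  assumes \<delta>: "\<delta> \<le> norm a" "\<delta> \<le> norm b" "0 < \<delta>" and h: "norm h \<le> \<delta> / 2"
    and L: "norm (a - b) \<le> L * norm (sgn a - sgn b)" "0 \<le> L"
  shows "norm (sgn (a + h) - sgn (b + h)) \<le>
    (1 + 2 * norm h / \<delta>) * (1 + 8 * norm h * L\<^sup>2 / \<delta> ^ 3) * norm (sgn a - sgn b)"
proof -
  let ?u = "norm h"
  define D where "D = norm (sgn a - sgn b)"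
  define e where "e = norm (a - b)"
  define A B where "A = norm (a + h)" and "B = norm (b + h)"
  have nz: "a \<noteq> 0" "b \<noteq> 0" using \<delta> by auto
  have A: "\<delta> / 2 \<le> A" "norm a \<le> A + ?u" and B: "\<delta> / 2 \<le> B" "norm b \<le> B + ?u"
    using norm_triangle_ineq4[of "a + h" h] norm_triangle_ineq4[of "b + h" h] h \<delta> by (auto simp: A_def B_def)
  have ah: "a + h \<noteq> 0" "b + h \<noteq> 0" using A(1) B(1) \<delta>(3) by (auto simp: A_def B_def)
  \<comment> \<open>After the shift the norms are still at least \<open>\<delta> / 2\<close>, so the
    loss \<open>?u\<close> is a fraction \<open>2 * ?u / \<delta>\<close> of them.\<close>
  have rat: "norm a \<le> A * (1 + 2 * ?u / \<delta>)" "norm b \<le> B * (1 + 2 * ?u / \<delta>)"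
  proof -
    have "?u \<le> A * (2 * ?u / \<delta>)" "?u \<le> B * (2 * ?u / \<delta>)"
      using A(1) B(1) \<delta>(3) mult_right_mono[OF A(1), of "2 * ?u / \<delta>"] mult_right_mono[OF B(1), of "2 * ?u / \<delta>"] by auto
    then show "norm a \<le> A * (1 + 2 * ?u / \<delta>)" "norm b \<le> B * (1 + 2 * ?u / \<delta>)" using A(2) B(2) by (auto simp: algebra_simps)
  qed
  have e: "0 \<le> e" "e \<le> L * D" using L by (auto simp: e_def D_def)
  have "A * B * (norm (sgn (a + h) - sgn (b + h)))\<^sup>2 = e\<^sup>2 - (A - B)\<^sup>2"
    using dist_sgn_square[OF ah] by (simp add: A_def B_def e_def)
  also have "\<dots> = norm a * norm b * D\<^sup>2 + ((norm a - norm b)\<^sup>2 - (A - B)\<^sup>2)"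
    using dist_sgn_square[OF nz] by (simp add: e_def D_def)
  \<comment> \<open>The difference of squares factors into the second difference, of order
    \<open>?u * e\<close>, and a sum of two radial gaps, each at most \<open>e\<close>.\<close>
  also have "(norm a - norm b)\<^sup>2 - (A - B)\<^sup>2 \<le> (4 * ?u * e / \<delta>) * (2 * e)"
  proof -
    have "(norm a - norm b)\<^sup>2 - (A - B)\<^sup>2 = ((norm a - norm b) - (A - B)) * ((norm a - norm b) + (A - B))"
      by (simp add: power2_eq_square algebra_simps)
    also have "\<dots> \<le> \<bar>(norm a - norm b) - (A - B)\<bar> * \<bar>(norm a - norm b) + (A - B)\<bar>"
      by (metis abs_ge_self abs_mult)
    also have "\<dots> \<le> (4 * ?u * e / \<delta>) * (2 * e)"
    proof (intro mult_mono)
      show "\<bar>(norm a - norm b) - (A - B)\<bar> \<le> 4 * ?u * e / \<delta>"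
        using norm_second_difference_le[OF \<delta>(1,3), of h b] unfolding A_def B_def e_def by linarith
      show "\<bar>(norm a - norm b) + (A - B)\<bar> \<le> 2 * e"
        using norm_triangle_ineq3[of a b] norm_triangle_ineq3[of "a + h" "b + h"]
        by (simp add: A_def B_def e_def)
    qed (use e \<delta> in auto)
    finally show ?thesis .
  qed
  also have "(4 * ?u * e / \<delta>) * (2 * e) = 8 * ?u / \<delta> * e\<^sup>2" by (simp add: power2_eq_square)
  also have "\<dots> \<le> 8 * ?u / \<delta> * (L * D)\<^sup>2"
    using e \<delta> by (intro mult_left_mono power_mono) auto
  also have "\<dots> \<le> norm a * norm b * (8 * ?u * L\<^sup>2 / \<delta> ^ 3 * D\<^sup>2)"
  proof -
    have "8 * ?u / \<delta> * (L * D)\<^sup>2 = \<delta> * \<delta> * (8 * ?u * L\<^sup>2 / \<delta> ^ 3 * D\<^sup>2)"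
      using \<delta>(3) by (simp add: power_mult_distrib power3_eq_cube)
    also have "\<dots> \<le> norm a * norm b * (8 * ?u * L\<^sup>2 / \<delta> ^ 3 * D\<^sup>2)"
      using \<delta> by (intro mult_right_mono mult_mono) auto
    finally show ?thesis .
  qed
  finally have "A * B * (norm (sgn (a + h) - sgn (b + h)))\<^sup>2 \<le> norm a * norm b * ((1 + 8 * ?u * L\<^sup>2 / \<delta> ^ 3) * D\<^sup>2)"
    by (simp add: algebra_simps)
  also have "\<dots> \<le> (A * (1 + 2 * ?u / \<delta>)) * (B * (1 + 2 * ?u / \<delta>)) * ((1 + 8 * ?u * L\<^sup>2 / \<delta> ^ 3)\<^sup>2 * D\<^sup>2)"
  proof (intro mult_mono rat mult_right_mono)
    \<comment> \<open>Squaring the factor is wasteful but leaves a perfect square, from which the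
      root can be taken.\<close>
    have "0 \<le> 8 * ?u * L\<^sup>2 / \<delta> ^ 3" using \<delta> by simp
    then show "1 + 8 * ?u * L\<^sup>2 / \<delta> ^ 3 \<le> (1 + 8 * ?u * L\<^sup>2 / \<delta> ^ 3)\<^sup>2"
      using mult_left_mono[of 1 "1 + 8 * ?u * L\<^sup>2 / \<delta> ^ 3" "1 + 8 * ?u * L\<^sup>2 / \<delta> ^ 3"] by (simp add: power2_eq_square)
  qed (use \<delta> A B in auto)
  also have "\<dots> = A * B * ((1 + 2 * ?u / \<delta>) * (1 + 8 * ?u * L\<^sup>2 / \<delta> ^ 3) * D)\<^sup>2"
    by (simp add: power_mult_distrib power2_eq_square)
  finally have "(norm (sgn (a + h) - sgn (b + h)))\<^sup>2 \<le> ((1 + 2 * ?u / \<delta>) * (1 + 8 * ?u * L\<^sup>2 / \<delta> ^ 3) * D)\<^sup>2"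
    using A(1) B(1) \<delta>(3) by (simp add: mult_le_cancel_left_pos)
  then show ?thesis unfolding D_def by (rule power2_le_imp_le) (use \<delta> in auto)
qed

lemma measurable_sphere_borelI: "continuous_on (sphere 0 1) f \<Longrightarrow> f \<in> borel_measurable sphere_borel"
  by (simp add: measurable_cong_sets[OF sets_sphere_borel refl] borel_measurable_continuous_on_restrict)

section \<open>Boundary points and directions as parameters of each other\<close>

context convex_domain
begin

text \<open>By convexity the closure contains the hull of the ball around \<open>x\<close> and the
  boundary point in direction \<open>u\<close>. This hull meets the ray in the neighbouring
  direction \<open>v\<close> at a distance not much shorter, which bounds \<open>back_time\<close>
  in direction \<open>v\<close> from below.\<close>

lemma back_time_diff_le:
  assumes x: "cball x \<delta> \<subseteq> closure \<Omega>" "\<delta> > 0" and u: "norm u = 1" "norm v = 1"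
  shows "back_time \<Omega> x u - back_time \<Omega> x v \<le> (diameter (closure \<Omega>))\<^sup>2 / \<delta> * norm (u - v)"
proof -
  let ?r = "back_time \<Omega> x u" and ?D = "norm (u - v)"
  have xc: "x \<in> closure \<Omega>" using x by auto
  note bu = back_time_set[OF xc u(1)] and bv = back_time_set[OF xc u(2)]
  show ?thesis
  proof (cases "?r * ?D = 0")
    case True
    have "0 \<le> (diameter (closure \<Omega>))\<^sup>2 / \<delta> * ?D" using x by simp
    moreover have "?r \<le> back_time \<Omega> x v" using True bv(1) by auto
    ultimately show ?thesis by linarith
  next
    case False
    then have rD: "?r * ?D > 0" using bu(1) by (simp add: less_le)
    \<comment> \<open>The weight for which the auxiliary point \<open>x + b\<close>, combined with
      the endpoint in direction \<open>u\<close>, lands on the ray in direction \<open>v\<close>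
      while \<open>b\<close> has norm exactly \<open>\<delta>\<close>.\<close>
    define lam where "lam = \<delta> / (\<delta> + ?r * ?D)"
    have lam: "0 < lam" "lam < 1" using rD x by (auto simp: lam_def field_simps)
    define b where "b = (lam * ?r / (1 - lam)) *\<^sub>R (u - v)"
    have "norm b = lam * ?r / (1 - lam) * ?D" using lam bu(1) by (simp add: b_def)
    also have "\<dots> = \<delta>"
    proof -
      have "1 - lam = ?r * ?D / (\<delta> + ?r * ?D)" using rD x by (simp add: lam_def field_simps)
      moreover have "?r \<noteq> 0" "u \<noteq> v" using rD by auto
      ultimately show ?thesis using rD x by (simp add: lam_def)
    qed
    finally have "x + b \<in> closure \<Omega>" using x(1) by (auto simp: dist_norm)
    then have "lam *\<^sub>R (x - ?r *\<^sub>R u) + (1 - lam) *\<^sub>R (x + b) \<in> closure \<Omega>"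
      using lam bu(2) by (intro convexD[OF convex_closure[OF convex_dom]]) auto
    also have "lam *\<^sub>R (x - ?r *\<^sub>R u) + (1 - lam) *\<^sub>R (x + b) = x - (lam * ?r) *\<^sub>R v"
    proof -
      have "(1 - lam) *\<^sub>R b = (lam * ?r) *\<^sub>R (u - v)" using lam by (simp add: b_def)
      then have "(1 - lam) *\<^sub>R (x + b) = (1 - lam) *\<^sub>R x + (lam * ?r) *\<^sub>R (u - v)" by (simp add: scaleR_add_right)
      then show ?thesis by (simp add: algebra_simps)
    qed
    finally have "lam * ?r \<le> back_time \<Omega> x v" using lam bu(1) by (intro bv(3)) auto
    then have "?r - back_time \<Omega> x v \<le> (1 - lam) * ?r" by (simp add: algebra_simps)
    also have "1 - lam \<le> ?r * ?D / \<delta>"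
    proof -
      have "1 - lam = ?r * ?D / (\<delta> + ?r * ?D)" using rD x by (simp add: lam_def field_simps)
      also have "\<dots> \<le> ?r * ?D / \<delta>" using rD x by (intro divide_left_mono) auto
      finally show ?thesis .
    qed
    then have "(1 - lam) * ?r \<le> ?r * ?D / \<delta> * ?r" using bu(1) by (intro mult_right_mono)
    also have "\<dots> = ?r\<^sup>2 / \<delta> * ?D" by (simp add: power2_eq_square)
    also have "\<dots> \<le> (diameter (closure \<Omega>))\<^sup>2 / \<delta> * ?D"
      using bu(1,4) x by (intro mult_right_mono divide_right_mono power_mono) auto
    finally show ?thesis .
  qed
qed

lemma entry_lipschitz:
  assumes x: "cball x \<delta> \<subseteq> closure \<Omega>" "\<delta> > 0" and u: "norm u = 1" "norm v = 1"
  shows "norm (entry \<Omega> x u - entry \<Omega> x v) \<le>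
    ((diameter (closure \<Omega>))\<^sup>2 / \<delta> + diameter (closure \<Omega>)) * norm (u - v)"
proof -
  let ?r = "back_time \<Omega> x u" and ?s = "back_time \<Omega> x v"
  have xc: "x \<in> closure \<Omega>" using x by auto
  have "entry \<Omega> x u - entry \<Omega> x v = - ((?r - ?s) *\<^sub>R u + ?s *\<^sub>R (u - v))" by (simp add: entry_def algebra_simps)
  then have "norm (entry \<Omega> x u - entry \<Omega> x v) \<le> norm ((?r - ?s) *\<^sub>R u) + norm (?s *\<^sub>R (u - v))"
    by (metis norm_minus_cancel norm_triangle_ineq)
  also have "\<dots> = \<bar>?r - ?s\<bar> + ?s * norm (u - v)" using u back_time_set(1)[OF xc u(2)] by simp
  also have "\<dots> \<le> (diameter (closure \<Omega>))\<^sup>2 / \<delta> * norm (u - v) + diameter (closure \<Omega>) * norm (u - v)"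
    using back_time_diff_le[OF x u] back_time_diff_le[OF x u(2,1)] back_time_set(4)[OF xc u(2)]
    by (intro add_mono mult_right_mono) (auto simp: abs_le_iff norm_minus_commute)
  finally show ?thesis by (simp add: algebra_simps)
qed

lemma entry_frontier:
  assumes "x \<in> \<Omega>" "norm \<xi> = 1"
  shows "entry \<Omega> x \<xi> \<in> frontier \<Omega>" "(entry \<Omega> x \<xi>, \<xi>) \<in> inflow \<Omega>"
  using entry_inflow[OF chords_interior[OF assms]] by (auto simp: inflow_def)

lemma sgn_entry:
  assumes "x \<in> \<Omega>" "norm \<xi> = 1"
  shows "sgn (x - entry \<Omega> x \<xi>) = \<xi>"
proof -
  have "back_time \<Omega> x \<xi> \<noteq> 0"
    using entry_frontier(1)[OF assms] assms open_dom by (auto simp: entry_def frontier_def interior_open)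
  then have "back_time \<Omega> x \<xi> > 0"
    using back_time_set(1)[of x \<xi>] assms closure_subset by (metis less_eq_real_def subsetD)
  then show ?thesis using assms by (simp add: entry_def sgn_scaleR) (simp add: sgn_div_norm)
qed

text \<open>Together with \<open>sgn_entry\<close>, this makes \<open>entry \<Omega> x\<close> and
  \<open>\<lambda>y. sgn (x - y)\<close> mutually inverse between directions and boundary
  points.\<close>

lemma frontier_inflow:
  assumes "x \<in> \<Omega>" "y \<in> frontier \<Omega>"
  shows "norm (sgn (x - y)) = 1" "(y, sgn (x - y)) \<in> inflow \<Omega>" "entry \<Omega> x (sgn (x - y)) = y"
proof -
  have "x \<noteq> y" using assms open_dom by (auto simp: frontier_def interior_open)
  then show n: "norm (sgn (x - y)) = 1" by (simp add: norm_sgn)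
  have e: "y + norm (x - y) *\<^sub>R sgn (x - y) = x" using \<open>x \<noteq> y\<close> by (simp add: sgn_div_norm)
  then show i: "(y, sgn (x - y)) \<in> inflow \<Omega>"
    using assms n \<open>x \<noteq> y\<close> unfolding inflow_def by (auto intro!: exI[of _ "norm (x - y)"])
  show "entry \<Omega> x (sgn (x - y)) = y"
    using inflow_forward(3)[OF i, of "norm (x - y)"] e assms closure_subset by auto
qed

lemma entry_continuous_dir: "x \<in> \<Omega> \<Longrightarrow> continuous_on (sphere 0 1) (entry \<Omega> x)"
proof -
  assume "x \<in> \<Omega>"
  then have "continuous_on (sphere 0 1) (\<lambda>\<xi>. (\<lambda>(x, \<xi>). entry \<Omega> x \<xi>) (x, \<xi>))"
    by (intro continuous_on_compose2[OF entry_continuous]) (auto intro!: continuous_intros chords_interior)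
  then show ?thesis by simp
qed

lemma sgn_entry_measurable:
  assumes "x \<in> \<Omega>" "z \<in> \<Omega>"
  shows "(\<lambda>\<xi>. sgn (z - entry \<Omega> x \<xi>)) \<in> sphere_borel \<rightarrow>\<^sub>M sphere_borel"
proof -
  have nz: "z - entry \<Omega> x \<xi> \<noteq> 0" if "\<xi> \<in> sphere 0 1" for \<xi>
    using entry_frontier(1)[of x \<xi>] assms that open_dom by (auto simp: frontier_def interior_open)
  have "continuous_on (sphere 0 1) (\<lambda>\<xi>. sgn (z - entry \<Omega> x \<xi>))"
    using nz by (intro continuous_intros entry_continuous_dir assms) auto
  then have "(\<lambda>\<xi>. sgn (z - entry \<Omega> x \<xi>)) \<in> borel_measurable sphere_borel" by (rule measurable_sphere_borelI)
  then have "(\<lambda>\<xi>. sgn (z - entry \<Omega> x \<xi>)) \<in> sphere_borel \<rightarrow>\<^sub>M restrict_space borel (sphere 0 1)"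
    using nz by (intro measurable_restrict_space2) (auto simp: norm_sgn)
  then show ?thesis by (simp add: measurable_cong_sets[OF refl sets_sphere_borel])
qed

text \<open>Seen from a nearby point \<open>z\<close>, the boundary is parametrised by the directions at \<open>x\<close> through
  a map of Lipschitz constant close to \<open>1\<close>; no Jacobian is needed.\<close>

lemma direction_pushforward_le:
  assumes x: "x \<in> \<Omega>" "cball x \<delta> \<subseteq> closure \<Omega>" "\<delta> > 0" and z: "z \<in> \<Omega>" "norm (z - x) \<le> \<delta> / 2"
    and A: "A \<in> sets sphere_borel"
    and L: "L = (diameter (closure \<Omega>))\<^sup>2 / \<delta> + diameter (closure \<Omega>)"
  shows "emeasure sphere_borel ((\<lambda>\<xi>. sgn (x - entry \<Omega> z \<xi>)) -` A \<inter> space sphere_borel) \<le>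
    ennreal (((1 + 2 * norm (z - x) / \<delta>) * (1 + 8 * norm (z - x) * L\<^sup>2 / \<delta> ^ 3)) ^ DIM('a)) * emeasure sphere_borel A"
proof (rule sphere_lipschitz_image_emeasure_le[where \<Psi> = "\<lambda>\<omega>. sgn (z - entry \<Omega> x \<omega>)", OF _ _ _ A])
  have L0: "0 \<le> L" using x(3) diameter_ge_0[OF bounded_closure[OF bounded_dom]] by (simp add: L)
  let ?c = "(1 + 2 * norm (z - x) / \<delta>) * (1 + 8 * norm (z - x) * L\<^sup>2 / \<delta> ^ 3)"
  show "1 \<le> ?c"
  proof -
    have "1 * 1 \<le> ?c" using x by (intro mult_mono) auto
    then show ?thesis by simp
  qed
  show "norm (sgn (z - entry \<Omega> x u)) = 1" if "norm u = 1" for u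
    using frontier_inflow(1)[OF z(1) entry_frontier(1)[OF x(1) that]] .
  show "norm (sgn (z - entry \<Omega> x u) - sgn (z - entry \<Omega> x v)) \<le> ?c * norm (u - v)"
    if uv: "norm u = 1" "norm v = 1" for u v
  proof -
    let ?a = "x - entry \<Omega> x u" and ?b = "x - entry \<Omega> x v" and ?h = "z - x"
    have far: "\<delta> \<le> norm (x - entry \<Omega> x w)" if "norm w = 1" for w
    proof -
      have "x - \<delta> *\<^sub>R w \<in> closure \<Omega>" using x that by (auto simp: dist_norm)
      then have "\<delta> \<le> back_time \<Omega> x w"
        using x that closure_subset by (intro back_time_set(3)) auto
      then show ?thesis using that x by (simp add: entry_def)
    qed
    have s: "sgn ?a = u" "sgn ?b = v" using sgn_entry x uv by auto
    \<comment> \<open>Moving the eye from \<open>x\<close> to \<open>z\<close> shifts both viewing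
      vectors by the same \<open>?h\<close>.\<close>
    have "norm (sgn (?a + ?h) - sgn (?b + ?h)) \<le> ?c * norm (sgn ?a - sgn ?b)"
    proof (rule dist_sgn_shift_le[OF far[OF uv(1)] far[OF uv(2)] x(3) z(2) _ L0])
      have "norm (?a - ?b) = norm (entry \<Omega> x u - entry \<Omega> x v)" by (simp add: norm_minus_commute)
      then show "norm (?a - ?b) \<le> L * norm (sgn ?a - sgn ?b)"
        unfolding s using entry_lipschitz[OF x(2,3) uv] by (simp add: L)
    qed
    then show ?thesis unfolding s by simp
  qed
  show "(\<lambda>\<xi>. sgn (x - entry \<Omega> z \<xi>)) -` A \<inter> space sphere_borel \<in> sets sphere_borel"
    by (rule measurable_sets[OF sgn_entry_measurable[OF z(1) x(1)] A])
  \<comment> \<open>The direction maps between \<open>x\<close> and \<open>z\<close> are inverse to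
    each other, so a preimage under one is contained in the image under the other.\<close>
  show "(\<lambda>\<xi>. sgn (x - entry \<Omega> z \<xi>)) -` A \<inter> space sphere_borel \<subseteq> (\<lambda>\<omega>. sgn (z - entry \<Omega> x \<omega>)) ` A"
  proof
    fix \<xi> assume \<xi>: "\<xi> \<in> (\<lambda>\<xi>. sgn (x - entry \<Omega> z \<xi>)) -` A \<inter> space sphere_borel"
    then have n: "norm \<xi> = 1" by simp
    have "entry \<Omega> x (sgn (x - entry \<Omega> z \<xi>)) = entry \<Omega> z \<xi>"
      by (rule frontier_inflow(3)[OF x(1) entry_frontier(1)[OF z(1) n]])
    then have "sgn (z - entry \<Omega> x (sgn (x - entry \<Omega> z \<xi>))) = \<xi>" using sgn_entry[OF z(1) n] by simp
    then show "\<xi> \<in> (\<lambda>\<omega>. sgn (z - entry \<Omega> x \<omega>)) ` A" using \<xi> by (metis IntE image_eqI vimageE)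
  qed
qed

lemma inflow_measurable:
  assumes f0: "f\<^sub>0 \<in> borel_measurable (restrict_space borel (inflow \<Omega>))"
    and g: "g \<in> borel_measurable sphere_borel" "h \<in> borel_measurable sphere_borel"
    and gh: "\<And>\<xi>. norm \<xi> = 1 \<Longrightarrow> (g \<xi>, h \<xi>) \<in> inflow \<Omega>"
  shows "(\<lambda>\<xi>. f\<^sub>0 (g \<xi>, h \<xi>)) \<in> borel_measurable sphere_borel"
proof (rule measurable_compose[OF _ f0])
  have "(\<lambda>\<xi>. (g \<xi>, h \<xi>)) \<in> borel_measurable sphere_borel" using g by (rule borel_measurable_Pair)
  then show "(\<lambda>\<xi>. (g \<xi>, h \<xi>)) \<in> sphere_borel \<rightarrow>\<^sub>M restrict_space borel (inflow \<Omega>)"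
    using gh by (intro measurable_restrict_space2) auto
qed

text \<open>Convergence of the kernels is demanded along moving directions, because under pointwise
  regularity of the data the boundary point is held fixed and its direction as seen from
  \<open>X n\<close> varies with \<open>n\<close>.\<close>

lemma boundary_integral_tendsto:
  fixes f\<^sub>0 :: "'a \<times> 'a \<Rightarrow> real" and \<phi> :: "nat \<Rightarrow> 'a \<Rightarrow> real" and \<phi>' :: "'a \<Rightarrow> real"
  assumes x: "x \<in> \<Omega>" and X: "\<And>n. X n \<in> \<Omega>" "X \<longlonglongrightarrow> x"
    and \<phi>: "\<And>n. \<phi> n \<in> borel_measurable sphere_borel" "\<And>n \<xi>. norm \<xi> = 1 \<Longrightarrow> \<bar>\<phi> n \<xi>\<bar> \<le> C"
      "\<phi>' \<in> borel_measurable sphere_borel"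
      "\<And>\<zeta> \<xi>. \<lbrakk>\<zeta> \<longlonglongrightarrow> \<xi>; \<And>n. norm (\<zeta> n) = 1; norm \<xi> = 1\<rbrakk> \<Longrightarrow> (\<lambda>n. \<phi> n (\<zeta> n)) \<longlonglongrightarrow> \<phi>' \<xi>"
    and f0: "f\<^sub>0 \<in> borel_measurable (restrict_space borel (inflow \<Omega>))" "\<And>z. z \<in> inflow \<Omega> \<Longrightarrow> \<bar>f\<^sub>0 z\<bar> \<le> K"
    and dim: "DIM('a) \<ge> 2"
    and cases: "surface_null {y \<in> frontier \<Omega>. \<not> continuous_on {\<xi>. (y, \<xi>) \<in> inflow \<Omega>} (\<lambda>\<xi>. f\<^sub>0 (y, \<xi>))}
      \<or> (AE \<xi> in sphere_borel. continuous_on {y. (y, \<xi>) \<in> inflow \<Omega>} (\<lambda>y. f\<^sub>0 (y, \<xi>)))"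
  shows "(\<lambda>n. \<integral>\<xi>. \<phi> n \<xi> * f\<^sub>0 (entry \<Omega> (X n) \<xi>, \<xi>) \<partial>sphere_borel)
    \<longlonglongrightarrow> (\<integral>\<xi>. \<phi>' \<xi> * f\<^sub>0 (entry \<Omega> x \<xi>, \<xi>) \<partial>sphere_borel)"
proof -
  interpret finite_measure "sphere_borel :: 'a measure" by (rule finite_sphere_borel)
  have id: "(\<lambda>\<xi>. \<xi>) \<in> borel_measurable (sphere_borel :: 'a measure)"
    by (intro measurable_sphere_borelI continuous_intros)
  have em: "entry \<Omega> z \<in> borel_measurable sphere_borel" if "z \<in> \<Omega>" for z
    using that by (intro measurable_sphere_borelI entry_continuous_dir)
  have lim_meas: "(\<lambda>\<xi>. \<phi>' \<xi> * f\<^sub>0 (entry \<Omega> x \<xi>, \<xi>)) \<in> borel_measurable sphere_borel"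
    by (rule borel_measurable_times[OF \<phi>(3) inflow_measurable[OF f0(1) em[OF x] id entry_frontier(2)[OF x]]])
  have bound: "\<bar>\<phi> n \<xi> * f\<^sub>0 (y, \<eta>)\<bar> \<le> C * K" if "norm \<xi> = 1" "(y, \<eta>) \<in> inflow \<Omega>" for n \<xi> y \<eta>
    unfolding abs_mult using \<phi>(2)[OF that(1)] f0(2)[OF that(2)]
    by (intro mult_mono) (auto intro: order_trans[OF abs_ge_zero])
  have seq: "(\<lambda>n. f\<^sub>0 (y, \<zeta> n)) \<longlonglongrightarrow> f\<^sub>0 (y, \<xi>)"
    if "continuous_on {\<xi>. (y, \<xi>) \<in> inflow \<Omega>} (\<lambda>\<xi>. f\<^sub>0 (y, \<xi>))" "\<zeta> \<longlonglongrightarrow> \<xi>" "\<And>n. (y, \<zeta> n) \<in> inflow \<Omega>" "(y, \<xi>) \<in> inflow \<Omega>"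
    for y \<zeta> \<xi> using continuous_on_tendsto_compose[OF that(1,2)] that(3,4) by simp
  consider (pt) "surface_null {y \<in> frontier \<Omega>. \<not> continuous_on {\<xi>. (y, \<xi>) \<in> inflow \<Omega>} (\<lambda>\<xi>. f\<^sub>0 (y, \<xi>))}"
    | (dir) "AE \<xi> in sphere_borel. continuous_on {y. (y, \<xi>) \<in> inflow \<Omega>} (\<lambda>y. f\<^sub>0 (y, \<xi>))" using cases by blast
  then show ?thesis
  proof cases
    case dir
    show ?thesis
    proof (rule integral_dominated_convergence[where w = "\<lambda>_. C * K"])
      show "(\<lambda>\<xi>. \<phi>' \<xi> * f\<^sub>0 (entry \<Omega> x \<xi>, \<xi>)) \<in> borel_measurable sphere_borel" by (rule lim_meas)
      show "(\<lambda>\<xi>. \<phi> n \<xi> * f\<^sub>0 (entry \<Omega> (X n) \<xi>, \<xi>)) \<in> borel_measurable sphere_borel" for n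
        by (rule borel_measurable_times[OF \<phi>(1) inflow_measurable[OF f0(1) em[OF X(1)] id entry_frontier(2)[OF X(1)]]])
      show "AE \<xi> in sphere_borel. norm (\<phi> n \<xi> * f\<^sub>0 (entry \<Omega> (X n) \<xi>, \<xi>)) \<le> C * K" for n
        using X by (intro AE_I2) (simp add: bound entry_frontier del: abs_mult)
      show "AE \<xi> in sphere_borel. (\<lambda>n. \<phi> n \<xi> * f\<^sub>0 (entry \<Omega> (X n) \<xi>, \<xi>)) \<longlonglongrightarrow> \<phi>' \<xi> * f\<^sub>0 (entry \<Omega> x \<xi>, \<xi>)"
        using dir AE_space
      proof eventually_elim
        case (elim \<xi>)
        then have n: "norm \<xi> = 1" by simp
        have "(\<lambda>n. (\<lambda>(x, \<xi>). entry \<Omega> x \<xi>) (X n, \<xi>)) \<longlonglongrightarrow> (\<lambda>(x, \<xi>). entry \<Omega> x \<xi>) (x, \<xi>)"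
          using X x n by (intro continuous_on_tendsto_compose[OF entry_continuous] tendsto_intros) (auto simp: chords_interior)
        then have "(\<lambda>n. entry \<Omega> (X n) \<xi>) \<longlonglongrightarrow> entry \<Omega> x \<xi>" by simp
        then have "(\<lambda>n. f\<^sub>0 (entry \<Omega> (X n) \<xi>, \<xi>)) \<longlonglongrightarrow> f\<^sub>0 (entry \<Omega> x \<xi>, \<xi>)"
          by (rule continuous_on_tendsto_compose[OF elim(1)]) (simp_all add: entry_frontier(2)[OF _ n] X(1) x)
        moreover have "(\<lambda>n. \<phi> n \<xi>) \<longlonglongrightarrow> \<phi>' \<xi>" using n by (intro \<phi>(4)) auto
        ultimately show ?case by (intro tendsto_mult)
      qed
    qed auto
  next
    case pt
    obtain \<delta>0 where \<delta>0: "\<delta>0 > 0" "ball x \<delta>0 \<subseteq> \<Omega>" using openE[OF open_dom x] by blast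
    define \<delta> where "\<delta> = \<delta>0 / 2"
    have \<delta>: "\<delta> > 0" "cball x \<delta> \<subseteq> \<Omega>" using \<delta>0 by (auto simp: \<delta>_def)
    then have \<delta>': "cball x \<delta> \<subseteq> closure \<Omega>" using closure_subset by blast
    define L where "L = (diameter (closure \<Omega>))\<^sup>2 / \<delta> + diameter (closure \<Omega>)"
    \<comment> \<open>The push-forward estimate holds only within distance
      \<open>\<delta> / 2\<close> of \<open>x\<close>, so the first \<open>k\<close> members of the
      sequence are dropped.\<close>
    have "\<forall>\<^sub>F n in sequentially. dist (X n) x < \<delta> / 2" using X(2) \<delta>(1) by (intro tendstoD) auto
    then obtain k where k: "\<And>n. n \<ge> k \<Longrightarrow> dist (X n) x < \<delta> / 2" by (auto simp: eventually_sequentially)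
    define Y where "Y n = X (n + k)" for n
    have Y: "Y n \<in> \<Omega>" "norm (Y n - x) \<le> \<delta> / 2" for n
      using X(1) k[of "n + k"] by (auto simp: Y_def dist_norm)
    have Ylim: "Y \<longlonglongrightarrow> x" unfolding Y_def[abs_def] using X(2) by (rule LIMSEQ_ignore_initial_segment)
    let ?\<Lambda> = "\<lambda>n \<xi>. sgn (x - entry \<Omega> (Y n) \<xi>)" and ?\<Psi> = "\<lambda>n \<omega>. sgn (Y n - entry \<Omega> x \<omega>)"
    define c where "c n = ((1 + 2 * norm (Y n - x) / \<delta>) * (1 + 8 * norm (Y n - x) * L\<^sup>2 / \<delta> ^ 3)) ^ DIM('a)" for n
    \<comment> \<open>The integrand for \<open>Y n\<close>, expressed through the direction
      \<open>\<omega>\<close> under which its boundary point is seen from \<open>x\<close>: the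
      first argument of the data no longer depends on \<open>n\<close>.\<close>
    let ?h = "\<lambda>n \<omega>. \<phi> (n + k) (?\<Psi> n \<omega>) * f\<^sub>0 (entry \<Omega> x \<omega>, ?\<Psi> n \<omega>)"
    have psi: "(entry \<Omega> x \<omega>, ?\<Psi> n \<omega>) \<in> inflow \<Omega>" "norm (?\<Psi> n \<omega>) = 1" if "norm \<omega> = 1" for n \<omega>
      using frontier_inflow[OF Y(1) entry_frontier(1)[OF x that]] by auto
    have "(\<lambda>n. \<integral>\<xi>. ?h n (?\<Lambda> n \<xi>) \<partial>sphere_borel) \<longlonglongrightarrow> (\<integral>\<omega>. \<phi>' \<omega> * f\<^sub>0 (entry \<Omega> x \<omega>, \<omega>) \<partial>sphere_borel)"
    proof (rule integral_pushforward_tendsto[OF finite_sphere_borel, where \<Lambda> = ?\<Lambda> and h = ?h and c = c and K = "C * K"])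
      show "?\<Lambda> n \<in> sphere_borel \<rightarrow>\<^sub>M sphere_borel" for n by (rule sgn_entry_measurable[OF Y(1) x])
      show "0 \<le> c n" for n using \<delta> by (simp add: c_def)
      have "c \<longlonglongrightarrow> ((1 + 2 * norm (x - x) / \<delta>) * (1 + 8 * norm (x - x) * L\<^sup>2 / \<delta> ^ 3)) ^ DIM('a)"
        unfolding c_def[abs_def] using \<delta> by (intro tendsto_intros Ylim) auto
      then show "c \<longlonglongrightarrow> 1" by simp
      show "emeasure sphere_borel (?\<Lambda> n -` A \<inter> space sphere_borel) \<le> ennreal (c n) * emeasure sphere_borel A"
        if "A \<in> sets sphere_borel" for n A
        unfolding c_def by (rule direction_pushforward_le[OF x \<delta>' \<delta>(1) Y that L_def])
      have pm: "?\<Psi> n \<in> sphere_borel \<rightarrow>\<^sub>M sphere_borel" for n by (rule sgn_entry_measurable[OF x Y(1)])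
      show "?h n \<in> borel_measurable sphere_borel" for n
        using psi measurable_compose[OF pm id]
        by (intro borel_measurable_times measurable_compose[OF pm \<phi>(1)] inflow_measurable f0 em x) auto
      show "\<bar>?h n \<omega>\<bar> \<le> C * K" if "\<omega> \<in> space sphere_borel" for n \<omega>
        using that psi by (intro bound) auto
      show "(\<lambda>\<omega>. \<phi>' \<omega> * f\<^sub>0 (entry \<Omega> x \<omega>, \<omega>)) \<in> borel_measurable sphere_borel" by (rule lim_meas)
      let ?N = "{y \<in> frontier \<Omega>. \<not> continuous_on {\<xi>. (y, \<xi>) \<in> inflow \<Omega>} (\<lambda>\<xi>. f\<^sub>0 (y, \<xi>))}"
      have far: "\<delta> \<le> norm (x - y)" if "y \<in> ?N" for y
      proof (rule ccontr)
        assume "\<not> \<delta> \<le> norm (x - y)"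
        then have "y \<in> \<Omega>" using \<delta>(2) by (auto simp: dist_norm)
        then show False using that open_dom by (auto simp: frontier_def interior_open)
      qed
      have "AE \<omega> in sphere_borel. \<omega> \<notin> (\<lambda>y. sgn (x - y)) ` ?N"
        by (rule surface_null_projection_AE[OF pt dim \<delta>(1) far])
      then show "AE \<omega> in sphere_borel. (\<lambda>n. ?h n \<omega>) \<longlonglongrightarrow> \<phi>' \<omega> * f\<^sub>0 (entry \<Omega> x \<omega>, \<omega>)"
        using AE_space
      proof eventually_elim
        case (elim \<omega>)
        then have n: "norm \<omega> = 1" by simp
        have fr: "entry \<Omega> x \<omega> \<in> frontier \<Omega>" by (rule entry_frontier(1)[OF x n])
        have s: "sgn (x - entry \<Omega> x \<omega>) = \<omega>" by (rule sgn_entry[OF x n])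
        have "entry \<Omega> x \<omega> \<notin> ?N"
        proof
          assume "entry \<Omega> x \<omega> \<in> ?N"
          then have "sgn (x - entry \<Omega> x \<omega>) \<in> (\<lambda>y. sgn (x - y)) ` ?N" by (rule imageI)
          then show False using elim(1) unfolding s by contradiction
        qed
        then have cont: "continuous_on {\<xi>. (entry \<Omega> x \<omega>, \<xi>) \<in> inflow \<Omega>} (\<lambda>\<xi>. f\<^sub>0 (entry \<Omega> x \<omega>, \<xi>))" using fr by simp
        have "x - entry \<Omega> x \<omega> \<noteq> 0" using fr x open_dom by (auto simp: frontier_def interior_open)
        then have "(\<lambda>n. ?\<Psi> n \<omega>) \<longlonglongrightarrow> sgn (x - entry \<Omega> x \<omega>)" by (intro tendsto_sgn tendsto_intros Ylim)
        then have lim: "(\<lambda>n. ?\<Psi> n \<omega>) \<longlonglongrightarrow> \<omega>" using s by simp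
        have 1: "(\<lambda>n. f\<^sub>0 (entry \<Omega> x \<omega>, ?\<Psi> n \<omega>)) \<longlonglongrightarrow> f\<^sub>0 (entry \<Omega> x \<omega>, \<omega>)"
          using psi(1)[OF n] entry_frontier(2)[OF x n] by (intro seq[OF cont lim]) auto
        \<comment> \<open>The kernels keep their original index, so the shifted directions are
          padded with \<open>\<omega>\<close> on the dropped indices.\<close>
        let ?\<zeta> = "\<lambda>j. if j < k then \<omega> else ?\<Psi> (j - k) \<omega>"
        have "(\<lambda>j. ?\<zeta> (j + k)) \<longlonglongrightarrow> \<omega>" using lim by simp
        then have "?\<zeta> \<longlonglongrightarrow> \<omega>" by (rule LIMSEQ_offset)
        then have "(\<lambda>j. \<phi> j (?\<zeta> j)) \<longlonglongrightarrow> \<phi>' \<omega>" using n psi(2)[OF n] by (intro \<phi>(4)) auto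
        then have "(\<lambda>j. \<phi> (j + k) (?\<zeta> (j + k))) \<longlonglongrightarrow> \<phi>' \<omega>" by (rule LIMSEQ_ignore_initial_segment)
        then have 2: "(\<lambda>n. \<phi> (n + k) (?\<Psi> n \<omega>)) \<longlonglongrightarrow> \<phi>' \<omega>" by simp
        show ?case by (rule tendsto_mult[OF 2 1])
      qed
    qed
    \<comment> \<open>Seen from \<open>x\<close> and then again from \<open>Y n\<close>, the
      boundary point gives back its original direction.\<close>
    moreover have "(\<integral>\<xi>. ?h n (?\<Lambda> n \<xi>) \<partial>sphere_borel)
        = (\<integral>\<xi>. \<phi> (n + k) \<xi> * f\<^sub>0 (entry \<Omega> (X (n + k)) \<xi>, \<xi>) \<partial>sphere_borel)" for n
    proof (rule Bochner_Integration.integral_cong[OF refl])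
      fix \<xi> :: 'a assume "\<xi> \<in> space sphere_borel"
      then have n: "norm \<xi> = 1" by simp
      have e: "entry \<Omega> x (?\<Lambda> n \<xi>) = entry \<Omega> (Y n) \<xi>"
        by (rule frontier_inflow(3)[OF x entry_frontier(1)[OF Y(1) n]])
      show "?h n (?\<Lambda> n \<xi>) = \<phi> (n + k) \<xi> * f\<^sub>0 (entry \<Omega> (X (n + k)) \<xi>, \<xi>)"
        unfolding e sgn_entry[OF Y(1) n] by (simp add: Y_def)
    qed
    ultimately have "(\<lambda>n. \<integral>\<xi>. \<phi> (n + k) \<xi> * f\<^sub>0 (entry \<Omega> (X (n + k)) \<xi>, \<xi>) \<partial>sphere_borel)
      \<longlonglongrightarrow> (\<integral>\<omega>. \<phi>' \<omega> * f\<^sub>0 (entry \<Omega> x \<omega>, \<omega>) \<partial>sphere_borel)" by simp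
    then show ?thesis by (rule LIMSEQ_offset)
  qed
qed

end

section \<open>Continuity of the scattering integral and the discontinuity set\<close>

text \<open>\<open>m\<close> and \<open>\<mu>\<close> play the roles of \<open>\<mu>\<^sub>t\<close>
  and \<open>\<mu>\<^sub>s\<close>. The boundary value problem is rephrased through chords, and one
  bound \<open>K\<close> serves for \<open>f\<close> and, by the inflow condition, for
  \<open>f\<^sub>0\<close>.\<close>

locale transport_problem = attenuated_domain \<Omega> \<Omega>\<^sub>0 R m M
  for \<Omega> \<Omega>\<^sub>0 :: "'a::euclidean_space set" and R m M +
  fixes \<mu> :: "'a \<Rightarrow> real" and p :: "'a \<Rightarrow> 'a \<Rightarrow> 'a \<Rightarrow> real" and f\<^sub>0 f :: "'a \<times> 'a \<Rightarrow> real" and B K :: real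
  assumes dim: "DIM('a) \<ge> 2"
    and \<mu>: "\<And>x. 0 \<le> \<mu> x" "\<And>x. \<mu> x \<le> m x" "continuous_on \<Omega>\<^sub>0 \<mu>"
    and p_bounds: "\<And>x \<xi> \<xi>'. \<lbrakk>norm \<xi> = 1; norm \<xi>' = 1\<rbrakk> \<Longrightarrow> 0 \<le> p x \<xi> \<xi>' \<and> p x \<xi> \<xi>' \<le> B"
    and p_cont: "continuous_on (\<Omega>\<^sub>0 \<times> sphere 0 1 \<times> sphere 0 1) (\<lambda>(x, \<xi>, \<xi>'). p x \<xi> \<xi>')"
    and p_int: "\<And>x \<xi>. \<lbrakk>x \<in> \<Omega>\<^sub>0; norm \<xi> = 1\<rbrakk> \<Longrightarrow> (LINT \<xi>'|sphere_measure. p x \<xi> \<xi>') = 1"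
    and f0_meas: "f\<^sub>0 \<in> borel_measurable (restrict_space borel (inflow \<Omega>))"
    and f0_regular: "surface_null {y \<in> frontier \<Omega>. \<not> continuous_on {\<xi>. (y, \<xi>) \<in> inflow \<Omega>} (\<lambda>\<xi>. f\<^sub>0 (y, \<xi>))}
      \<or> (AE \<xi> in sphere_borel. continuous_on {y. (y, \<xi>) \<in> inflow \<Omega>} (\<lambda>y. f\<^sub>0 (y, \<xi>)))"
    and f_bound: "\<And>z. z \<in> \<Omega> \<times> sphere 0 1 \<union> inflow \<Omega> \<Longrightarrow> \<bar>f z\<bar> \<le> K"
    and f_integrable: "\<And>x \<xi>. \<lbrakk>x \<in> \<Omega>\<^sub>0; norm \<xi> = 1\<rbrakk> \<Longrightarrow> integrable sphere_measure (\<lambda>\<xi>'. p x \<xi> \<xi>' * f (x, \<xi>'))"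
    and f_deriv: "\<And>x \<xi>. \<lbrakk>x \<in> \<Omega>\<^sub>0; norm \<xi> = 1\<rbrakk> \<Longrightarrow> ((\<lambda>t. f (x + t *\<^sub>R \<xi>, \<xi>)) has_real_derivative
      (\<mu> x * (LINT \<xi>'|sphere_measure. p x \<xi> \<xi>' * f (x, \<xi>')) - m x * f (x, \<xi>))) (at 0)"
    and f_inflow: "\<And>z. z \<in> inflow \<Omega> \<Longrightarrow> f z = f\<^sub>0 z"
    and f_cont: "\<And>x \<xi>. (x, \<xi>) \<in> \<Omega> \<times> sphere 0 1 \<union> inflow \<Omega> \<Longrightarrow>
      continuous_on {0..back_time \<Omega> x \<xi>} (\<lambda>t. f (x - t *\<^sub>R \<xi>, \<xi>))"
begin

definition scatter :: "'a \<times> 'a \<Rightarrow> real" where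
  "scatter = (\<lambda>(x, \<xi>). LINT \<xi>'|sphere_measure. p x \<xi> \<xi>' * f (x, \<xi>'))"

text \<open>One source iteration: the transport equation solved with the scattering integral frozen
  at \<open>g\<close>, so for nonzero \<open>g\<close> it is more than the unscattered part.\<close>

definition ballistic :: "('a \<times> 'a \<Rightarrow> real) \<Rightarrow> 'a \<times> 'a \<Rightarrow> real" where
  "ballistic g = (\<lambda>(x, \<xi>). exp (- depth m x \<xi> R) * f\<^sub>0 (entry \<Omega> x \<xi>, \<xi>) + travel (\<lambda>z. \<mu> (fst z) * g z) x \<xi>)"

lemma \<mu>_zero: "x \<notin> \<Omega>\<^sub>0 \<Longrightarrow> \<mu> x = 0"
  using \<mu>(1,2)[of x] m_zero[of x] by simp

lemma dom_chords: "z \<in> \<Omega> \<times> sphere 0 1 \<union> inflow \<Omega> \<Longrightarrow> z \<in> chords \<Omega>"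
  using chords_interior inflow_chords by auto

lemma f0_bound: "z \<in> inflow \<Omega> \<Longrightarrow> \<bar>f\<^sub>0 z\<bar> \<le> K"
  using f_bound[of z] f_inflow[of z] by simp

lemma K_nonneg: "0 \<le> K"
proof -
  obtain x where "x \<in> \<Omega>" using nonempty_dom by blast
  moreover obtain e :: 'a where "norm e = 1" using vector_choose_size[of 1] by auto
  ultimately show ?thesis using order_trans[OF abs_ge_zero f_bound[of "(x, e)"]] by simp
qed

lemma integrand_source:
  assumes g: "continuous_on (\<Omega>\<^sub>0 \<times> sphere 0 1) g" "\<And>z. z \<in> \<Omega>\<^sub>0 \<times> sphere 0 1 \<Longrightarrow> \<bar>g z\<bar> \<le> C" and C: "0 \<le> C"
  shows "integrand (M * C) (\<lambda>z. \<mu> (fst z) * g z)"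
  unfolding integrand_def
proof (intro conjI ballI allI impI)
  show "continuous_on (\<Omega>\<^sub>0 \<times> sphere 0 1) (\<lambda>z. \<mu> (fst z) * g z)"
    by (intro continuous_on_mult g continuous_on_compose2[OF \<mu>(3)] continuous_intros) auto
  show "\<bar>\<mu> (fst z) * g z\<bar> \<le> M * C" if "z \<in> UNIV \<times> sphere 0 1" for z
  proof (cases "fst z \<in> \<Omega>\<^sub>0")
    case True
    then have "z \<in> \<Omega>\<^sub>0 \<times> sphere 0 1" using that by auto
    then show ?thesis unfolding abs_mult using g(2)[of z] \<mu>(1,2)[of "fst z"] m_le[of "fst z"] M_nonneg
      by (intro mult_mono) auto
  qed (simp add: \<mu>_zero M_nonneg C)
  show "\<mu> (fst (x, \<xi>)) * g (x, \<xi>) = 0" if "x \<notin> \<Omega>\<^sub>0" for x \<xi>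
    using that by (simp add: \<mu>_zero)
qed

lemma representation:
  assumes "(x, \<xi>) \<in> \<Omega> \<times> sphere 0 1 \<union> inflow \<Omega>"
  shows "((\<lambda>t. exp (- depth m x \<xi> t) * (\<mu> (x - t *\<^sub>R \<xi>) * scatter (x - t *\<^sub>R \<xi>, \<xi>))) has_integral
     (f (x, \<xi>) - exp (- depth m x \<xi> R) * f\<^sub>0 (entry \<Omega> x \<xi>, \<xi>))) {0..R}"
proof -
  have c: "(x, \<xi>) \<in> chords \<Omega>" using dom_chords[OF assms] .
  note \<xi> = chordsD(2)[OF c]
  have "((\<lambda>t. exp (- depth m x \<xi> t) * (\<lambda>y. \<mu> y * scatter (y, \<xi>)) (x - t *\<^sub>R \<xi>)) has_integral
     ((\<lambda>y. f (y, \<xi>)) x - exp (- depth m x \<xi> R) * (\<lambda>y. f (y, \<xi>)) (entry \<Omega> x \<xi>))) {0..R}"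
    by (rule transport_representation[OF c f_cont[OF assms]])
      (use f_deriv[OF _ \<xi>] in \<open>simp_all add: scatter_def \<mu>_zero\<close>)
  then show ?thesis using f_inflow[OF entry_inflow[OF c]] by simp
qed

text \<open>The boundary terms of \<open>f\<close> and of the iterate coincide and cancel. What
  remains is a line integral whose source is at most \<open>\<mu> * \<epsilon>\<close>, hence at
  most \<open>m * \<epsilon>\<close>.\<close>

lemma ballistic_approx:
  assumes g: "continuous_on (\<Omega>\<^sub>0 \<times> sphere 0 1) g" "\<And>z. z \<in> \<Omega>\<^sub>0 \<times> sphere 0 1 \<Longrightarrow> \<bar>g z\<bar> \<le> C" "0 \<le> C"
    and \<epsilon>: "\<And>z. z \<in> \<Omega>\<^sub>0 \<times> sphere 0 1 \<Longrightarrow> \<bar>scatter z - g z\<bar> \<le> \<epsilon>" "0 \<le> \<epsilon>"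
    and z: "z \<in> \<Omega> \<times> sphere 0 1 \<union> inflow \<Omega>"
  shows "\<bar>f z - ballistic g z\<bar> \<le> \<epsilon> * (1 - exp (- (M * R)))"
proof -
  obtain x \<xi> where zx: "z = (x, \<xi>)" by fastforce
  have c: "(x, \<xi>) \<in> chords \<Omega>" using dom_chords z zx by blast
  note \<xi> = chordsD(2)[OF c]
  let ?D = "\<lambda>t. \<mu> (x - t *\<^sub>R \<xi>) * scatter (x - t *\<^sub>R \<xi>, \<xi>) - \<mu> (x - t *\<^sub>R \<xi>) * g (x - t *\<^sub>R \<xi>, \<xi>)"
  note q = integrand_source[OF g]
  have T: "((\<lambda>t. exp (- depth m x \<xi> t) * (\<mu> (x - t *\<^sub>R \<xi>) * g (x - t *\<^sub>R \<xi>, \<xi>))) has_integral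
      travel (\<lambda>z. \<mu> (fst z) * g z) x \<xi>) {0..R}"
    using integrable_integral[OF travel_integrable[OF q \<xi>, of x R]] by (simp add: travel_def)
  have I: "((\<lambda>t. exp (- depth m x \<xi> t) * ?D t) has_integral (f (x, \<xi>) - ballistic g (x, \<xi>))) {0..R}"
    using has_integral_diff[OF representation[of x \<xi>] T] z zx by (simp add: ballistic_def right_diff_distrib algebra_simps)
  have "\<bar>?D t\<bar> \<le> \<epsilon> * m (x - t *\<^sub>R \<xi>)" for t
  proof (cases "x - t *\<^sub>R \<xi> \<in> \<Omega>\<^sub>0")
    case True
    have "?D t = \<mu> (x - t *\<^sub>R \<xi>) * (scatter (x - t *\<^sub>R \<xi>, \<xi>) - g (x - t *\<^sub>R \<xi>, \<xi>))" by (simp add: right_diff_distrib)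
    then have "\<bar>?D t\<bar> = \<mu> (x - t *\<^sub>R \<xi>) * \<bar>scatter (x - t *\<^sub>R \<xi>, \<xi>) - g (x - t *\<^sub>R \<xi>, \<xi>)\<bar>"
      by (simp add: abs_mult \<mu>)
    also have "\<dots> \<le> m (x - t *\<^sub>R \<xi>) * \<epsilon>" using True \<xi> by (intro mult_mono \<mu> \<epsilon>) (auto simp: m_nonneg)
    finally show ?thesis by (simp add: mult.commute)
  qed (simp add: \<mu>_zero m_zero)
  then have "\<bar>integral {0..R} (\<lambda>t. exp (- depth m x \<xi> t) * ?D t)\<bar> \<le> \<epsilon> * (1 - exp (- (M * R)))"
    by (intro attenuation_bound[OF c has_integral_integrable[OF I]] \<epsilon>(2))
  then show ?thesis unfolding integral_unique[OF I] zx .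
qed

lemma p_dir_measurable:
  assumes "x \<in> \<Omega>\<^sub>0" "norm \<xi> = 1"
  shows "p x \<xi> \<in> borel_measurable sphere_borel"
proof (rule measurable_sphere_borelI)
  have "continuous_on (sphere 0 1) (\<lambda>\<xi>'. (\<lambda>(x, \<xi>, \<xi>'). p x \<xi> \<xi>') (x, \<xi>, \<xi>'))"
    using assms by (intro continuous_on_compose2[OF p_cont]) (auto intro!: continuous_intros)
  then show "continuous_on (sphere 0 1) (p x \<xi>)" by simp
qed

lemma depth_tendsto:
  assumes "(\<lambda>n. (X n, \<zeta> n)) \<longlonglongrightarrow> (x, \<xi>)" "\<And>n. (X n, \<zeta> n) \<in> chords \<Omega>" "(x, \<xi>) \<in> chords \<Omega>"
  shows "(\<lambda>n. depth m (X n) (\<zeta> n) t) \<longlonglongrightarrow> depth m x \<xi> t"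
  using depth_continuous_at[OF assms(3), of t, unfolded continuous_within_sequentially o_def, rule_format,
      of "\<lambda>n. (X n, \<zeta> n)"] assms(1,2) by simp

lemma travel_tendsto:
  assumes "integrand C q"
    and "(\<lambda>n. (X n, \<zeta> n)) \<longlonglongrightarrow> (x, \<xi>)" "\<And>n. (X n, \<zeta> n) \<in> chords \<Omega>" "(x, \<xi>) \<in> chords \<Omega>"
  shows "(\<lambda>n. travel q (X n) (\<zeta> n)) \<longlonglongrightarrow> travel q x \<xi>"
  using travel_continuous_at[OF assms(1,4), unfolded continuous_within_sequentially o_def, rule_format,
      of "\<lambda>n. (X n, \<zeta> n)"] assms(2,3) by simp

lemma depth_dir_measurable:
  assumes "x \<in> \<Omega>" shows "(\<lambda>\<xi>. depth m x \<xi> t) \<in> borel_measurable sphere_borel"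
  using assms by (intro measurable_sphere_borelI continuous_on_sequentiallyI depth_tendsto)
    (auto intro!: tendsto_intros chords_interior)

lemma travel_dir_measurable:
  assumes "integrand C q" "x \<in> \<Omega>" shows "travel q x \<in> borel_measurable sphere_borel"
  using assms(2) by (intro measurable_sphere_borelI continuous_on_sequentiallyI travel_tendsto[OF assms(1)])
    (auto intro!: tendsto_intros chords_interior)

lemma f0_entry_measurable:
  assumes "x \<in> \<Omega>" shows "(\<lambda>\<xi>. f\<^sub>0 (entry \<Omega> x \<xi>, \<xi>)) \<in> borel_measurable sphere_borel"
  using assms
  by (intro inflow_measurable[OF f0_meas] measurable_sphere_borelI entry_continuous_dir continuous_intros entry_frontier)

lemma B_nonneg: "0 \<le> B"
proof -
  obtain e :: 'a where "norm e = 1" using vector_choose_size[of 1] by auto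
  then show ?thesis using p_bounds[of e e] by fastforce
qed

lemma exp_depth_f0_bound:
  assumes "x \<in> \<Omega>" "norm \<xi> = 1"
  shows "\<bar>exp (- depth m x \<xi> R) * f\<^sub>0 (entry \<Omega> x \<xi>, \<xi>)\<bar> \<le> K"
  using R_pos by (intro exp_depth_mult_le f0_bound entry_frontier assms) auto

text \<open>The boundary part \<open>?I1\<close> carries the discontinuous data and needs
  \<open>boundary_integral_tendsto\<close>; in \<open>?I2\<close> the factor \<open>travel\<close>
  is jointly continuous, so plain dominated convergence suffices.\<close>

lemma scattered_ballistic_continuous:
  assumes q: "integrand C (\<lambda>z. \<mu> (fst z) * g z)"
  shows "continuous_on (\<Omega>\<^sub>0 \<times> sphere 0 1)
    (\<lambda>(x, \<xi>). \<integral>\<xi>'. p x \<xi> \<xi>' * ballistic g (x, \<xi>') \<partial>sphere_borel)"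
proof -
  interpret finite_measure "sphere_borel :: 'a measure" by (rule finite_sphere_borel)
  let ?T = "travel (\<lambda>z. \<mu> (fst z) * g z)"
  let ?I1 = "\<lambda>x \<xi>. \<integral>\<xi>'. (p x \<xi> \<xi>' * exp (- depth m x \<xi>' R)) * f\<^sub>0 (entry \<Omega> x \<xi>', \<xi>') \<partial>sphere_borel"
  let ?I2 = "\<lambda>x \<xi>. \<integral>\<xi>'. p x \<xi> \<xi>' * ?T x \<xi>' \<partial>sphere_borel"
  have dom: "x \<in> \<Omega>" if "x \<in> \<Omega>\<^sub>0" for x using that dom0_sub by blast
  have tm: "(\<lambda>\<xi>'. p x \<xi> \<xi>' * ?T x \<xi>') \<in> borel_measurable sphere_borel" if "x \<in> \<Omega>\<^sub>0" "norm \<xi> = 1" for x \<xi>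
    by (rule borel_measurable_times[OF p_dir_measurable[OF that] travel_dir_measurable[OF q dom[OF that(1)]]])
  have em: "(\<lambda>\<xi>'. p x \<xi> \<xi>' * exp (- depth m x \<xi>' R)) \<in> borel_measurable sphere_borel" if "x \<in> \<Omega>\<^sub>0" "norm \<xi> = 1" for x \<xi>
    using p_dir_measurable[OF that] depth_dir_measurable[OF dom[OF that(1)]] by measurable
  have tb: "\<bar>p x \<xi> \<xi>' * ?T x \<xi>'\<bar> \<le> B * (C * R)" if "norm \<xi> = 1" "norm \<xi>' = 1" for x \<xi> \<xi>'
    unfolding abs_mult using p_bounds[OF that] travel_bound[OF q that(2)] B_nonneg by (intro mult_mono) auto
  have eb: "\<bar>p x \<xi> \<xi>' * exp (- depth m x \<xi>' R)\<bar> \<le> B" if "norm \<xi> = 1" "norm \<xi>' = 1" for x \<xi> \<xi>'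
    using exp_depth_mult_le[OF that(2), of R "p x \<xi> \<xi>'" B x] p_bounds[OF that] R_pos by (simp add: mult.commute)
  have split: "(\<integral>\<xi>'. p x \<xi> \<xi>' * ballistic g (x, \<xi>') \<partial>sphere_borel) = ?I1 x \<xi> + ?I2 x \<xi>" if x: "x \<in> \<Omega>\<^sub>0" "norm \<xi> = 1" for x \<xi>
  proof -
    have i1: "integrable sphere_borel (\<lambda>\<xi>'. (p x \<xi> \<xi>' * exp (- depth m x \<xi>' R)) * f\<^sub>0 (entry \<Omega> x \<xi>', \<xi>'))"
    proof (rule integrable_const_bound[of _ "B * K"])
      show "(\<lambda>\<xi>'. (p x \<xi> \<xi>' * exp (- depth m x \<xi>' R)) * f\<^sub>0 (entry \<Omega> x \<xi>', \<xi>')) \<in> borel_measurable sphere_borel"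
        by (rule borel_measurable_times[OF em[OF x] f0_entry_measurable[OF dom[OF x(1)]]])
      show "AE \<xi>' in sphere_borel. norm ((p x \<xi> \<xi>' * exp (- depth m x \<xi>' R)) * f\<^sub>0 (entry \<Omega> x \<xi>', \<xi>')) \<le> B * K"
      proof (rule AE_I2)
        fix \<xi>' :: 'a assume "\<xi>' \<in> space sphere_borel"
        then have n: "norm \<xi>' = 1" by simp
        show "norm ((p x \<xi> \<xi>' * exp (- depth m x \<xi>' R)) * f\<^sub>0 (entry \<Omega> x \<xi>', \<xi>')) \<le> B * K"
          using mult_mono[OF eb[OF x(2) n, of x] f0_bound[OF entry_frontier(2)[OF dom[OF x(1)] n]] B_nonneg abs_ge_zero]
          unfolding real_norm_def abs_mult .
      qed
    qed
    have i2: "integrable sphere_borel (\<lambda>\<xi>'. p x \<xi> \<xi>' * ?T x \<xi>')"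
      using tm[OF x] tb[OF x(2)] by (intro integrable_const_bound[of _ "B * (C * R)"]) auto
    show ?thesis
      unfolding Bochner_Integration.integral_add[OF i1 i2, symmetric]
      by (rule Bochner_Integration.integral_cong[OF refl]) (simp add: ballistic_def algebra_simps)
  qed
  have "continuous_on (\<Omega>\<^sub>0 \<times> sphere 0 1) (\<lambda>z. ?I1 (fst z) (snd z) + ?I2 (fst z) (snd z))"
  proof (rule continuous_on_sequentiallyI)
    fix u :: "nat \<Rightarrow> 'a \<times> 'a" and a
    assume u: "\<forall>n. u n \<in> \<Omega>\<^sub>0 \<times> sphere 0 1" and a: "a \<in> \<Omega>\<^sub>0 \<times> sphere 0 1" and lim: "u \<longlonglongrightarrow> a"
    define X \<eta> where "X n = fst (u n)" and "\<eta> n = snd (u n)" for n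
    define x \<xi> where "x = fst a" and "\<xi> = snd a"
    have X: "X n \<in> \<Omega>\<^sub>0" "norm (\<eta> n) = 1" for n using u by (auto simp: X_def \<eta>_def mem_Times_iff)
    have x: "x \<in> \<Omega>\<^sub>0" "norm \<xi> = 1" using a by (auto simp: x_def \<xi>_def mem_Times_iff)
    have Xl: "X \<longlonglongrightarrow> x" and \<eta>l: "\<eta> \<longlonglongrightarrow> \<xi>"
      unfolding X_def[abs_def] \<eta>_def[abs_def] x_def \<xi>_def by (intro tendsto_fst tendsto_snd lim)+
    have pl: "(\<lambda>n. p (X n) (\<eta> n) (\<zeta> n)) \<longlonglongrightarrow> p x \<xi> \<zeta>'"
      if "\<zeta> \<longlonglongrightarrow> \<zeta>'" "\<And>n. norm (\<zeta> n) = 1" "norm \<zeta>' = 1" for \<zeta> \<zeta>'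
    proof -
      have "(\<lambda>n. (\<lambda>(x, \<xi>, \<xi>'). p x \<xi> \<xi>') (X n, \<eta> n, \<zeta> n)) \<longlonglongrightarrow> (\<lambda>(x, \<xi>, \<xi>'). p x \<xi> \<xi>') (x, \<xi>, \<zeta>')"
        using X x that by (intro continuous_on_tendsto_compose[OF p_cont] tendsto_Pair Xl \<eta>l) auto
      then show ?thesis by simp
    qed
    have ch: "(X n, \<zeta>) \<in> chords \<Omega>" "(x, \<zeta>) \<in> chords \<Omega>" if "norm \<zeta> = 1" for n \<zeta>
      using that X x dom by (auto intro: chords_interior)
    have "(\<lambda>n. ?I1 (X n) (\<eta> n)) \<longlonglongrightarrow> ?I1 x \<xi>"
    proof (rule boundary_integral_tendsto[where C = B and K = K])
      show "x \<in> \<Omega>" "\<And>n. X n \<in> \<Omega>" using X x dom by auto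
      show "X \<longlonglongrightarrow> x" by (rule Xl)
      show "(\<lambda>\<xi>'. p (X n) (\<eta> n) \<xi>' * exp (- depth m (X n) \<xi>' R)) \<in> borel_measurable sphere_borel" for n
        by (rule em[OF X])
      show "\<bar>p (X n) (\<eta> n) \<zeta> * exp (- depth m (X n) \<zeta> R)\<bar> \<le> B" if "norm \<zeta> = 1" for n \<zeta> by (rule eb[OF X(2) that])
      show "(\<lambda>\<xi>'. p x \<xi> \<xi>' * exp (- depth m x \<xi>' R)) \<in> borel_measurable sphere_borel" by (rule em[OF x])
      show "(\<lambda>n. p (X n) (\<eta> n) (\<zeta> n) * exp (- depth m (X n) (\<zeta> n) R)) \<longlonglongrightarrow> p x \<xi> \<zeta>' * exp (- depth m x \<zeta>' R)"
        if "\<zeta> \<longlonglongrightarrow> \<zeta>'" "\<And>n. norm (\<zeta> n) = 1" "norm \<zeta>' = 1" for \<zeta> \<zeta>'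
        using that by (intro tendsto_intros pl depth_tendsto Xl ch) auto
      show "f\<^sub>0 \<in> borel_measurable (restrict_space borel (inflow \<Omega>))" by (rule f0_meas)
      show "\<bar>f\<^sub>0 z\<bar> \<le> K" if "z \<in> inflow \<Omega>" for z by (rule f0_bound[OF that])
      show "2 \<le> DIM('a)" by (rule dim)
    qed (rule f0_regular)
    moreover have "(\<lambda>n. ?I2 (X n) (\<eta> n)) \<longlonglongrightarrow> ?I2 x \<xi>"
    proof (rule integral_dominated_convergence[where w = "\<lambda>_. B * (C * R)"])
      show "(\<lambda>\<xi>'. p x \<xi> \<xi>' * ?T x \<xi>') \<in> borel_measurable sphere_borel" by (rule tm[OF x])
      show "(\<lambda>\<xi>'. p (X n) (\<eta> n) \<xi>' * ?T (X n) \<xi>') \<in> borel_measurable sphere_borel" for n by (rule tm[OF X])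
      show "AE \<xi>' in sphere_borel. norm (p (X n) (\<eta> n) \<xi>' * ?T (X n) \<xi>') \<le> B * (C * R)" for n
        using tb[OF X(2)] by (intro AE_I2) simp
      show "AE \<xi>' in sphere_borel. (\<lambda>n. p (X n) (\<eta> n) \<xi>' * ?T (X n) \<xi>') \<longlonglongrightarrow> p x \<xi> \<xi>' * ?T x \<xi>'"
      proof (rule AE_I2)
        fix \<xi>' :: 'a assume "\<xi>' \<in> space sphere_borel"
        then have n: "norm \<xi>' = 1" by simp
        show "(\<lambda>n. p (X n) (\<eta> n) \<xi>' * ?T (X n) \<xi>') \<longlonglongrightarrow> p x \<xi> \<xi>' * ?T x \<xi>'"
          using n by (intro tendsto_mult pl travel_tendsto[OF q] tendsto_Pair Xl tendsto_const ch)
      qed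
    qed simp
    ultimately show "(\<lambda>n. ?I1 (fst (u n)) (snd (u n)) + ?I2 (fst (u n)) (snd (u n))) \<longlonglongrightarrow> ?I1 (fst a) (snd a) + ?I2 (fst a) (snd a)"
      unfolding X_def \<eta>_def x_def \<xi>_def by (rule tendsto_add)
  qed
  then show ?thesis
    by (rule continuous_on_eq) (use split in auto)
qed

text \<open>Averaging with \<open>p\<close>, which has mass 1, preserves the factor gained along the
  chords.\<close>

lemma scatter_approx_step:
  assumes g: "continuous_on (\<Omega>\<^sub>0 \<times> sphere 0 1) g" "\<And>z. z \<in> \<Omega>\<^sub>0 \<times> sphere 0 1 \<Longrightarrow> \<bar>g z\<bar> \<le> C" "0 \<le> C"
    and \<epsilon>: "\<And>z. z \<in> \<Omega>\<^sub>0 \<times> sphere 0 1 \<Longrightarrow> \<bar>scatter z - g z\<bar> \<le> \<epsilon>" "0 \<le> \<epsilon>"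
    and z: "z \<in> \<Omega>\<^sub>0 \<times> sphere 0 1"
  shows "\<bar>scatter z - (\<lambda>(x, \<xi>). \<integral>\<xi>'. p x \<xi> \<xi>' * ballistic g (x, \<xi>') \<partial>sphere_borel) z\<bar> \<le> \<epsilon> * (1 - exp (- (M * R)))"
proof -
  interpret finite_measure "sphere_borel :: 'a measure" by (rule finite_sphere_borel)
  obtain x \<xi> where zx: "z = (x, \<xi>)" by fastforce
  have x: "x \<in> \<Omega>\<^sub>0" "x \<in> \<Omega>" "norm \<xi> = 1" using z zx dom0_sub by auto
  note q = integrand_source[OF g]
  let ?b = "\<lambda>\<xi>'. p x \<xi> \<xi>' * ballistic g (x, \<xi>')" and ?e = "\<epsilon> * (1 - exp (- (M * R)))"
  have "(\<lambda>\<xi>'. ballistic g (x, \<xi>')) \<in> borel_measurable sphere_borel"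
    unfolding ballistic_def prod.case
    using depth_dir_measurable[OF x(2), of R] f0_entry_measurable[OF x(2)] travel_dir_measurable[OF q x(2)] by measurable
  then have bm: "?b \<in> borel_measurable sphere_borel" using p_dir_measurable[OF x(1,3)] by (intro borel_measurable_times)
  have bb: "\<bar>?b \<xi>'\<bar> \<le> B * (K + M * C * R)" if "norm \<xi>' = 1" for \<xi>'
  proof -
    have "\<bar>ballistic g (x, \<xi>')\<bar> \<le> K + M * C * R"
      unfolding ballistic_def prod.case using exp_depth_f0_bound[OF x(2) that] travel_bound[OF q that, of x]
      by (intro order_trans[OF abs_triangle_ineq]) auto
    then show ?thesis unfolding abs_mult using p_bounds[OF x(3) that] B_nonneg by (intro mult_mono) auto
  qed
  have bi: "integrable sphere_borel ?b" using bm bb by (intro integrable_const_bound[of _ "B * (K + M * C * R)"]) auto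
  \<comment> \<open>The iterate is Borel, so its integral is unchanged by completion; the difference
    with \<open>f\<close> has to be formed in the completion.\<close>
  have bi': "integrable sphere_measure ?b" and beq: "(LINT \<xi>'|sphere_measure. ?b \<xi>') = (\<integral>\<xi>'. ?b \<xi>' \<partial>sphere_borel)"
    unfolding sphere_measure_eq using bi bm by (simp_all add: integrable_completion integral_completion)
  \<comment> \<open>A non-integrable function has integral 0 by default, so the value 1 forces
    integrability.\<close>
  have pi: "integrable sphere_measure (p x \<xi>)"
    using p_int[OF x(1,3)] not_integrable_integral_eq[of sphere_measure "p x \<xi>"] by fastforce
  have "\<bar>scatter (x, \<xi>) - (\<integral>\<xi>'. ?b \<xi>' \<partial>sphere_borel)\<bar> = norm (LINT \<xi>'|sphere_measure. p x \<xi> \<xi>' * f (x, \<xi>') - ?b \<xi>')"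
    using f_integrable[OF x(1,3)] bi' by (simp add: scatter_def beq)
  also have "\<dots> \<le> (LINT \<xi>'|sphere_measure. p x \<xi> \<xi>' * ?e)"
  proof (rule Bochner_Integration.integral_norm_bound_integral)
    show "integrable sphere_measure (\<lambda>\<xi>'. p x \<xi> \<xi>' * f (x, \<xi>') - ?b \<xi>')" using f_integrable[OF x(1,3)] bi' by (rule Bochner_Integration.integrable_diff)
    show "integrable sphere_measure (\<lambda>\<xi>'. p x \<xi> \<xi>' * ?e)" by (rule integrable_mult_left[OF pi])
    fix \<xi>' :: 'a assume "\<xi>' \<in> space sphere_measure"
    then have n: "norm \<xi>' = 1" by (simp add: sphere_measure_eq)
    have "\<bar>f (x, \<xi>') - ballistic g (x, \<xi>')\<bar> \<le> ?e" using x n by (intro ballistic_approx[OF g \<epsilon>]) auto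
    then have "p x \<xi> \<xi>' * \<bar>f (x, \<xi>') - ballistic g (x, \<xi>')\<bar> \<le> p x \<xi> \<xi>' * ?e"
      using p_bounds[OF x(3) n] by (intro mult_left_mono) auto
    then show "norm (p x \<xi> \<xi>' * f (x, \<xi>') - ?b \<xi>') \<le> p x \<xi> \<xi>' * ?e"
      using p_bounds[OF x(3) n, of x] by (simp add: right_diff_distrib[symmetric] abs_mult)
  qed
  also have "\<dots> = ?e" using p_int[OF x(1,3)] by simp
  finally show ?thesis by (simp add: zx)
qed

lemma scatter_bound:
  assumes "z \<in> \<Omega>\<^sub>0 \<times> sphere 0 1" shows "\<bar>scatter z\<bar> \<le> K"
proof -
  obtain x \<xi> where zx: "z = (x, \<xi>)" by fastforce
  have x: "x \<in> \<Omega>\<^sub>0" "x \<in> \<Omega>" "norm \<xi> = 1" using assms zx dom0_sub by auto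
  have pi: "integrable sphere_measure (p x \<xi>)"
    using p_int[OF x(1,3)] not_integrable_integral_eq[of sphere_measure "p x \<xi>"] by fastforce
  have "norm (LINT \<xi>'|sphere_measure. p x \<xi> \<xi>' * f (x, \<xi>')) \<le> (LINT \<xi>'|sphere_measure. p x \<xi> \<xi>' * K)"
  proof (rule Bochner_Integration.integral_norm_bound_integral[OF f_integrable[OF x(1,3)] integrable_mult_left[OF pi]])
    fix \<xi>' :: 'a assume "\<xi>' \<in> space sphere_measure"
    then have n: "norm \<xi>' = 1" by (simp add: sphere_measure_eq)
    show "norm (p x \<xi> \<xi>' * f (x, \<xi>')) \<le> p x \<xi> \<xi>' * K"
      using p_bounds[OF x(3) n, of x] f_bound[of "(x, \<xi>')"] x n by (simp add: abs_mult mult_left_mono)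
  qed
  then show ?thesis using p_int[OF x(1,3)] by (simp add: zx scatter_def)
qed

text \<open>Source iteration converges uniformly with ratio \<open>1 - exp (- (M * R)) < 1\<close> because the
  scattering coefficient does not exceed the attenuation coefficient.\<close>

lemma scatter_continuous: "continuous_on (\<Omega>\<^sub>0 \<times> sphere 0 1) scatter"
proof -
  define r where "r = 1 - exp (- (M * R))"
  have "0 \<le> M * R" using M_nonneg R_pos by simp
  then have r: "0 \<le> r" "r < 1" by (auto simp: r_def)
  have "\<exists>g. continuous_on (\<Omega>\<^sub>0 \<times> sphere 0 1) g \<and> (\<forall>z \<in> \<Omega>\<^sub>0 \<times> sphere 0 1. \<bar>scatter z - g z\<bar> \<le> K * r ^ n)" for n
  proof (induction n)
    case 0
    \<comment> \<open>The iteration starts from 0, with the a priori bound \<open>K\<close> as its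
      error.\<close>
    show ?case using scatter_bound by (intro exI[of _ "\<lambda>_. 0"]) auto
  next
    case (Suc n)
    then obtain g where g: "continuous_on (\<Omega>\<^sub>0 \<times> sphere 0 1) g" "\<And>z. z \<in> \<Omega>\<^sub>0 \<times> sphere 0 1 \<Longrightarrow> \<bar>scatter z - g z\<bar> \<le> K * r ^ n"
      by blast
    have pos: "0 \<le> K * r ^ n" using K_nonneg r by simp
    \<comment> \<open>A finite bound at each stage is enough here: it makes the source of the next
      iterate an \<open>integrand\<close>.\<close>
    have gb: "\<bar>g z\<bar> \<le> K + K * r ^ n" if "z \<in> \<Omega>\<^sub>0 \<times> sphere 0 1" for z
      using g(2)[OF that] scatter_bound[OF that] by linarith
    have C: "0 \<le> K + K * r ^ n" using pos K_nonneg by simp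
    show ?case
      using scattered_ballistic_continuous[OF integrand_source[OF g(1) gb C]]
        scatter_approx_step[OF g(1) gb C g(2) pos]
      by (intro exI[of _ "\<lambda>(x, \<xi>). \<integral>\<xi>'. p x \<xi> \<xi>' * ballistic g (x, \<xi>') \<partial>sphere_borel"])
        (simp add: r_def[symmetric] mult_ac)
  qed
  then obtain g where g: "\<And>n. continuous_on (\<Omega>\<^sub>0 \<times> sphere 0 1) (g n)"
    "\<And>n z. z \<in> \<Omega>\<^sub>0 \<times> sphere 0 1 \<Longrightarrow> \<bar>scatter z - g n z\<bar> \<le> K * r ^ n" by metis
  have rl: "(\<lambda>n. K * r ^ n) \<longlonglongrightarrow> K * 0" using r by (intro tendsto_intros LIMSEQ_power_zero) auto
  have "uniform_limit (\<Omega>\<^sub>0 \<times> sphere 0 1) g scatter sequentially"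
  proof (rule uniform_limitI)
    fix e :: real assume "e > 0"
    then have "\<forall>\<^sub>F n in sequentially. K * r ^ n < e" using order_tendstoD(2)[OF rl] by simp
    then show "\<forall>\<^sub>F n in sequentially. \<forall>z\<in>\<Omega>\<^sub>0 \<times> sphere 0 1. dist (g n z) (scatter z) < e"
    proof eventually_elim
      case (elim n)
      show ?case
      proof
        fix z assume "z \<in> \<Omega>\<^sub>0 \<times> sphere (0::'a) 1"
        from g(2)[OF this, of n] elim show "dist (g n z) (scatter z) < e" by (simp add: dist_real_def abs_minus_commute)
      qed
    qed
  qed
  then show ?thesis using g(1) by (intro uniform_limit_theorem[OF always_eventually]) auto
qed

section \<open>The extended solution and transport of discontinuities\<close>

definition solution :: "'a \<times> 'a \<Rightarrow> real" where "solution = ballistic scatter"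

lemma integrand_scatter: "integrand (M * K) (\<lambda>z. \<mu> (fst z) * scatter z)"
  by (rule integrand_source[OF scatter_continuous scatter_bound K_nonneg])

text \<open>The approximation estimate with \<open>g = scatter\<close> and error 0 becomes an
  equality.\<close>

lemma f_eq_solution: "z \<in> \<Omega> \<times> sphere 0 1 \<union> inflow \<Omega> \<Longrightarrow> f z = solution z"
  using ballistic_approx[OF scatter_continuous scatter_bound K_nonneg, of 0 z] by (simp add: solution_def)

lemma attenuation_continuous_at:
  "z \<in> chords \<Omega> \<Longrightarrow> continuous (at z within chords \<Omega>) (\<lambda>z. depth m (fst z) (snd z) R)"
  using depth_continuous_at[of "fst z" "snd z" R] by simp

lemma source_continuous_at:
  "z \<in> chords \<Omega> \<Longrightarrow> continuous (at z within chords \<Omega>) (\<lambda>z. travel (\<lambda>z. \<mu> (fst z) * scatter z) (fst z) (snd z))"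
  using travel_continuous_at[OF integrand_scatter, of "fst z" "snd z"] by simp

text \<open>All points of a chord share their entry point, so along it the boundary datum is a
  constant, and only the depth and the line integral pass to the limit.\<close>

lemma outflow_limit:
  assumes "(x, - \<xi>) \<in> inflow \<Omega>"
  shows "((\<lambda>t. f (x - t *\<^sub>R \<xi>, \<xi>)) \<longlongrightarrow> solution (x, \<xi>)) (at_right 0)"
proof -
  have c: "(x, \<xi>) \<in> chords \<Omega>" using assms inflow_chords chords_reverse by blast
  note \<xi> = chordsD(2)[OF c]
  let ?g = "\<lambda>t::real. (x - t *\<^sub>R \<xi>, \<xi>)"
  define b where "b = back_time \<Omega> x \<xi>"
  have b: "b > 0" using inflow_forward_time(1)[OF assms] by (simp add: b_def)
  have seg: "x - t *\<^sub>R \<xi> \<in> \<Omega>" if "0 < t" "t < b" for t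
    using back_segment_in_dom[OF c] that by (simp add: b_def)
  have ev: "\<forall>\<^sub>F t in at_right 0. 0 < t \<and> t < b"
    using b by (auto simp: eventually_at_right_field intro!: exI[of _ b])
  have "((\<lambda>t. x - t *\<^sub>R \<xi>) \<longlongrightarrow> x - 0 *\<^sub>R \<xi>) (at_right 0)" by (intro tendsto_intros)
  then have "(?g \<longlongrightarrow> (x, \<xi>)) (at_right 0)" by (intro tendsto_Pair) simp_all
  moreover have "\<forall>\<^sub>F t in at_right 0. ?g t \<in> chords \<Omega> \<and> ?g t \<noteq> (x, \<xi>)"
    using ev by eventually_elim (use seg \<xi> in \<open>auto intro: chords_interior\<close>)
  ultimately have F: "filterlim ?g (at (x, \<xi>) within chords \<Omega>) (at_right 0)"
    by (simp add: filterlim_at eventually_conj_iff)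
  have "((\<lambda>t. exp (- depth m (fst (?g t)) (snd (?g t)) R) * f\<^sub>0 (entry \<Omega> x \<xi>, \<xi>)
      + travel (\<lambda>z. \<mu> (fst z) * scatter z) (fst (?g t)) (snd (?g t))) \<longlongrightarrow> solution (x, \<xi>)) (at_right 0)"
  proof -
    have "((\<lambda>t. depth m (fst (?g t)) (snd (?g t)) R) \<longlongrightarrow> depth m x \<xi> R) (at_right 0)"
      using filterlim_compose[OF attenuation_continuous_at[OF c, unfolded continuous_within] F] by simp
    moreover have "((\<lambda>t. travel (\<lambda>z. \<mu> (fst z) * scatter z) (fst (?g t)) (snd (?g t))) \<longlongrightarrow> travel (\<lambda>z. \<mu> (fst z) * scatter z) x \<xi>) (at_right 0)"
      using filterlim_compose[OF source_continuous_at[OF c, unfolded continuous_within] F] by simp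
    ultimately show ?thesis unfolding solution_def ballistic_def prod.case by (intro tendsto_intros)
  qed
  then show ?thesis
  proof (rule Lim_transform_eventually)
    show "\<forall>\<^sub>F t in at_right 0. exp (- depth m (fst (?g t)) (snd (?g t)) R) * f\<^sub>0 (entry \<Omega> x \<xi>, \<xi>)
      + travel (\<lambda>z. \<mu> (fst z) * scatter z) (fst (?g t)) (snd (?g t)) = f (x - t *\<^sub>R \<xi>, \<xi>)"
      using ev
    proof eventually_elim
      case (elim t)
      have s: "x - t *\<^sub>R \<xi> \<in> \<Omega>" using seg elim by blast
      then have "x - t *\<^sub>R \<xi> \<in> closure \<Omega>" using closure_subset by blast
      then have "entry \<Omega> (x - t *\<^sub>R \<xi>) \<xi> = entry \<Omega> x \<xi>" using elim by (intro back_time_shift(3)[OF c]) (auto simp: b_def)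
      then show ?case using f_eq_solution[of "(x - t *\<^sub>R \<xi>, \<xi>)"] s \<xi> by (simp add: solution_def ballistic_def)
    qed
  qed
qed

text \<open>Depth and line integral are continuous and the exponential factor is invertible, so
  continuity of \<open>solution\<close> is that of \<open>f\<^sub>0\<close> composed with the entry
  map. Continuity of that map gives one implication, a continuous section through the given point
  the other.\<close>

lemma continuous_solution_iff:
  assumes c: "(x, \<xi>) \<in> chords \<Omega>"
  shows "continuous (at (x, \<xi>) within chords \<Omega>) solution \<longleftrightarrow>
    continuous (at (entry \<Omega> x \<xi>, \<xi>) within inflow \<Omega>) f\<^sub>0"
proof
  let ?e = "\<lambda>z. (entry \<Omega> (fst z) (snd z), snd z)"
  let ?T = "\<lambda>z. travel (\<lambda>z. \<mu> (fst z) * scatter z) (fst z) (snd z)" and ?d = "\<lambda>z. depth m (fst z) (snd z) R"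
  have sol: "solution z = exp (- ?d z) * f\<^sub>0 (?e z) + ?T z" for z
    by (simp add: solution_def ballistic_def case_prod_unfold)
  have ec: "continuous (at (x, \<xi>) within chords \<Omega>) ?e"
  proof -
    have "continuous (at (x, \<xi>) within chords \<Omega>) (\<lambda>z. entry \<Omega> (fst z) (snd z))"
      using entry_continuous c by (simp add: continuous_on_eq_continuous_within case_prod_unfold)
    then show ?thesis by (intro continuous_intros)
  qed
  show "continuous (at (x, \<xi>) within chords \<Omega>) solution"
    if f0: "continuous (at (entry \<Omega> x \<xi>, \<xi>) within inflow \<Omega>) f\<^sub>0"
  proof -
    have "?e ` chords \<Omega> \<subseteq> inflow \<Omega>" using entry_inflow by auto
    then have "continuous (at (?e (x, \<xi>)) within ?e ` chords \<Omega>) f\<^sub>0" using continuous_within_subset[OF f0] by simp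
    then have "continuous (at (x, \<xi>) within chords \<Omega>) (\<lambda>z. f\<^sub>0 (?e z))" by (rule continuous_within_compose2[OF ec])
    then show ?thesis unfolding sol[abs_def]
      by (intro continuous_intros attenuation_continuous_at source_continuous_at c)
  qed
  show "continuous (at (entry \<Omega> x \<xi>, \<xi>) within inflow \<Omega>) f\<^sub>0"
    if s: "continuous (at (x, \<xi>) within chords \<Omega>) solution"
  proof -
    have "continuous (at (x, \<xi>) within chords \<Omega>) (\<lambda>z. exp (?d z) * (solution z - ?T z))"
      by (intro continuous_intros attenuation_continuous_at source_continuous_at c s)
    moreover have "exp (?d z) * (solution z - ?T z) = f\<^sub>0 (?e z)" for z
      by (simp add: sol mult.assoc[symmetric] exp_add[symmetric])
    ultimately have f0e: "continuous (at (x, \<xi>) within chords \<Omega>) (\<lambda>z. f\<^sub>0 (?e z))" by simp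
    define b where "b = back_time \<Omega> x \<xi>"
    \<comment> \<open>Advancing by \<open>b\<close> leads from \<open>?y\<close> back to
      \<open>x\<close>, so this section passes through the given point; the minimum keeps shorter
      neighbouring chords inside the closure.\<close>
    let ?y = "entry \<Omega> x \<xi>" and ?\<sigma> = "\<lambda>(y, \<xi>). (y + min b (back_time \<Omega> y (- \<xi>)) *\<^sub>R \<xi>, \<xi>)"
    have b0: "0 \<le> b" using back_time_set(1)[OF chordsD(1,2)[OF c]] by (simp add: b_def)
    have yi: "(?y, \<xi>) \<in> inflow \<Omega>" by (rule entry_inflow[OF c])
    have sec: "?\<sigma> z \<in> chords \<Omega> \<and> ?e (?\<sigma> z) = z" if "z \<in> inflow \<Omega>" for z
    proof -
      obtain y \<eta> where z: "z = (y, \<eta>)" by fastforce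
      let ?t = "min b (back_time \<Omega> y (- \<eta>))"
      have i: "(y, \<eta>) \<in> inflow \<Omega>" using that z by simp
      have t: "0 \<le> ?t" using b0 inflow_forward_time(1)[OF i] by simp
      have "y + ?t *\<^sub>R \<eta> \<in> closure \<Omega>" using t by (intro inflow_forward_time(3)[OF i]) auto
      from inflow_forward(1,3)[OF i t this] show ?thesis by (simp add: z)
    qed
    have yb: "?y + b *\<^sub>R \<xi> = x" by (simp add: entry_def b_def)
    have "b \<le> back_time \<Omega> ?y (- \<xi>)"
    proof (rule back_time_set(3))
      show "?y \<in> closure \<Omega>" "norm (- \<xi>) = 1" using yi by (auto simp: inflow_def frontier_def)
      show "?y - b *\<^sub>R (- \<xi>) \<in> closure \<Omega>" using yb chordsD(1)[OF c] by simp
    qed (rule b0)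
    then have s0: "?\<sigma> (?y, \<xi>) = (x, \<xi>)" using yb by (simp add: min_absorb1)
    have sc: "continuous (at (?y, \<xi>) within inflow \<Omega>) ?\<sigma>"
      using inflow_section_continuous[of b] yi by (simp add: continuous_on_eq_continuous_within)
    have "continuous (at (?\<sigma> (?y, \<xi>)) within ?\<sigma> ` inflow \<Omega>) (\<lambda>z. f\<^sub>0 (?e z))"
      unfolding s0 by (rule continuous_within_subset[OF f0e]) (use sec in blast)
    then have "continuous (at (?y, \<xi>) within inflow \<Omega>) (\<lambda>z. f\<^sub>0 (?e (?\<sigma> z)))" by (rule continuous_within_compose2[OF sc])
    then have "((\<lambda>z. f\<^sub>0 (?e (?\<sigma> z))) \<longlongrightarrow> f\<^sub>0 (?y, \<xi>)) (at (?y, \<xi>) within inflow \<Omega>)"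
      using sec[OF yi] by (simp only: continuous_within)
    then have "(f\<^sub>0 \<longlongrightarrow> f\<^sub>0 (?y, \<xi>)) (at (?y, \<xi>) within inflow \<Omega>)"
      by (rule Lim_transform_within[OF _ zero_less_one]) (use sec in simp)
    then show ?thesis by (simp only: continuous_within)
  qed
qed

text \<open>The fibre of the entry map over an inflow point is its whole closed chord, of length
  \<open>tau_plus\<close>; the discontinuities form the preimage of those of
  \<open>f\<^sub>0\<close>.\<close>

lemma disc_solution:
  "disc (chords \<Omega>) solution =
    {(x + t *\<^sub>R \<xi>, \<xi>) | x \<xi> t. (x, \<xi>) \<in> disc (inflow \<Omega>) f\<^sub>0 \<and> 0 \<le> t \<and> t \<le> tau_plus \<Omega> x \<xi>}" (is "?A = ?B")
proof (intro set_eqI iffI)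
  fix z assume "z \<in> ?A"
  then obtain x \<xi> where z: "z = (x, \<xi>)" and c: "(x, \<xi>) \<in> chords \<Omega>"
    and nc: "\<not> continuous (at (x, \<xi>) within chords \<Omega>) solution" by (cases z) (auto simp: disc_def)
  let ?y = "entry \<Omega> x \<xi>" and ?b = "back_time \<Omega> x \<xi>"
  have yi: "(?y, \<xi>) \<in> inflow \<Omega>" by (rule entry_inflow[OF c])
  have b0: "0 \<le> ?b" using back_time_set(1)[OF chordsD(1,2)[OF c]] .
  have yb: "?y + ?b *\<^sub>R \<xi> = x" by (simp add: entry_def)
  have "?b \<le> back_time \<Omega> ?y (- \<xi>)"
  proof (rule back_time_set(3))
    show "?y \<in> closure \<Omega>" "norm (- \<xi>) = 1" using yi by (auto simp: inflow_def frontier_def)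
    show "?y - ?b *\<^sub>R (- \<xi>) \<in> closure \<Omega>" using yb chordsD(1)[OF c] by simp
  qed (rule b0)
  then have "?b \<le> tau_plus \<Omega> ?y \<xi>" using inflow_forward_time(2)[OF yi] by simp
  moreover have "(?y, \<xi>) \<in> disc (inflow \<Omega>) f\<^sub>0" using yi nc continuous_solution_iff[OF c] by (simp add: disc_def)
  moreover have "z = (?y + ?b *\<^sub>R \<xi>, \<xi>)" using z yb by simp
  ultimately show "z \<in> ?B" using b0 by blast
next
  fix z assume "z \<in> ?B"
  then obtain y \<xi> t where z: "z = (y + t *\<^sub>R \<xi>, \<xi>)" and d: "(y, \<xi>) \<in> disc (inflow \<Omega>) f\<^sub>0"
    and t: "0 \<le> t" "t \<le> tau_plus \<Omega> y \<xi>" by blast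
  have i: "(y, \<xi>) \<in> inflow \<Omega>" using d by (simp add: disc_def)
  have "y + t *\<^sub>R \<xi> \<in> closure \<Omega>" using inflow_forward_time(2,3)[OF i] t by simp
  note fw = inflow_forward[OF i t(1) this]
  show "z \<in> ?A" using continuous_solution_iff[OF fw(1)] fw d by (simp add: disc_def z)
qed

end

section \<open>The boundary value problem as an instance of the abstract transport problem\<close>

theorem theorem2:
  fixes \<Omega> \<Omega>\<^sub>0 :: "'a::euclidean_space set"
    and \<Omega>s :: "nat \<Rightarrow> 'a set" and N :: nat
    and l :: "'a \<Rightarrow> 'a \<Rightarrow> nat" and T :: "'a \<Rightarrow> 'a \<Rightarrow> nat \<Rightarrow> real"
    and \<mu>\<^sub>t \<mu>\<^sub>s :: "'a \<Rightarrow> real" and p :: "'a \<Rightarrow> 'a \<Rightarrow> 'a \<Rightarrow> real"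
    and f\<^sub>0 f :: "'a \<times> 'a \<Rightarrow> real"
  assumes "DIM('a) \<in> {2, 3}"
    and "is_domain \<Omega>" and "bounded \<Omega>" and "convex \<Omega>" and "C1_boundary \<Omega>"
    and "\<And>j. j \<in> {1..N} \<Longrightarrow> is_domain (\<Omega>s j) \<and> \<Omega>s j \<subseteq> \<Omega> \<and> piecewise_C1_boundary (\<Omega>s j)"
    and "disjoint_family_on \<Omega>s {1..N}"
    and "closure \<Omega> = (\<Union>j\<in>{1..N}. closure (\<Omega>s j))"
    and "\<Omega>\<^sub>0 = (\<Union>j\<in>{1..N}. \<Omega>s j)"
    and "generalized_convexity \<Omega> \<Omega>\<^sub>0 l T"
    and "admissible_coefficients \<Omega>\<^sub>0 \<mu>\<^sub>t \<mu>\<^sub>s"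
    and "phase_function \<Omega>\<^sub>0 p"
    and "bounded (f\<^sub>0 ` Gamma_minus \<Omega>)"
    and "f\<^sub>0 \<in> borel_measurable (restrict_space borel (Gamma_minus \<Omega>))"
    and "surface_null {x \<in> frontier \<Omega>. \<not> continuous_on (Gamma_minus_pt \<Omega> x) (\<lambda>\<xi>. f\<^sub>0 (x, \<xi>))}
       \<or> (AE \<xi> in sphere_measure. continuous_on (Gamma_minus_dir \<Omega> \<xi>) (\<lambda>x. f\<^sub>0 (x, \<xi>)))"
    and "bvp_solution \<Omega> \<Omega>\<^sub>0 l T \<mu>\<^sub>t \<mu>\<^sub>s p f\<^sub>0 f"
  shows "(\<forall>(x, \<xi>)\<in>Gamma_plus \<Omega>. \<exists>L. ((\<lambda>t. f (x - t *\<^sub>R \<xi>, \<xi>)) \<longlongrightarrow> L) (at_right 0)) \<and>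
    disc (phase_dom_bar \<Omega>) (extension \<Omega> f) =
      {(x + t *\<^sub>R \<xi>, \<xi>) | x \<xi> t. (x, \<xi>) \<in> disc (Gamma_minus \<Omega>) f\<^sub>0 \<and> 0 \<le> t \<and> t \<le> tau_plus \<Omega> x \<xi>}"
proof -
  note dim = assms(1) and dom = assms(2-5) and sub = assms(6) and cover = assms(8) and \<Omega>0 = assms(9)
    and gc = assms(10) and coeff = assms(11) and phase = assms(12) and f0m = assms(14) and reg = assms(15)
    and sol = assms(16)
  interpret C1_convex_domain \<Omega>
    using dom by unfold_locales (auto simp: is_domain_def)
  have phase_dom_eq: "phase_dom \<Omega> = \<Omega> \<times> sphere 0 1 \<union> inflow \<Omega>" by (simp add: phase_dom_def Gamma_minus_eq)
  have bounded_coeff: "bounded (range \<mu>\<^sub>t)" and mu_nonneg: "\<And>x. 0 \<le> \<mu>\<^sub>t x \<and> 0 \<le> \<mu>\<^sub>s x"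
    and mu_zero: "\<And>x. x \<notin> \<Omega>\<^sub>0 \<Longrightarrow> \<mu>\<^sub>t x = 0 \<and> \<mu>\<^sub>s x = 0"
    and mu_le: "\<And>x. x \<in> \<Omega>\<^sub>0 \<Longrightarrow> \<mu>\<^sub>s x \<le> \<mu>\<^sub>t x"
    and mu_cont: "continuous_on \<Omega>\<^sub>0 \<mu>\<^sub>t" "continuous_on \<Omega>\<^sub>0 \<mu>\<^sub>s"
    using coeff by (auto simp: admissible_coefficients_def)
  obtain M where M: "\<And>x. \<bar>\<mu>\<^sub>t x\<bar> \<le> M" using bounded_coeff by (auto simp: bounded_iff)
  obtain B where "\<forall>x. \<forall>\<xi>\<in>sphere 0 1. \<forall>\<xi>'\<in>sphere 0 1. p x \<xi> \<xi>' \<le> B"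
    using phase unfolding phase_function_def by blast
  then have B: "p x \<xi> \<xi>' \<le> B" if "norm \<xi> = 1" "norm \<xi>' = 1" for x \<xi> \<xi>' using that by simp
  have f_bdd: "bounded (f ` phase_dom \<Omega>)" using sol by (simp add: bvp_solution_def)
  have f_int: "integrable sphere_measure (\<lambda>\<xi>'. p x \<xi> \<xi>' * f (x, \<xi>'))"
    and f_diff: "(\<lambda>t. f (x + t *\<^sub>R \<xi>, \<xi>)) differentiable (at (0::real))"
    and f_eq: "dir_deriv f x \<xi> + \<mu>\<^sub>t x * f (x, \<xi>) =
        \<mu>\<^sub>s x * (LINT \<xi>'|sphere_measure. p x \<xi> \<xi>' * f (x, \<xi>'))"
    if "x \<in> \<Omega>\<^sub>0" "norm \<xi> = 1" for x \<xi>
    using sol that by (simp_all add: bvp_solution_def)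
  have "\<forall>(x, \<xi>)\<in>Gamma_minus \<Omega>. f (x, \<xi>) = f\<^sub>0 (x, \<xi>)" using sol by (simp add: bvp_solution_def)
  then have f_in: "f (x, \<xi>) = f\<^sub>0 (x, \<xi>)" if "(x, \<xi>) \<in> Gamma_minus \<Omega>" for x \<xi> using that by auto
  have "\<forall>(x, \<xi>)\<in>phase_dom \<Omega>. continuous_on (range (\<lambda>t. x + t *\<^sub>R \<xi>) \<inter> (\<Omega> \<union> Gamma_minus_dir \<Omega> \<xi>)) (\<lambda>y. f (y, \<xi>))"
    using sol by (simp add: bvp_solution_def)
  then have f_line: "continuous_on (range (\<lambda>t. x + t *\<^sub>R \<xi>) \<inter> (\<Omega> \<union> Gamma_minus_dir \<Omega> \<xi>)) (\<lambda>y. f (y, \<xi>))"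
    if "(x, \<xi>) \<in> phase_dom \<Omega>" for x \<xi> using that by auto
  obtain K where K: "\<And>z. z \<in> phase_dom \<Omega> \<Longrightarrow> \<bar>f z\<bar> \<le> K" using f_bdd by (auto simp: bounded_iff)
  interpret transport_problem \<Omega> \<Omega>\<^sub>0 "diameter (closure \<Omega>) + 1" \<mu>\<^sub>t M \<mu>\<^sub>s p f\<^sub>0 f B K
  proof unfold_locales
    show "open \<Omega>\<^sub>0" unfolding \<Omega>0 using sub by (auto simp: is_domain_def)
    show "\<Omega>\<^sub>0 \<subseteq> \<Omega>" unfolding \<Omega>0 using sub by blast
    \<comment> \<open>Density puts every point of \<open>\<Omega>\<close> outside
      \<open>\<Omega>\<^sub>0\<close> on the interfaces, which each line crosses only finitely
      often.\<close>
    have "closure \<Omega> \<subseteq> closure \<Omega>\<^sub>0" unfolding cover \<Omega>0 by (intro UN_least closure_mono) auto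
    then show "\<Omega> \<subseteq> closure \<Omega>\<^sub>0" using closure_subset by blast
    show "finite {t. 0 \<le> t \<and> x - t *\<^sub>R \<xi> \<in> frontier \<Omega>\<^sub>0}" if "x \<in> \<Omega>" "norm \<xi> = 1" for x \<xi>
    proof (rule finite_subset)
      have "\<forall>t\<ge>0. x - t *\<^sub>R \<xi> \<in> frontier \<Omega>\<^sub>0 \<longleftrightarrow> (\<exists>j\<in>{1..l x \<xi>}. t = T x \<xi> j)"
        using gc that by (simp add: generalized_convexity_def)
      then show "{t. 0 \<le> t \<and> x - t *\<^sub>R \<xi> \<in> frontier \<Omega>\<^sub>0} \<subseteq> T x \<xi> ` {1..l x \<xi>}" by auto
    qed auto
    show "\<mu>\<^sub>t x \<le> M" for x using M[of x] by simp
    show "2 \<le> DIM('a)" using dim by auto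
    show "\<mu>\<^sub>s x \<le> \<mu>\<^sub>t x" for x using mu_le[of x] mu_zero[of x] by (cases "x \<in> \<Omega>\<^sub>0") auto
    show "0 \<le> p x \<xi> \<xi>' \<and> p x \<xi> \<xi>' \<le> B" if "norm \<xi> = 1" "norm \<xi>' = 1" for x \<xi> \<xi>'
      using phase B[OF that] that by (simp add: phase_function_def)
    show "continuous_on (\<Omega>\<^sub>0 \<times> sphere 0 1 \<times> sphere 0 1) (\<lambda>(x, \<xi>, \<xi>'). p x \<xi> \<xi>')"
      using phase by (simp add: phase_function_def)
    show "(LINT \<xi>'|sphere_measure. p x \<xi> \<xi>') = 1" if "x \<in> \<Omega>\<^sub>0" "norm \<xi> = 1" for x \<xi>
      using phase that by (simp add: phase_function_def)
    show "f\<^sub>0 \<in> borel_measurable (restrict_space borel (inflow \<Omega>))" using f0m by (simp add: Gamma_minus_eq)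
    have "{x \<in> frontier \<Omega>. \<not> continuous_on (Gamma_minus_pt \<Omega> x) (\<lambda>\<xi>. f\<^sub>0 (x, \<xi>))}
        = {y \<in> frontier \<Omega>. \<not> continuous_on {\<xi>. (y, \<xi>) \<in> inflow \<Omega>} (\<lambda>\<xi>. f\<^sub>0 (y, \<xi>))}"
      by (auto simp: Gamma_minus_pt_eq)
    moreover have "AE \<xi> in sphere_borel. continuous_on {y. (y, \<xi>) \<in> inflow \<Omega>} (\<lambda>y. f\<^sub>0 (y, \<xi>))"
      if "AE \<xi> in sphere_measure. continuous_on (Gamma_minus_dir \<Omega> \<xi>) (\<lambda>x. f\<^sub>0 (x, \<xi>))"
    proof -
      \<comment> \<open>Every null set of the completion lies in a Borel null set, so both measures
        have the same almost-everywhere statements.\<close>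
      have "AE \<xi> in sphere_borel. continuous_on (Gamma_minus_dir \<Omega> \<xi>) (\<lambda>x. f\<^sub>0 (x, \<xi>))"
        using that unfolding sphere_measure_eq AE_completion_iff .
      then show ?thesis using AE_space by eventually_elim (simp add: Gamma_minus_dir_eq)
    qed
    ultimately show "surface_null {y \<in> frontier \<Omega>. \<not> continuous_on {\<xi>. (y, \<xi>) \<in> inflow \<Omega>} (\<lambda>\<xi>. f\<^sub>0 (y, \<xi>))}
      \<or> (AE \<xi> in sphere_borel. continuous_on {y. (y, \<xi>) \<in> inflow \<Omega>} (\<lambda>y. f\<^sub>0 (y, \<xi>)))"
      using reg by auto
    show "\<bar>f z\<bar> \<le> K" if "z \<in> \<Omega> \<times> sphere 0 1 \<union> inflow \<Omega>" for z
      using K that by (simp add: phase_dom_eq)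
    show "((\<lambda>t. f (x + t *\<^sub>R \<xi>, \<xi>)) has_real_derivative
      (\<mu>\<^sub>s x * (LINT \<xi>'|sphere_measure. p x \<xi> \<xi>' * f (x, \<xi>')) - \<mu>\<^sub>t x * f (x, \<xi>))) (at 0)"
      if "x \<in> \<Omega>\<^sub>0" "norm \<xi> = 1" for x \<xi>
    proof -
      have "((\<lambda>t. f (x + t *\<^sub>R \<xi>, \<xi>)) has_real_derivative dir_deriv f x \<xi>) (at 0)"
        unfolding dir_deriv_def using f_diff[OF that] by (simp add: DERIV_deriv_iff_real_differentiable)
      moreover have "dir_deriv f x \<xi> = \<mu>\<^sub>s x * (LINT \<xi>'|sphere_measure. p x \<xi> \<xi>' * f (x, \<xi>')) - \<mu>\<^sub>t x * f (x, \<xi>)"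
        using f_eq[OF that] by linarith
      ultimately show ?thesis by simp
    qed
    show "f z = f\<^sub>0 z" if "z \<in> inflow \<Omega>" for z
      using f_in that by (cases z) (simp add: Gamma_minus_eq)
    show "continuous_on {0..back_time \<Omega> x \<xi>} (\<lambda>t. f (x - t *\<^sub>R \<xi>, \<xi>))"
      if z: "(x, \<xi>) \<in> \<Omega> \<times> sphere 0 1 \<union> inflow \<Omega>" for x \<xi>
    proof -
      have c: "(x, \<xi>) \<in> chords \<Omega>" using z chords_interior inflow_chords by auto
      note \<xi> = chordsD(2)[OF c]
      \<comment> \<open>The closed backward chord stays where \<open>bvp_solution\<close> grants
        continuity: its inner points are in \<open>\<Omega>\<close> and its end is an inflow
        point.\<close>
      have "x - t *\<^sub>R \<xi> \<in> \<Omega> \<union> Gamma_minus_dir \<Omega> \<xi>" if "t \<in> {0..back_time \<Omega> x \<xi>}" for t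
      proof -
        consider "t = 0" | "t = back_time \<Omega> x \<xi>" | "0 < t" "t < back_time \<Omega> x \<xi>" using \<open>t \<in> _\<close> by fastforce
        then show ?thesis
        proof cases
          case 1 then show ?thesis using z by (auto simp: Gamma_minus_dir_eq[OF \<xi>])
        next
          case 2 then show ?thesis using entry_inflow[OF c] by (simp add: Gamma_minus_dir_eq[OF \<xi>] entry_def)
        next
          case 3 then show ?thesis using back_segment_in_dom[OF c] by blast
        qed
      qed
      moreover have "x - t *\<^sub>R \<xi> \<in> range (\<lambda>t. x + t *\<^sub>R \<xi>)" for t by (rule range_eqI[of _ _ "- t"]) simp
      ultimately have "(\<lambda>t. x - t *\<^sub>R \<xi>) ` {0..back_time \<Omega> x \<xi>} \<subseteq> range (\<lambda>t. x + t *\<^sub>R \<xi>) \<inter> (\<Omega> \<union> Gamma_minus_dir \<Omega> \<xi>)"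
        by blast
      moreover have "(x, \<xi>) \<in> phase_dom \<Omega>" using z by (simp add: phase_dom_eq)
      moreover have "continuous_on {0..back_time \<Omega> x \<xi>} (\<lambda>t. x - t *\<^sub>R \<xi>)" by (intro continuous_intros)
      ultimately show ?thesis using continuous_on_compose2[OF f_line] by blast
    qed
  qed (use mu_nonneg mu_zero mu_cont f_int in auto)
  have limits: "((\<lambda>t. f (x - t *\<^sub>R \<xi>, \<xi>)) \<longlongrightarrow> solution (x, \<xi>)) (at_right 0)" if "(x, \<xi>) \<in> Gamma_plus \<Omega>" for x \<xi>
    using that outflow_limit by (simp add: Gamma_plus_eq)
  have ext: "extension \<Omega> f z = solution z" if "z \<in> chords \<Omega>" for z
  proof -
    obtain x \<xi> where z: "z = (x, \<xi>)" by fastforce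
    show ?thesis
    proof (cases "z \<in> phase_dom \<Omega>")
      case True
      then show ?thesis using f_eq_solution[of z] by (simp add: extension_def z phase_dom_eq)
    next
      case False
      then have "(x, \<xi>) \<in> Gamma_plus \<Omega>" using that z by (auto simp: phase_dom_bar_eq[symmetric] phase_dom_bar_def)
      then show ?thesis using False tendsto_Lim[OF _ limits] by (simp add: extension_def z)
    qed
  qed
  have "disc (chords \<Omega>) (extension \<Omega> f) = disc (chords \<Omega>) solution"
  proof -
    \<comment> \<open>The two functions are known to agree on \<open>chords \<Omega>\<close>, so
      limits are compared within that set.\<close>
    have "continuous (at z within chords \<Omega>) (extension \<Omega> f) \<longleftrightarrow> continuous (at z within chords \<Omega>) solution"
      if "z \<in> chords \<Omega>" for z
    proof -
      have "(extension \<Omega> f \<longlongrightarrow> solution z) (at z within chords \<Omega>) \<longleftrightarrow> (solution \<longlongrightarrow> solution z) (at z within chords \<Omega>)"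
        by (rule tendsto_cong) (simp add: eventually_at_filter ext)
      then show ?thesis by (simp add: continuous_within ext[OF that])
    qed
    then show ?thesis by (auto simp: disc_def)
  qed
  moreover have "\<forall>(x, \<xi>)\<in>Gamma_plus \<Omega>. \<exists>L. ((\<lambda>t. f (x - t *\<^sub>R \<xi>, \<xi>)) \<longlongrightarrow> L) (at_right 0)"
    by clarify (rule exI, erule limits)
  ultimately show ?thesis
    using disc_solution by (simp add: phase_dom_bar_eq Gamma_minus_eq)
qed

end
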